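(* Let $G\subset S_n$ be a permutation group, acting on polynomial rings $k[\mathbf{x}]=k[x_1,\dots,x_n]$ over fields $k$ by permuting the indeterminates, and let $N$ be the subgroup of $G$ generated by the transpositions, double transpositions, and $3$-cycles contained in $G$. If $N\subsetneq G$, then for any $g\in G\setminus N$ such that the partition of $[n]=\{1,\dots,n\}$ into orbits of $g$ is not properly refined by the partition of $[n]$ into orbits of any other element of $G\setminus N$, the order of $g$ is a prime power $p^\ell$, where $p$ has the property that $k[\mathbf{x}]^G$ is not Cohen-Macaulay for every field $k$ of characteristic $p$.
   Context: A double transposition is a product of two disjoint transpositions. The orbits of an element $g\in S_n$ are the orbits of the cyclic group $\langle g\rangle$ on $[n]$. A partition $\pi$ of $[n]$ properly refines a partition $\tau$ if every block of $\pi$ is contained in a block of $\tau$ and $\pi\neq\tau$. $k[\mathbf{x}]^G$ is the subring of $G$-invariants. A commutative ring is Cohen-Macaulay if it is noetherian and each of its localizations at maximal (equivalently, prime) ideals has depth equal to its dimension. *)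

theory Defs
  imports
    "HOL-Algebra.Sym_Groups"
    "HOL-Algebra.Group_Action"
    "HOL-Algebra.Multiplicative_Group"
    "HOL-Algebra.QuotRing"
    "HOL-Algebra.Ring_Divisibility"
    "HOL-Computational_Algebra.Computational_Algebra"
    "HOL-Library.Poly_Mapping"
    "HOL-Library.Extended_Nat"
    "HOL-Library.Disjoint_Sets"
begin

section \<open>Permutation groups\<close>

definition transpositions :: "nat \<Rightarrow> (nat \<Rightarrow> nat) set" where
  "transpositions n = {transpose a b | a b. distinct [a, b] \<and> {a, b} \<subseteq> {1..n}}"

definition double_transpositions :: "nat \<Rightarrow> (nat \<Rightarrow> nat) set" where
  "double_transpositions n =
     {transpose a b \<circ> transpose c d | a b c d. distinct [a, b, c, d] \<and> {a, b, c, d} \<subseteq> {1..n}}"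

definition small_subgroup :: "nat \<Rightarrow> (nat \<Rightarrow> nat) set \<Rightarrow> (nat \<Rightarrow> nat) set" where
  "small_subgroup n G =
     generate (sym_group n)
       (G \<inter> (transpositions n \<union> double_transpositions n \<union> three_cycles n))"

definition orbit_partition :: "nat \<Rightarrow> (nat \<Rightarrow> nat) \<Rightarrow> nat set set" where
  "orbit_partition n g =
     orbits ((sym_group n)\<lparr>carrier := generate (sym_group n) {g}\<rparr>) {1..n} (\<lambda>h. h)"

lemma partition_on_orbit_partition:
  assumes "g permutes {1..n}"
  shows "partition_on {1..n} (orbit_partition n g)"
proof -
  let ?H = "generate (sym_group n) {g}"
  interpret S: group "sym_group n" by (rule sym_group_is_group)
  have gc: "{g} \<subseteq> carrier (sym_group n)" using assms by (simp add: sym_group_carrier)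
  interpret H: subgroup ?H "sym_group n" by (rule S.generate_is_subgroup[OF gc])
  have perm: "h permutes {1..n}" if "h \<in> ?H" for h
    using H.mem_carrier[OF that] by (simp add: sym_group_carrier)
  have one: "id \<in> ?H" using H.one_closed by (simp add: sym_group_one)
  have comp: "h \<circ> k \<in> ?H" if "h \<in> ?H" "k \<in> ?H" for h k
    using H.m_closed[OF that] by (simp add: sym_group_mult)
  have inv: "\<exists>k \<in> ?H. k \<circ> h = id" if "h \<in> ?H" for h
    using H.m_inv_closed[OF that] S.l_inv[OF H.mem_carrier[OF that]]
    by (auto simp: sym_group_mult sym_group_one)
  have part: "orbit_partition n g = (\<lambda>x. {h x | h. h \<in> ?H}) ` {1..n}"
    by (auto simp: orbit_partition_def orbits_def orbit_def)
  show ?thesis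
    unfolding part
  proof (rule partition_onI)
    show "{} \<notin> (\<lambda>x. {h x | h. h \<in> ?H}) ` {1..n}"
      using one by blast
    have "h x \<in> {1..n}" if "x \<in> {1..n}" "h \<in> ?H" for x h
      using permutes_in_image[OF perm[OF that(2)], of x] that(1) by simp
    moreover have "x \<in> {h x | h. h \<in> ?H}" for x
      using one by (auto intro: exI[of _ id])
    ultimately show "\<Union> ((\<lambda>x. {h x | h. h \<in> ?H}) ` {1..n}) = {1..n}" by blast
    have sub: "{h x | h. h \<in> ?H} \<subseteq> {h y | h. h \<in> ?H}"
      if hk: "h \<in> ?H" "k \<in> ?H" "h x = k y" for h k x y
    proof
      fix z assume "z \<in> {h x | h. h \<in> ?H}"
      then obtain l where l: "l \<in> ?H" "z = l x" by blast
      obtain i where i: "i \<in> ?H" "i \<circ> h = id" using inv[OF hk(1)] by blast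
      have "z = (l \<circ> (i \<circ> k)) y"
        using l(2) hk(3) fun_cong[OF i(2), of x] by simp
      then show "z \<in> {h y | h. h \<in> ?H}"
        using comp[OF l(1) comp[OF i(1) hk(2)]] by blast
    qed
    show "disjnt p q" if p: "p \<in> (\<lambda>x. {h x | h. h \<in> ?H}) ` {1..n}"
      and q: "q \<in> (\<lambda>x. {h x | h. h \<in> ?H}) ` {1..n}" and "p \<noteq> q" for p q
    proof (rule ccontr)
      obtain x y where xy: "p = {h x | h. h \<in> ?H}" "q = {h y | h. h \<in> ?H}"
        using p q by blast
      assume "\<not> disjnt p q"
      then obtain h k where "h \<in> ?H" "k \<in> ?H" "h x = k y"
        unfolding disjnt_def xy by auto
      then have "p = q"
        unfolding xy using sub[of h k x y] sub[of k h y x] by simp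
      then show False using \<open>p \<noteq> q\<close> by simp
    qed
  qed
qed

definition properly_refines :: "'a set \<Rightarrow> 'a set set \<Rightarrow> 'a set set \<Rightarrow> bool" where
  "properly_refines A P Q \<longleftrightarrow> refines A P Q \<and> P \<noteq> Q"


section \<open>Cohen-Macaulay rings\<close>

subsection \<open>Localization at a prime ideal\<close>

definition loc_rel :: "('a, 'm) ring_scheme \<Rightarrow> 'a set \<Rightarrow> (('a \<times> 'a) \<times> ('a \<times> 'a)) set" where
  "loc_rel R P =
     {((a, s), (b, t)). a \<in> carrier R \<and> s \<in> carrier R - P \<and> b \<in> carrier R \<and> t \<in> carrier R - P \<and>
        (\<exists>u \<in> carrier R - P. u \<otimes>\<^bsub>R\<^esub> (a \<otimes>\<^bsub>R\<^esub> t) = u \<otimes>\<^bsub>R\<^esub> (b \<otimes>\<^bsub>R\<^esub> s))}"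

definition loc_frac :: "('a, 'm) ring_scheme \<Rightarrow> 'a set \<Rightarrow> 'a \<Rightarrow> 'a \<Rightarrow> ('a \<times> 'a) set" where
  "loc_frac R P a s = loc_rel R P `` {(a, s)}"

text \<open>As in \<^const>\<open>rcoset_mult\<close>, the operations are unions over all representatives; by
  \<open>loc_mult\<close> and \<open>loc_add\<close> below, the classes in these unions coincide.\<close>

definition localization :: "('a, 'm) ring_scheme \<Rightarrow> 'a set \<Rightarrow> ('a \<times> 'a) set ring" where
  "localization R P =
     \<lparr>carrier = (carrier R \<times> (carrier R - P)) // loc_rel R P,
      mult = (\<lambda>X Y. \<Union>(a, s)\<in>X. \<Union>(b, t)\<in>Y. loc_frac R P (a \<otimes>\<^bsub>R\<^esub> b) (s \<otimes>\<^bsub>R\<^esub> t)),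
      one = loc_frac R P \<one>\<^bsub>R\<^esub> \<one>\<^bsub>R\<^esub>,
      zero = loc_frac R P \<zero>\<^bsub>R\<^esub> \<one>\<^bsub>R\<^esub>,
      add = (\<lambda>X Y. \<Union>(a, s)\<in>X. \<Union>(b, t)\<in>Y.
               loc_frac R P (a \<otimes>\<^bsub>R\<^esub> t \<oplus>\<^bsub>R\<^esub> b \<otimes>\<^bsub>R\<^esub> s) (s \<otimes>\<^bsub>R\<^esub> t))\<rparr>"

lemma UN_UN_const:
  assumes "p \<in> X" "q \<in> Y"
    and "\<And>a s b t. (a, s) \<in> X \<Longrightarrow> (b, t) \<in> Y \<Longrightarrow> F a s b t = C"
  shows "(\<Union>(a, s)\<in>X. \<Union>(b, t)\<in>Y. F a s b t) = C"
proof -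
  have "(\<Union>(a, s)\<in>X. \<Union>(b, t)\<in>Y. F a s b t) = (\<Union>(a, s)\<in>X. \<Union>(b, t)\<in>Y. C)"
    using assms(3) by (intro SUP_cong refl) (auto simp: assms(3))
  also have "\<dots> = C"
    using assms(1,2) by (cases p, cases q) auto
  finally show ?thesis .
qed

context primeideal
begin

lemma one_compl: "\<one> \<in> carrier R - I"
  using I_notcarr one_imp_carrier by auto

lemma mult_compl: "s \<in> carrier R - I \<Longrightarrow> t \<in> carrier R - I \<Longrightarrow> s \<otimes> t \<in> carrier R - I"
  using I_prime by auto

lemma loc_rel_iff:
  "((a, s), (b, t)) \<in> loc_rel R I \<longleftrightarrow>
     a \<in> carrier R \<and> s \<in> carrier R - I \<and> b \<in> carrier R \<and> t \<in> carrier R - I \<and>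
     (\<exists>u \<in> carrier R - I. u \<otimes> (a \<otimes> t) = u \<otimes> (b \<otimes> s))"
  by (simp add: loc_rel_def)

lemma equiv_loc_rel: "equiv (carrier R \<times> (carrier R - I)) (loc_rel R I)"
proof (rule equivI)
  show "loc_rel R I \<subseteq> (carrier R \<times> (carrier R - I)) \<times> (carrier R \<times> (carrier R - I))"
    by (auto simp: loc_rel_def)
  show "refl_on (carrier R \<times> (carrier R - I)) (loc_rel R I)"
    using one_compl by (auto simp: refl_on_def loc_rel_def)
  show "sym (loc_rel R I)"
    by (rule symI) (auto simp: loc_rel_def intro: sym)
  show "trans (loc_rel R I)"
  proof (rule transI, clarify)
    fix a s b t c w
    assume 1: "((a, s), (b, t)) \<in> loc_rel R I" and 2: "((b, t), (c, w)) \<in> loc_rel R I"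
    from 1 obtain u where u: "u \<in> carrier R - I" "u \<otimes> (a \<otimes> t) = u \<otimes> (b \<otimes> s)"
      by (auto simp: loc_rel_iff)
    from 2 obtain v where v: "v \<in> carrier R - I" "v \<otimes> (b \<otimes> w) = v \<otimes> (c \<otimes> t)"
      by (auto simp: loc_rel_iff)
    have cl: "a \<in> carrier R" "s \<in> carrier R" "b \<in> carrier R" "t \<in> carrier R"
      "c \<in> carrier R" "w \<in> carrier R" "u \<in> carrier R" "v \<in> carrier R"
      using 1 2 u v by (auto simp: loc_rel_iff)
    have "(u \<otimes> v \<otimes> t) \<otimes> (a \<otimes> w) = v \<otimes> w \<otimes> (u \<otimes> (a \<otimes> t))"
      using cl by (simp add: m_ac)
    also have "\<dots> = u \<otimes> s \<otimes> (v \<otimes> (b \<otimes> w))"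
      using cl u(2) by (simp add: m_ac)
    also have "\<dots> = (u \<otimes> v \<otimes> t) \<otimes> (c \<otimes> s)"
      using cl v(2) by (simp add: m_ac)
    finally have "(u \<otimes> v \<otimes> t) \<otimes> (a \<otimes> w) = (u \<otimes> v \<otimes> t) \<otimes> (c \<otimes> s)" .
    moreover have "u \<otimes> v \<otimes> t \<in> carrier R - I"
      using 1 u(1) v(1) mult_compl by (auto simp: loc_rel_iff)
    ultimately show "((a, s), (c, w)) \<in> loc_rel R I"
      using 1 2 unfolding loc_rel_iff by blast
  qed
qed

lemma loc_frac_eq_iff:
  assumes "a \<in> carrier R" "s \<in> carrier R - I" "b \<in> carrier R" "t \<in> carrier R - I"
  shows "loc_frac R I a s = loc_frac R I b t \<longleftrightarrow>
           (\<exists>u \<in> carrier R - I. u \<otimes> (a \<otimes> t) = u \<otimes> (b \<otimes> s))"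
  unfolding loc_frac_def
  using eq_equiv_class_iff[OF equiv_loc_rel, of "(a, s)" "(b, t)"] assms
  by (auto simp: loc_rel_iff)

lemma loc_frac_eqI:
  assumes "a \<in> carrier R" "s \<in> carrier R - I" "b \<in> carrier R" "t \<in> carrier R - I"
    "u \<in> carrier R - I" "u \<otimes> (a \<otimes> t) = u \<otimes> (b \<otimes> s)"
  shows "loc_frac R I a s = loc_frac R I b t"
  using assms by (subst loc_frac_eq_iff) auto

lemma loc_frac_eqI':
  assumes "a \<in> carrier R" "s \<in> carrier R - I" "b \<in> carrier R" "t \<in> carrier R - I"
    "a \<otimes> t = b \<otimes> s"
  shows "loc_frac R I a s = loc_frac R I b t"
  using loc_frac_eqI[OF assms(1-4) one_compl] assms(5) by simp

lemma loc_carrier_iff: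
  "X \<in> carrier (localization R I) \<longleftrightarrow>
     (\<exists>a \<in> carrier R. \<exists>s \<in> carrier R - I. X = loc_frac R I a s)"
  by (auto simp: localization_def quotient_def loc_frac_def)

lemma loc_carrierE:
  assumes "X \<in> carrier (localization R I)"
  obtains a s where "a \<in> carrier R" "s \<in> carrier R - I" "X = loc_frac R I a s"
  using assms loc_carrier_iff by blast

lemma loc_mult:
  assumes "a \<in> carrier R" "s \<in> carrier R - I" "b \<in> carrier R" "t \<in> carrier R - I"
  shows "loc_frac R I a s \<otimes>\<^bsub>localization R I\<^esub> loc_frac R I b t =
           loc_frac R I (a \<otimes> b) (s \<otimes> t)"
proof -
  have well: "loc_frac R I (a' \<otimes> b') (s' \<otimes> t') = loc_frac R I (a \<otimes> b) (s \<otimes> t)"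
    if "(a', s') \<in> loc_frac R I a s" "(b', t') \<in> loc_frac R I b t" for a' s' b' t'
  proof -
    from that obtain u v where u: "u \<in> carrier R - I" "u \<otimes> (a \<otimes> s') = u \<otimes> (a' \<otimes> s)"
      and v: "v \<in> carrier R - I" "v \<otimes> (b \<otimes> t') = v \<otimes> (b' \<otimes> t)"
      by (auto simp: loc_frac_def loc_rel_iff)
    have cl: "a' \<in> carrier R" "b' \<in> carrier R" "s' \<in> carrier R - I" "t' \<in> carrier R - I"
      using that by (auto simp: loc_frac_def loc_rel_iff)
    have "(u \<otimes> v) \<otimes> ((a' \<otimes> b') \<otimes> (s \<otimes> t)) = (u \<otimes> (a' \<otimes> s)) \<otimes> (v \<otimes> (b' \<otimes> t))"
      using assms cl u(1) v(1) by (simp add: m_ac)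
    also have "\<dots> = (u \<otimes> (a \<otimes> s')) \<otimes> (v \<otimes> (b \<otimes> t'))"
      using u(2) v(2) by simp
    also have "\<dots> = (u \<otimes> v) \<otimes> ((a \<otimes> b) \<otimes> (s' \<otimes> t'))"
      using assms cl u(1) v(1) by (simp add: m_ac)
    finally have eq: "(u \<otimes> v) \<otimes> ((a' \<otimes> b') \<otimes> (s \<otimes> t)) = (u \<otimes> v) \<otimes> ((a \<otimes> b) \<otimes> (s' \<otimes> t'))" .
    show ?thesis
      by (rule loc_frac_eqI[OF _ _ _ _ mult_compl[OF u(1) v(1)] eq])
        (use assms cl mult_compl[of s t] mult_compl[of s' t'] in simp_all)
  qed
  have "((a, s), (a, s)) \<in> loc_rel R I" "((b, t), (b, t)) \<in> loc_rel R I"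
    using assms one_compl by (auto simp: loc_rel_iff)
  then have "(a, s) \<in> loc_frac R I a s" "(b, t) \<in> loc_frac R I b t"
    by (simp_all add: loc_frac_def)
  from UN_UN_const[OF this well] show ?thesis
    by (simp add: localization_def loc_frac_def)
qed

lemma loc_add:
  assumes "a \<in> carrier R" "s \<in> carrier R - I" "b \<in> carrier R" "t \<in> carrier R - I"
  shows "loc_frac R I a s \<oplus>\<^bsub>localization R I\<^esub> loc_frac R I b t =
           loc_frac R I (a \<otimes> t \<oplus> b \<otimes> s) (s \<otimes> t)"
proof -
  have well: "loc_frac R I (a' \<otimes> t' \<oplus> b' \<otimes> s') (s' \<otimes> t') = loc_frac R I (a \<otimes> t \<oplus> b \<otimes> s) (s \<otimes> t)"
    if "(a', s') \<in> loc_frac R I a s" "(b', t') \<in> loc_frac R I b t" for a' s' b' t'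
  proof -
    from that obtain u v where u: "u \<in> carrier R - I" "u \<otimes> (a \<otimes> s') = u \<otimes> (a' \<otimes> s)"
      and v: "v \<in> carrier R - I" "v \<otimes> (b \<otimes> t') = v \<otimes> (b' \<otimes> t)"
      by (auto simp: loc_frac_def loc_rel_iff)
    have cl: "a' \<in> carrier R" "b' \<in> carrier R" "s' \<in> carrier R - I" "t' \<in> carrier R - I"
      using that by (auto simp: loc_frac_def loc_rel_iff)
    have cl': "a' \<in> carrier R" "b' \<in> carrier R" "s' \<in> carrier R" "t' \<in> carrier R"
      "a \<in> carrier R" "b \<in> carrier R" "s \<in> carrier R" "t \<in> carrier R"
      "u \<in> carrier R" "v \<in> carrier R"
      using cl assms u v by auto
    have "(u \<otimes> v) \<otimes> ((a' \<otimes> t' \<oplus> b' \<otimes> s') \<otimes> (s \<otimes> t)) =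
          (u \<otimes> (a' \<otimes> s)) \<otimes> (v \<otimes> (t \<otimes> t')) \<oplus> (v \<otimes> (b' \<otimes> t)) \<otimes> (u \<otimes> (s \<otimes> s'))"
      using cl' by (simp add: m_ac l_distr r_distr)
    also have "\<dots> = (u \<otimes> (a \<otimes> s')) \<otimes> (v \<otimes> (t \<otimes> t')) \<oplus> (v \<otimes> (b \<otimes> t')) \<otimes> (u \<otimes> (s \<otimes> s'))"
      using u(2) v(2) by simp
    also have "\<dots> = (u \<otimes> v) \<otimes> ((a \<otimes> t \<oplus> b \<otimes> s) \<otimes> (s' \<otimes> t'))"
      using cl' by (simp add: m_ac l_distr r_distr)
    finally have eq: "(u \<otimes> v) \<otimes> ((a' \<otimes> t' \<oplus> b' \<otimes> s') \<otimes> (s \<otimes> t)) =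
      (u \<otimes> v) \<otimes> ((a \<otimes> t \<oplus> b \<otimes> s) \<otimes> (s' \<otimes> t'))" .
    show ?thesis
      by (rule loc_frac_eqI[OF _ _ _ _ mult_compl[OF u(1) v(1)] eq])
        (use cl cl' assms mult_compl[of s t] mult_compl[of s' t'] in simp_all)
  qed
  have "((a, s), (a, s)) \<in> loc_rel R I" "((b, t), (b, t)) \<in> loc_rel R I"
    using assms one_compl by (auto simp: loc_rel_iff)
  then have "(a, s) \<in> loc_frac R I a s" "(b, t) \<in> loc_frac R I b t"
    by (simp_all add: loc_frac_def)
  from UN_UN_const[OF this well] show ?thesis
    by (simp add: localization_def loc_frac_def)
qed

lemma loc_one: "\<one>\<^bsub>localization R I\<^esub> = loc_frac R I \<one> \<one>"
  and loc_zero: "\<zero>\<^bsub>localization R I\<^esub> = loc_frac R I \<zero> \<one>"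
  by (simp_all add: localization_def)

lemma loc_frac_closed:
  "a \<in> carrier R \<Longrightarrow> s \<in> carrier R - I \<Longrightarrow> loc_frac R I a s \<in> carrier (localization R I)"
  using loc_carrier_iff by blast

lemma localization_cring: "cring (localization R I)"
proof (rule cringI)
  note [simp] = loc_mult loc_add loc_one loc_zero one_compl[simplified] loc_frac_closed
  have [simp]: "s \<otimes> t \<notin> I" if "s \<in> carrier R" "t \<in> carrier R" "s \<notin> I" "t \<notin> I" for s t
    using that mult_compl by blast
  show "abelian_group (localization R I)"
  proof (rule abelian_groupI)
    fix x assume "x \<in> carrier (localization R I)"
    then obtain a s where x: "a \<in> carrier R" "s \<in> carrier R - I" "x = loc_frac R I a s"
      by (rule loc_carrierE)
    have "loc_frac R I (\<ominus> a) s \<oplus>\<^bsub>localization R I\<^esub> x = loc_frac R I \<zero> (s \<otimes> s)"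
      using x by (simp add: l_minus l_neg)
    also have "\<dots> = \<zero>\<^bsub>localization R I\<^esub>"
      unfolding loc_zero by (rule loc_frac_eqI') (use x in simp_all)
    finally show "\<exists>y\<in>carrier (localization R I). y \<oplus>\<^bsub>localization R I\<^esub> x = \<zero>\<^bsub>localization R I\<^esub>"
      using x loc_frac_closed[of "\<ominus> a" s] by blast
  qed (auto elim!: loc_carrierE intro!: loc_frac_eqI' simp: m_ac l_distr r_distr a_ac)
  show "comm_monoid (localization R I)"
    by (rule comm_monoidI) (auto elim!: loc_carrierE intro!: loc_frac_eqI' simp: m_ac)
  fix x y z
  assume xyz: "x \<in> carrier (localization R I)" "y \<in> carrier (localization R I)"
    "z \<in> carrier (localization R I)"
  obtain a s where x: "a \<in> carrier R" "s \<in> carrier R - I" "x = loc_frac R I a s"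
    using xyz(1) by (rule loc_carrierE)
  obtain b t where y: "b \<in> carrier R" "t \<in> carrier R - I" "y = loc_frac R I b t"
    using xyz(2) by (rule loc_carrierE)
  obtain c w where z: "c \<in> carrier R" "w \<in> carrier R - I" "z = loc_frac R I c w"
    using xyz(3) by (rule loc_carrierE)
  show "(x \<oplus>\<^bsub>localization R I\<^esub> y) \<otimes>\<^bsub>localization R I\<^esub> z =
    x \<otimes>\<^bsub>localization R I\<^esub> z \<oplus>\<^bsub>localization R I\<^esub> y \<otimes>\<^bsub>localization R I\<^esub> z"
    using x y z by (simp, intro loc_frac_eqI') (simp_all add: m_ac l_distr r_distr)
qed


definition loc_max_ideal :: "('a \<times> 'a) set set" where
  "loc_max_ideal = {loc_frac R I a s | a s. a \<in> I \<and> s \<in> carrier R - I}"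

lemma loc_frac_in_max_iff:
  assumes "a \<in> carrier R" "s \<in> carrier R - I"
  shows "loc_frac R I a s \<in> loc_max_ideal \<longleftrightarrow> a \<in> I"
proof
  assume "loc_frac R I a s \<in> loc_max_ideal"
  then obtain b t where b: "b \<in> I" "t \<in> carrier R - I" "loc_frac R I a s = loc_frac R I b t"
    by (auto simp: loc_max_ideal_def)
  then obtain u where u: "u \<in> carrier R - I" "u \<otimes> (a \<otimes> t) = u \<otimes> (b \<otimes> s)"
    using loc_frac_eq_iff[of a s b t, THEN iffD1] assms Icarr by metis
  have "b \<otimes> s \<in> I"
    using I_r_closed[OF b(1), of s] assms by simp
  then have "u \<otimes> (b \<otimes> s) \<in> I"
    using I_l_closed[of "b \<otimes> s" u] u(1) by simp
  then have "u \<otimes> (a \<otimes> t) \<in> I"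
    using u(2) by simp
  then have "a \<otimes> t \<in> I"
    using I_prime[of u "a \<otimes> t"] assms(1) u(1) b(2) by simp
  then show "a \<in> I"
    using I_prime[of a t] assms(1) b(2) by simp
next
  assume "a \<in> I"
  then show "loc_frac R I a s \<in> loc_max_ideal"
    unfolding loc_max_ideal_def using assms(2) by blast
qed

lemma ideal_loc_max_ideal: "ideal loc_max_ideal (localization R I)"
proof -
  interpret L: cring "localization R I" by (rule localization_cring)
  have sub: "loc_max_ideal \<subseteq> carrier (localization R I)"
  proof
    fix x assume "x \<in> loc_max_ideal"
    then obtain a s where "a \<in> I" "s \<in> carrier R - I" "x = loc_frac R I a s"
      unfolding loc_max_ideal_def by blast
    then show "x \<in> carrier (localization R I)"
      using loc_frac_closed[of a s] Icarr[of a] by simp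
  qed
  have zero: "\<zero>\<^bsub>localization R I\<^esub> \<in> loc_max_ideal"
    unfolding loc_zero using loc_frac_in_max_iff[of \<zero> \<one>] one_compl by simp
  have mult: "y \<otimes>\<^bsub>localization R I\<^esub> x \<in> loc_max_ideal"
    if x: "x \<in> loc_max_ideal" and y: "y \<in> carrier (localization R I)" for x y
  proof -
    obtain a s where a: "a \<in> I" "s \<in> carrier R - I" "x = loc_frac R I a s"
      using x by (auto simp: loc_max_ideal_def)
    obtain b t where b: "b \<in> carrier R" "t \<in> carrier R - I" "y = loc_frac R I b t"
      using y by (rule loc_carrierE)
    have "a \<in> carrier R" using a(1) a_subset by blast
    then show ?thesis
      using a b loc_mult[of b t a s] mult_compl[of t s]
        loc_frac_in_max_iff[of "b \<otimes> a" "t \<otimes> s"] I_l_closed[OF a(1) b(1)] by simp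
  qed
  have add: "x \<oplus>\<^bsub>localization R I\<^esub> y \<in> loc_max_ideal"
    if x: "x \<in> loc_max_ideal" and y: "y \<in> loc_max_ideal" for x y
  proof -
    obtain a s where a: "a \<in> I" "s \<in> carrier R - I" "x = loc_frac R I a s"
      using x by (auto simp: loc_max_ideal_def)
    obtain b t where b: "b \<in> I" "t \<in> carrier R - I" "y = loc_frac R I b t"
      using y by (auto simp: loc_max_ideal_def)
    have "a \<in> carrier R" "b \<in> carrier R" using Icarr a(1) b(1) by blast+
    moreover have "a \<otimes> t \<oplus> b \<otimes> s \<in> I"
      using a(2) b(2) I_r_closed[OF a(1), of t] I_r_closed[OF b(1), of s]
      by (simp add: additive_subgroup.a_closed[OF is_additive_subgroup])
    ultimately show ?thesis
      using a b loc_add[of a s b t] mult_compl[of s t]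
        loc_frac_in_max_iff[of "a \<otimes> t \<oplus> b \<otimes> s" "s \<otimes> t"] by simp
  qed
  have neg: "\<ominus>\<^bsub>localization R I\<^esub> x \<in> loc_max_ideal" if x: "x \<in> loc_max_ideal" for x
  proof -
    have "\<ominus>\<^bsub>localization R I\<^esub> x = (\<ominus>\<^bsub>localization R I\<^esub> \<one>\<^bsub>localization R I\<^esub>) \<otimes>\<^bsub>localization R I\<^esub> x"
      using x sub L.l_minus[of "\<one>\<^bsub>localization R I\<^esub>" x] by (simp add: subsetD)
    then show ?thesis
      using mult[OF x, of "\<ominus>\<^bsub>localization R I\<^esub> \<one>\<^bsub>localization R I\<^esub>"] by simp
  qed
  show ?thesis
  proof (rule idealI)
    show "subgroup loc_max_ideal (add_monoid (localization R I))"
    proof (rule group.subgroupI[OF abelian_group.a_group[OF L.abelian_group_axioms]])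
      show "loc_max_ideal \<subseteq> carrier (add_monoid (localization R I))"
        using sub by simp
      show "loc_max_ideal \<noteq> {}"
        using zero by blast
      show "inv\<^bsub>add_monoid (localization R I)\<^esub> x \<in> loc_max_ideal"
        if "x \<in> loc_max_ideal" for x
        using neg[OF that] by (simp add: a_inv_def)
      show "x \<otimes>\<^bsub>add_monoid (localization R I)\<^esub> y \<in> loc_max_ideal"
        if "x \<in> loc_max_ideal" "y \<in> loc_max_ideal" for x y
        using add[OF that] by simp
    qed
    show "x \<otimes>\<^bsub>localization R I\<^esub> a \<in> loc_max_ideal"
      if "a \<in> loc_max_ideal" "x \<in> carrier (localization R I)" for a x
      using mult that by blast
    show "a \<otimes>\<^bsub>localization R I\<^esub> x \<in> loc_max_ideal"
      if "a \<in> loc_max_ideal" "x \<in> carrier (localization R I)" for a x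
      using mult[OF that] L.m_comm[of a x] that sub by (simp add: subsetD)
  qed (rule L.ring_axioms)
qed

lemma ideal_subset_loc_max_ideal:
  assumes J: "ideal J (localization R I)" "J \<noteq> carrier (localization R I)"
  shows "J \<subseteq> loc_max_ideal"
proof
  fix x assume xJ: "x \<in> J"
  then obtain a s where x: "a \<in> carrier R" "s \<in> carrier R - I" "x = loc_frac R I a s"
    using ideal.Icarr[OF J(1) xJ] by (auto elim: loc_carrierE)
  have "a \<in> I"
  proof (rule ccontr)
    assume "a \<notin> I"
    then have a: "a \<in> carrier R - I" using x(1) by simp
    have "loc_frac R I (s \<otimes> a) (a \<otimes> s) = loc_frac R I \<one> \<one>"
      by (rule loc_frac_eqI')
        (use x(1,2) a one_compl mult_compl[of a s] in \<open>simp_all add: m_comm\<close>)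
    then have "loc_frac R I s a \<otimes>\<^bsub>localization R I\<^esub> x = \<one>\<^bsub>localization R I\<^esub>"
      using loc_mult[of s a a s] x a by (simp add: loc_one)
    then have "\<one>\<^bsub>localization R I\<^esub> \<in> J"
      using ideal.I_l_closed[OF J(1) xJ loc_frac_closed[of s a]] x(2) a by simp
    then show False using J(2) ideal.one_imp_carrier[OF J(1)] by blast
  qed
  then show "x \<in> loc_max_ideal"
    using loc_frac_in_max_iff x by simp
qed

theorem maximalideal_localization_iff:
  "maximalideal M (localization R I) \<longleftrightarrow> M = loc_max_ideal"
proof -
  interpret L: cring "localization R I" by (rule localization_cring)
  have ne: "carrier (localization R I) \<noteq> loc_max_ideal"
    using loc_frac_in_max_iff[of \<one> \<one>] loc_frac_closed[of \<one> \<one>] one_compl by auto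
  show ?thesis
  proof
    assume M: "maximalideal M (localization R I)"
    have M_ideal: "ideal M (localization R I)"
      by (rule maximalideal.axioms(1)[OF M])
    have "M \<subseteq> loc_max_ideal"
      by (rule ideal_subset_loc_max_ideal[OF M_ideal])
        (use maximalideal.I_notcarr[OF M] in simp)
    moreover have "loc_max_ideal \<subseteq> carrier (localization R I)"
      using ideal.Icarr[OF ideal_loc_max_ideal] by (rule subsetI)
    ultimately show "M = loc_max_ideal"
      using maximalideal.I_maximal[OF M ideal_loc_max_ideal] ne by simp
  next
    assume "M = loc_max_ideal"
    moreover have "maximalideal loc_max_ideal (localization R I)"
    proof (rule maximalidealI[OF ideal_loc_max_ideal ne])
      fix J assume "ideal J (localization R I)" "loc_max_ideal \<subseteq> J"
      then show "J = loc_max_ideal \<or> J = carrier (localization R I)"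
        using ideal_subset_loc_max_ideal[of J] by (cases "J = carrier (localization R I)") simp_all
    qed
    ultimately show "maximalideal M (localization R I)" by simp
  qed
qed

end


subsection \<open>Dimension and depth\<close>

definition krull_dim :: "('a, 'm) ring_scheme \<Rightarrow> enat" where
  "krull_dim R =
     Sup {enat n | n p. (\<forall>i\<le>n. primeideal (p i) R) \<and> (\<forall>i<n. p i \<subset> (p (Suc i) :: 'a set))}"

definition nonzerodivisor :: "('a, 'm) ring_scheme \<Rightarrow> 'a \<Rightarrow> bool" where
  "nonzerodivisor R x \<longleftrightarrow>
     x \<in> carrier R \<and> (\<forall>y \<in> carrier R. x \<otimes>\<^bsub>R\<^esub> y = \<zero>\<^bsub>R\<^esub> \<longrightarrow> y = \<zero>\<^bsub>R\<^esub>)"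

text \<open>\<open>J +>\<^bsub>R\<^esub> x\<close> is the residue class of \<open>x\<close> in the quotient by
  \<open>J = (x\<^sub>1, \<dots>, x\<^bsub>i-1\<^esub>)\<close>; list indices start at 0.\<close>

definition regular_sequence :: "('a, 'm) ring_scheme \<Rightarrow> 'a list \<Rightarrow> bool" where
  "regular_sequence R xs \<longleftrightarrow>
     set xs \<subseteq> carrier R \<and>
     (\<forall>i<length xs. let J = Idl\<^bsub>R\<^esub> (set (take i xs)) in nonzerodivisor (R Quot J) (J +>\<^bsub>R\<^esub> xs ! i)) \<and>
     Idl\<^bsub>R\<^esub> (set xs) \<noteq> carrier R"

text \<open>The depth of a local ring, applied only to localizations at prime ideals; there
  \<open>maximalideal_localization_iff\<close> shows that the definite description is proper.\<close>

definition depth :: "('a, 'm) ring_scheme \<Rightarrow> enat" where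
  "depth R =
     Sup {enat (length xs) | xs. regular_sequence R xs \<and> set xs \<subseteq> (THE M. maximalideal M R)}"

definition cohen_macaulay :: "('a, 'm) ring_scheme \<Rightarrow> bool" where
  "cohen_macaulay R \<longleftrightarrow>
     cring R \<and> noetherian_ring R \<and>
     (\<forall>M. maximalideal M R \<longrightarrow> depth (localization R M) = krull_dim (localization R M))"


section \<open>Rings of permutation invariants\<close>

text \<open>Polynomials are finitely supported maps from monomials to coefficients, and a monomial is
  the finitely supported map giving the exponents of the indeterminates, of which
  \<open>x\<^sub>1, \<dots>, x\<^sub>n\<close> are those allowed in \<open>k[x\<^sub>1, \<dots>, x\<^sub>n]\<close>.\<close>

type_synonym 'k mpoly = "(nat \<Rightarrow>\<^sub>0 nat) \<Rightarrow>\<^sub>0 'k"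

definition poly_ring :: "nat \<Rightarrow> 'k::field mpoly ring" where
  "poly_ring n =
     \<lparr>carrier = {f. \<forall>m \<in> Poly_Mapping.keys f. Poly_Mapping.keys m \<subseteq> {1..n}},
      mult = (*), one = 1, zero = 0, add = (+)\<rparr>"

text \<open>Permuting the indeterminates by \<open>x\<^sub>i \<mapsto> x\<^bsub>\<sigma>(i)\<^esub>\<close> sends a monomial
  \<open>m\<close> to \<open>m \<circ> \<sigma>\<inverse>\<close>, so the coefficient of \<open>m\<close> in the image of
  \<open>f\<close> is the coefficient of \<open>m \<circ> \<sigma>\<close> in \<open>f\<close>.\<close>

definition perm_poly :: "(nat \<Rightarrow> nat) \<Rightarrow> 'k::field mpoly \<Rightarrow> 'k mpoly" where
  "perm_poly \<sigma> = Poly_Mapping.map_key (Poly_Mapping.map_key \<sigma>)"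

lemma map_key_inv:
  fixes \<sigma> :: "'a \<Rightarrow> 'a"
  assumes "bij \<sigma>"
  shows "Poly_Mapping.map_key \<sigma> (Poly_Mapping.map_key (inv' \<sigma>) m) = m"
    and "Poly_Mapping.map_key (inv' \<sigma>) (Poly_Mapping.map_key \<sigma> m) = m"
proof -
  have inj: "inj \<sigma>" "inj (inv' \<sigma>)"
    using assms by (simp_all add: bij_is_inj bij_imp_bij_inv)
  have "inv' \<sigma> \<circ> \<sigma> = (\<lambda>x. x)" "\<sigma> \<circ> inv' \<sigma> = (\<lambda>x. x)"
    using assms by (auto simp: fun_eq_iff bij_is_inj bij_is_surj surj_f_inv_f)
  then show "Poly_Mapping.map_key \<sigma> (Poly_Mapping.map_key (inv' \<sigma>) m) = m"
    "Poly_Mapping.map_key (inv' \<sigma>) (Poly_Mapping.map_key \<sigma> m) = m"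
    by (simp_all add: map_key_compose[OF inj] map_key_compose[OF inj(2,1)] map_key_id)
qed

lemma inj_map_key:
  fixes \<sigma> :: "'a \<Rightarrow> 'a"
  assumes "bij \<sigma>"
  shows "inj (Poly_Mapping.map_key \<sigma>)"
  by (rule inj_on_inverseI[where g = "Poly_Mapping.map_key (inv' \<sigma>)"])
    (rule map_key_inv(2)[OF assms])

lemma perm_poly_single:
  assumes "bij \<sigma>"
  shows "perm_poly \<sigma> (Poly_Mapping.single m c) =
           Poly_Mapping.single (Poly_Mapping.map_key (inv' \<sigma>) m) c"
  using map_key_single[OF inj_map_key[OF assms], of "Poly_Mapping.map_key (inv' \<sigma>) m" c]
  by (simp add: perm_poly_def map_key_inv[OF assms])

lemma perm_poly_var:
  assumes "bij \<sigma>"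
  shows "perm_poly \<sigma> (Poly_Mapping.single (Poly_Mapping.single i 1) 1) =
           Poly_Mapping.single (Poly_Mapping.single (\<sigma> i) 1) 1"
proof -
  have "inj (inv' \<sigma>)" using assms by (simp add: bij_imp_bij_inv bij_is_inj)
  from map_key_single[OF this, of "\<sigma> i" "1::nat"] show ?thesis
    using assms by (simp add: perm_poly_single bij_is_inj)
qed

lemma perm_poly_add:
  assumes "bij \<sigma>"
  shows "perm_poly \<sigma> (f + g) = perm_poly \<sigma> f + perm_poly \<sigma> g"
  by (simp add: perm_poly_def map_key_plus[OF inj_map_key[OF assms]])

lemma perm_poly_zero: "bij \<sigma> \<Longrightarrow> perm_poly \<sigma> 0 = 0"
  by (simp add: perm_poly_def map_key_zero[OF inj_map_key])

lemma perm_poly_uminus: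
  assumes "bij \<sigma>"
  shows "perm_poly \<sigma> (- f) = - perm_poly \<sigma> f"
  using perm_poly_add[OF assms, of "- f" f] perm_poly_zero[OF assms]
  by (metis add.left_inverse eq_neg_iff_add_eq_0)

lemma perm_poly_one: "bij \<sigma> \<Longrightarrow> perm_poly \<sigma> 1 = 1"
  using perm_poly_single[of \<sigma> 0 1]
  by (simp add: map_key_zero bij_is_inj bij_imp_bij_inv)

lemma mpoly_induct [case_names single sum]:
  fixes P :: "('a \<Rightarrow>\<^sub>0 'b::comm_monoid_add) \<Rightarrow> bool"
  assumes "\<And>m c. P (Poly_Mapping.single m c)" "\<And>f g. P f \<Longrightarrow> P g \<Longrightarrow> P (f + g)"
  shows "P f"
proof (induction f rule: update_induct)
  case const
  show ?case using assms(1)[of undefined 0] by simp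
next
  case (update f a b)
  then have "Poly_Mapping.update a b f = f + Poly_Mapping.single a b"
    by (intro poly_mapping_eqI)
      (auto simp: lookup_update lookup_add lookup_single when_def in_keys_iff)
  then show ?case using update assms by simp
qed

lemma perm_poly_mult:
  assumes \<sigma>: "bij \<sigma>"
  shows "perm_poly \<sigma> (f * g) = perm_poly \<sigma> f * perm_poly \<sigma> g"
proof (induction f rule: mpoly_induct)
  case (single m c)
  show ?case
  proof (induction g rule: mpoly_induct)
    case (single m' c')
    have "inj (inv' \<sigma>)" using \<sigma> by (simp add: bij_imp_bij_inv bij_is_inj)
    then show ?case
      by (simp add: mult_single perm_poly_single[OF \<sigma>] map_key_plus)
  qed (simp add: perm_poly_add[OF \<sigma>] distrib_left)
qed (simp add: perm_poly_add[OF \<sigma>] distrib_right)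

definition invariant_ring :: "nat \<Rightarrow> (nat \<Rightarrow> nat) set \<Rightarrow> 'k::field mpoly ring" where
  "invariant_ring n G =
     (poly_ring n)\<lparr>carrier := {f \<in> carrier (poly_ring n). \<forall>\<sigma>\<in>G. perm_poly \<sigma> f = f}\<rparr>"

lemma cring_type_subset:
  fixes C :: "'a::comm_ring_1 set"
  assumes "0 \<in> C" "1 \<in> C" "\<And>f. f \<in> C \<Longrightarrow> - f \<in> C"
    "\<And>f g. f \<in> C \<Longrightarrow> g \<in> C \<Longrightarrow> f + g \<in> C" "\<And>f g. f \<in> C \<Longrightarrow> g \<in> C \<Longrightarrow> f * g \<in> C"
  shows "cring \<lparr>carrier = C, mult = (*), one = 1, zero = 0, add = (+)\<rparr>" (is "cring ?R")
proof (rule cringI)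
  show "abelian_group ?R"
  proof (rule abelian_groupI)
    fix f assume "f \<in> carrier ?R"
    then show "\<exists>g\<in>carrier ?R. g \<oplus>\<^bsub>?R\<^esub> f = \<zero>\<^bsub>?R\<^esub>"
      using assms(3)[of f] by (intro bexI[of _ "- f"]) simp_all
  qed (use assms in \<open>simp_all add: add_ac\<close>)
  show "comm_monoid ?R"
    by (rule comm_monoidI) (use assms in \<open>simp_all add: mult_ac\<close>)
qed (simp add: distrib_right)

lemma cring_invariant_ring:
  assumes G: "\<And>\<sigma>. \<sigma> \<in> G \<Longrightarrow> bij \<sigma>"
  shows "cring (invariant_ring n G :: 'k::field mpoly ring)"
proof -
  let ?C = "{f :: 'k mpoly. \<forall>m \<in> Poly_Mapping.keys f. Poly_Mapping.keys m \<subseteq> {1..n}}"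
  have add: "f + g \<in> ?C" if "f \<in> ?C" "g \<in> ?C" for f g
    using that Poly_Mapping.keys_add[of f g] by blast
  have mult: "f * g \<in> ?C" if fg: "f \<in> ?C" "g \<in> ?C" for f g
  proof (rule CollectI, rule ballI)
    fix m assume "m \<in> Poly_Mapping.keys (f * g)"
    then obtain a b where "a \<in> Poly_Mapping.keys f" "b \<in> Poly_Mapping.keys g" "m = a + b"
      using keys_mult[of f g] by blast
    then show "Poly_Mapping.keys m \<subseteq> {1..n}"
      using fg Poly_Mapping.keys_add[of a b] by blast
  qed
  have neg: "- f \<in> ?C" if "f \<in> ?C" for f
    using that by (simp add: in_keys_iff)
  have "cring \<lparr>carrier = {f \<in> ?C. \<forall>\<sigma>\<in>G. perm_poly \<sigma> f = f},
          mult = (*), one = 1, zero = 0, add = (+)\<rparr>"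
  proof (rule cring_type_subset)
    show "0 \<in> {f \<in> ?C. \<forall>\<sigma>\<in>G. perm_poly \<sigma> f = f}" "1 \<in> {f \<in> ?C. \<forall>\<sigma>\<in>G. perm_poly \<sigma> f = f}"
      by (simp_all add: perm_poly_zero[OF G] perm_poly_one[OF G])
    show "- f \<in> {f \<in> ?C. \<forall>\<sigma>\<in>G. perm_poly \<sigma> f = f}"
      if "f \<in> {f \<in> ?C. \<forall>\<sigma>\<in>G. perm_poly \<sigma> f = f}" for f
      using that neg[of f] by (simp add: perm_poly_uminus[OF G])
    show "f + g \<in> {f \<in> ?C. \<forall>\<sigma>\<in>G. perm_poly \<sigma> f = f}"
      if "f \<in> {f \<in> ?C. \<forall>\<sigma>\<in>G. perm_poly \<sigma> f = f}" "g \<in> {f \<in> ?C. \<forall>\<sigma>\<in>G. perm_poly \<sigma> f = f}" for f g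
      using that add[of f g] by (simp add: perm_poly_add[OF G])
    show "f * g \<in> {f \<in> ?C. \<forall>\<sigma>\<in>G. perm_poly \<sigma> f = f}"
      if "f \<in> {f \<in> ?C. \<forall>\<sigma>\<in>G. perm_poly \<sigma> f = f}" "g \<in> {f \<in> ?C. \<forall>\<sigma>\<in>G. perm_poly \<sigma> f = f}" for f g
      using that mult[of f g] by (simp add: perm_poly_mult[OF G])
  qed
  then show ?thesis
    by (simp add: invariant_ring_def poly_ring_def)
qed

end

theory Submission
  imports Defs "HOL-Algebra.Sylow"
begin

text \<open>
  Let \<open>A = k[x]\<^sup>G\<close>, let \<open>I\<close> be the subgroup of the elements of \<open>G\<close> that preserve every orbit
  of \<open>g\<close>, and let \<open>P\<close> be the ideal generated by the differences of variables in the same orbit, so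
  that \<open>I\<close> is the inertia group of \<open>P\<close>. If two primes divided the order of \<open>g\<close>, then \<open>g\<close> would be a
  product of powers of \<open>g\<close> one of which lies outside \<open>N\<close> and has strictly finer orbits; so the order
  is a power of a prime \<open>p\<close>. By the choice of \<open>g\<close>, an element of \<open>I\<close> whose orbits are strictly finer
  lies in \<open>N\<close>. Hence \<open>I\<close> modulo the subgroup generated by such elements is a nontrivial
  \<open>p\<close>-group, and there is a nonzero homomorphism \<open>\<phi>\<close> from \<open>I\<close> to \<open>k\<close> all of whose nonzero values are taken at elements
  with the same orbits as \<open>g\<close>.

  The class of \<open>\<phi>\<close> in \<open>H\<^sup>1(I, k[x])\<close> is nonzero modulo \<open>P\<close> but is annihilated by an ideal of \<open>A\<close>
  with radical \<open>P \<inter> A\<close>, which has height at least 3 as \<open>g \<notin> N\<close>. If \<open>A\<close> were Cohen-Macaulay, that ideal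
  would contain a regular sequence \<open>a\<^sub>1, a\<^sub>2, a\<^sub>3\<close> of the localization of \<open>A\<close> at the ideal of the
  invariants without constant term. Write \<open>a\<^sub>i \<phi>(\<sigma>) = \<sigma> u\<^sub>i - u\<^sub>i\<close>. The elements
  \<open>a\<^sub>i u\<^sub>j - a\<^sub>j u\<^sub>i\<close> are \<open>I\<close>-invariant and satisfy the Koszul relation; since the \<open>I\<close>-invariants
  are unramified over \<open>A\<close> at \<open>P\<close>, it follows that, up to a factor outside \<open>P\<close>, \<open>a\<^sub>1 u\<^sub>2 - a\<^sub>2 u\<^sub>1\<close> is a
  combination of \<open>a\<^sub>1\<close> and \<open>a\<^sub>2\<close> with \<open>I\<close>-invariant coefficients. Dividing by \<open>a\<^sub>1\<close>, chosen as a power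
  of \<open>\<Prod> (x\<^sub>i - x\<^sub>j)\<close>, shows that \<open>\<phi>\<close> is a coboundary modulo \<open>P\<close>, a contradiction.
\<close>


section \<open>Ideals and primes in subrings of a commutative ring\<close>

text \<open>Height, unmixedness, lying over and inertia theory are replaced by elementary statements
  about subsets of a ring type, so that one locale covers polynomials, invariants, polynomials over
  either, and localizations inside a field of fractions. Height at least 3 appears only as the
  absence of long chains of primes above an ideal: regular sequences produce such chains above
  annihilators, and counting monomials bounds their length.

  The radical of the annihilator of the class comes from traces. With K the kernel of \<phi>, a
  trace over I/K splits \<phi> explicitly, and independence of characters modulo a prime shows that
  a prime containing all these traces contains P. Unramifiedness takes the form of Lagrange
  interpolation at the conjugates of a single monomial whose stabilizer in G is I.

  A product of linear forms is used for the first element because coprimality with the second can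
  then be tested by identifying two variables.\<close>

locale unital_subring =
  fixes S :: "'a::comm_ring_1 set"
  assumes zero_in [simp, intro]: "0 \<in> S" and one_in [simp, intro]: "1 \<in> S"
    and add_in [intro]: "a \<in> S \<Longrightarrow> b \<in> S \<Longrightarrow> a + b \<in> S"
    and uminus_in [intro]: "a \<in> S \<Longrightarrow> - a \<in> S"
    and mult_in [intro]: "a \<in> S \<Longrightarrow> b \<in> S \<Longrightarrow> a * b \<in> S"
begin

lemma diff_in [intro]: "a \<in> S \<Longrightarrow> b \<in> S \<Longrightarrow> a - b \<in> S"
  using add_in[of a "- b"] by auto

lemma sum_in: "(\<And>i. i \<in> X \<Longrightarrow> f i \<in> S) \<Longrightarrow> sum f X \<in> S"
  by (induction X rule: infinite_finite_induct) auto

lemma prod_in: "(\<And>i. i \<in> X \<Longrightarrow> f i \<in> S) \<Longrightarrow> prod f X \<in> S"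
  by (induction X rule: infinite_finite_induct) auto

lemma power_in [intro]: "a \<in> S \<Longrightarrow> a ^ k \<in> S"
  by (induction k) auto

lemma of_nat_in: "of_nat k \<in> S"
  by (induction k) auto

definition idl :: "'a set \<Rightarrow> bool" where
  "idl J \<longleftrightarrow> J \<subseteq> S \<and> 0 \<in> J \<and> (\<forall>a\<in>J. \<forall>b\<in>J. a + b \<in> J) \<and> (\<forall>s\<in>S. \<forall>a\<in>J. s * a \<in> J)"

definition prm :: "'a set \<Rightarrow> bool" where
  "prm Q \<longleftrightarrow> idl Q \<and> 1 \<notin> Q \<and> (\<forall>a\<in>S. \<forall>b\<in>S. a * b \<in> Q \<longrightarrow> a \<in> Q \<or> b \<in> Q)"

text \<open>The ideal \<open>J + yS\<close>; folded over a list it gives the ideals that occur in a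
  regular sequence.\<close>

definition adj :: "'a set \<Rightarrow> 'a \<Rightarrow> 'a set" where
  "adj J y = {j + y * s | j s. j \<in> J \<and> s \<in> S}"

text \<open>The annihilator of the class of \<open>w\<close> in \<open>S/J\<close>; the associated
  primes of \<open>J\<close> are the primes of this shape.\<close>

definition colon :: "'a set \<Rightarrow> 'a \<Rightarrow> 'a set" where
  "colon J w = {s \<in> S. s * w \<in> J}"

definition reg :: "'a set \<Rightarrow> 'a \<Rightarrow> bool" where
  "reg J y \<longleftrightarrow> (\<forall>z\<in>S. y * z \<in> J \<longrightarrow> z \<in> J)"

lemma idlD:
  assumes "idl J"
  shows "a \<in> J \<Longrightarrow> a \<in> S" and "0 \<in> J" and "a \<in> J \<Longrightarrow> b \<in> J \<Longrightarrow> a + b \<in> J"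
    and "s \<in> S \<Longrightarrow> a \<in> J \<Longrightarrow> s * a \<in> J" and "s \<in> S \<Longrightarrow> a \<in> J \<Longrightarrow> a * s \<in> J"
    and "a \<in> J \<Longrightarrow> - a \<in> J" and "a \<in> J \<Longrightarrow> b \<in> J \<Longrightarrow> a - b \<in> J"
proof -
  show *: "a \<in> J \<Longrightarrow> a \<in> S" "0 \<in> J" "a \<in> J \<Longrightarrow> b \<in> J \<Longrightarrow> a + b \<in> J"
    "s \<in> S \<Longrightarrow> a \<in> J \<Longrightarrow> s * a \<in> J" "s \<in> S \<Longrightarrow> a \<in> J \<Longrightarrow> a * s \<in> J" for a b s
    using assms by (auto simp: idl_def mult.commute)
  have neg: "- b \<in> J" if "b \<in> J" for b using *(4)[of "-1" b] that by auto
  show "a \<in> J \<Longrightarrow> - a \<in> J" by (rule neg)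
  show "a \<in> J \<Longrightarrow> b \<in> J \<Longrightarrow> a - b \<in> J" using *(3)[of a "- b"] neg by simp
qed

lemma idl_sum: "idl J \<Longrightarrow> (\<And>i. i \<in> X \<Longrightarrow> f i \<in> J) \<Longrightarrow> sum f X \<in> J"
  by (induction X rule: infinite_finite_induct) (auto intro: idlD)

lemma idl_add_cancel:
  assumes "idl J" "a \<in> J"
  shows "a + b \<in> J \<longleftrightarrow> b \<in> J"
  using idlD(7)[OF assms(1), of "a + b" a] idlD(3)[OF assms(1), of a b] assms(2) by auto

lemma prmD:
  assumes "prm Q"
  shows "idl Q" "1 \<notin> Q" "a \<in> S \<Longrightarrow> b \<in> S \<Longrightarrow> a * b \<in> Q \<Longrightarrow> a \<in> Q \<or> b \<in> Q"
  using assms by (auto simp: prm_def)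

lemma prm_prod:
  assumes "prm Q" "finite X" "(\<And>i. i \<in> X \<Longrightarrow> f i \<in> S)" "prod f X \<in> Q"
  shows "\<exists>i\<in>X. f i \<in> Q"
  using assms(2-4)
proof (induction X rule: finite_induct)
  case empty
  then show ?case using prmD(2)[OF assms(1)] by simp
next
  case (insert x F)
  then show ?case using prmD(3)[OF assms(1), of "f x" "prod f F"] prod_in[of F f] by auto
qed

lemma prm_power: "prm Q \<Longrightarrow> a \<in> S \<Longrightarrow> a ^ k \<in> Q \<Longrightarrow> a \<in> Q"
  using prm_prod[of Q "{..<k}" "\<lambda>_. a"] by auto

lemma idl_prod_mem:
  assumes "idl Q" "finite X" "\<And>i. i \<in> X \<Longrightarrow> f i \<in> S" "i \<in> X" "f i \<in> Q"
  shows "prod f X \<in> Q"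
  using prod.remove[OF assms(2,4), of f] idlD(5)[OF assms(1) _ assms(5)] prod_in[of "X - {i}" f]
    assms(3) by auto

lemma idl_adj: assumes J: "idl J" and y: "y \<in> S" shows "idl (adj J y)"
  unfolding idl_def
proof (intro conjI ballI subsetI)
  show "x \<in> S" if "x \<in> adj J y" for x using that idlD(1)[OF J] y by (auto simp: adj_def)
  have "0 = 0 + y * 0" by simp
  then show "0 \<in> adj J y" unfolding adj_def using idlD(2)[OF J] by blast
next
  fix a b assume "a \<in> adj J y" "b \<in> adj J y"
  then obtain j s j' s' where "a = j + y * s" "b = j' + y * s'" "j \<in> J" "j' \<in> J" "s \<in> S" "s' \<in> S"
    by (auto simp: adj_def)
  then have "a + b = (j + j') + y * (s + s')" "j + j' \<in> J" "s + s' \<in> S"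
    using idlD(3)[OF J] by (auto simp: algebra_simps)
  then show "a + b \<in> adj J y" unfolding adj_def by blast
next
  fix t a assume t: "t \<in> S" "a \<in> adj J y"
  then obtain j s where "a = j + y * s" "j \<in> J" "s \<in> S" by (auto simp: adj_def)
  then have "t * a = t * j + y * (t * s)" "t * j \<in> J" "t * s \<in> S"
    using idlD(4)[OF J t(1)] mult_in[OF t(1)] by (simp_all add: algebra_simps)
  then show "t * a \<in> adj J y" unfolding adj_def by blast
qed

lemma adjI: "j \<in> J \<Longrightarrow> s \<in> S \<Longrightarrow> j + y * s \<in> adj J y"
  by (auto simp: adj_def)

lemma adj_sub: "J \<subseteq> adj J y"
  using adjI[of _ J 0 y] by auto

lemma adj_self: "idl J \<Longrightarrow> y \<in> adj J y"
  using adjI[of 0 J 1 y] idlD(2) by auto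

lemma adj_least: "idl K \<Longrightarrow> J \<subseteq> K \<Longrightarrow> y \<in> K \<Longrightarrow> adj J y \<subseteq> K"
  by (auto simp: adj_def intro!: idlD)

lemma adj_commute: "adj (adj J x) y = adj (adj J y) x"
proof -
  have "adj (adj J x) y \<subseteq> adj (adj J y) x" for x y
  proof
    fix a assume "a \<in> adj (adj J x) y"
    then obtain j s t where "j \<in> J" "s \<in> S" "t \<in> S" "a = (j + x * s) + y * t"
      by (auto simp: adj_def)
    then have "a = (j + y * t) + x * s" "j + y * t \<in> adj J y" by (auto simp: algebra_simps adj_def)
    then show "a \<in> adj (adj J y) x" using \<open>s \<in> S\<close> by (auto simp: adj_def)
  qed
  then show ?thesis by blast
qed

lemma idl_colon: "idl J \<Longrightarrow> w \<in> S \<Longrightarrow> idl (colon J w)"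
  unfolding colon_def by (auto simp: idl_def distrib_right mult.assoc)

lemma idl_zero: "idl {0}"
  by (auto simp: idl_def)

text \<open>An ideal that is maximal among those containing \<open>J\<close> and missing
  \<open>T\<close> is prime. The last conjunct records the maximality, since lying over is later
  proved from it.\<close>

lemma exists_prm_disjoint:
  assumes J: "idl J" and T: "1 \<in> T" "\<And>a b. a \<in> T \<Longrightarrow> b \<in> T \<Longrightarrow> a * b \<in> T" and disj: "J \<inter> T = {}"
  shows "\<exists>Q. prm Q \<and> J \<subseteq> Q \<and> Q \<inter> T = {} \<and> (\<forall>a\<in>S - Q. \<exists>q\<in>Q. \<exists>r\<in>S. q + a * r \<in> T)"
proof -
  define F where "F = {Q. idl Q \<and> J \<subseteq> Q \<and> Q \<inter> T = {}}"
  have "\<exists>M\<in>F. \<forall>X\<in>F. M \<subseteq> X \<longrightarrow> X = M"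
  proof (rule subset_Zorn_nonempty)
    show "F \<noteq> {}" using J disj by (auto simp: F_def)
  next
    fix C assume C: "C \<noteq> {}" "subset.chain F C"
    have CF: "idl X" "J \<subseteq> X" "X \<inter> T = {}" if "X \<in> C" for X
      using C(2) that by (auto simp: subset_chain_def F_def)
    have "idl (\<Union>C)"
      unfolding idl_def
    proof (intro conjI ballI)
      show "\<Union>C \<subseteq> S" using CF(1) idlD(1) by blast
      show "0 \<in> \<Union>C" using CF(1) idlD(2) C(1) by blast
    next
      fix a b assume "a \<in> \<Union>C" "b \<in> \<Union>C"
      then obtain X Y where XY: "X \<in> C" "Y \<in> C" "a \<in> X" "b \<in> Y" by blast
      then have "X \<subseteq> Y \<or> Y \<subseteq> X" using C(2) by (auto simp: subset_chain_def)
      then show "a + b \<in> \<Union>C" using XY CF(1) idlD(3) by blast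
    next
      fix s a assume "s \<in> S" "a \<in> \<Union>C"
      then show "s * a \<in> \<Union>C" using CF(1) idlD(4) by blast
    qed
    moreover have "J \<subseteq> \<Union>C" using C(1) CF(2) by blast
    moreover have "\<Union>C \<inter> T = {}" using CF(3) by blast
    ultimately show "\<Union>C \<in> F" by (simp add: F_def)
  qed
  then obtain Q where Q: "idl Q" "J \<subseteq> Q" "Q \<inter> T = {}"
    and max: "\<And>X. idl X \<Longrightarrow> J \<subseteq> X \<Longrightarrow> X \<inter> T = {} \<Longrightarrow> Q \<subseteq> X \<Longrightarrow> X = Q"
    by (auto simp: F_def)
  have meet: "\<exists>q\<in>Q. \<exists>r\<in>S. q + a * r \<in> T" if a: "a \<in> S - Q" for a
  proof (rule ccontr)
    assume "\<not> ?thesis"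
    then have "adj Q a \<inter> T = {}" by (auto simp: adj_def)
    then have "adj Q a = Q" using max[OF idl_adj[OF Q(1)]] a adj_sub[of Q a] Q(2) by blast
    then show False using adj_self[OF Q(1), of a] a by simp
  qed
  have "prm Q"
    unfolding prm_def
  proof (intro conjI ballI impI)
    show "idl Q" by (rule Q(1))
    show "1 \<notin> Q" using Q(3) T(1) by blast
    fix a b assume ab: "a \<in> S" "b \<in> S" "a * b \<in> Q"
    show "a \<in> Q \<or> b \<in> Q"
    proof (rule ccontr)
      assume "\<not> (a \<in> Q \<or> b \<in> Q)"
      then obtain q r q' r' where q: "q \<in> Q" "r \<in> S" "q + a * r \<in> T" "q' \<in> Q" "r' \<in> S"
        "q' + b * r' \<in> T"
        using meet[of a] meet[of b] ab by blast
      have "(q + a * r) * (q' + b * r') = q * (q' + b * r') + (a * r) * q' + (r * r') * (a * b)"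
        by (simp add: algebra_simps)
      also have "\<dots> \<in> Q" 
        using q ab idlD(1)[OF Q(1)]
        by (intro idlD(3)[OF Q(1)] idlD(5)[OF Q(1) _ q(1)] idlD(4)[OF Q(1) _ q(4)] idlD(4)[OF Q(1) _ ab(3)]
              add_in mult_in) auto
      finally show False using T(2)[OF q(3,6)] Q(3) by blast
    qed
  qed
  with Q meet show ?thesis by blast
qed

text \<open>Discard a prime contained in another one. Otherwise an element avoiding all primes but
  \<open>Q\<close> is corrected, if it lies in \<open>Q\<close>, by an element of \<open>I\<close>
  that lies in all the other primes but not in \<open>Q\<close>.\<close>

lemma prime_avoidance:
  assumes I: "idl I" and X: "finite X" "\<And>Q. Q \<in> X \<Longrightarrow> prm Q" "\<And>Q. Q \<in> X \<Longrightarrow> \<not> I \<subseteq> Q"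
  shows "\<exists>z\<in>I. \<forall>Q\<in>X. z \<notin> Q"
  using X
proof (induction X rule: finite_psubset_induct)
  case (psubset X)
  show ?case
  proof (cases "X = {}")
    case True
    then show ?thesis using idlD(2)[OF I] by blast
  next
    case False
    then obtain Q where Q: "Q \<in> X" by blast
    show ?thesis
    proof (cases "\<exists>P'\<in>X. \<exists>P\<in>X. P \<noteq> P' \<and> P' \<subseteq> P")
      case True
      then obtain P P' where P: "P \<in> X" "P' \<in> X" "P \<noteq> P'" "P' \<subseteq> P" by blast
      then have "\<exists>z\<in>I. \<forall>Q\<in>X - {P'}. z \<notin> Q" by (intro psubset.IH psubset.prems) auto
      then show ?thesis using P by blast
    next
      case incomp: False
      have "\<exists>z\<in>I. \<forall>Q\<in>X - {Q}. z \<notin> Q" using Q by (intro psubset.IH psubset.prems) auto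
      then obtain a where a: "a \<in> I" "\<And>P. P \<in> X - {Q} \<Longrightarrow> a \<notin> P" by blast
      show ?thesis
      proof (cases "a \<in> Q")
        case True
        obtain b where b: "b \<in> I" "b \<notin> Q" using psubset.prems(2)[OF Q] by blast
        have "\<forall>P\<in>X - {Q}. \<exists>c. c \<in> P \<and> c \<notin> Q" using incomp Q by blast
        then obtain c where c: "\<And>P. P \<in> X - {Q} \<Longrightarrow> c P \<in> P \<and> c P \<notin> Q" by metis
        define d where "d = b * prod c (X - {Q})"
        have fin: "finite (X - {Q})" using psubset.hyps by simp
        have cS: "c P \<in> S" if "P \<in> X - {Q}" for P
          using c[OF that] psubset.prems(1)[of P] that idlD(1) prmD(1) by blast
        have pS: "prod c (X - {Q}) \<in> S" by (rule prod_in[OF cS])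
        have dQ: "d \<notin> Q"
        proof
          assume "d \<in> Q"
          then have "prod c (X - {Q}) \<in> Q"
            using prmD(3)[OF psubset.prems(1)[OF Q] idlD(1)[OF I b(1)] pS] b(2) by (simp add: d_def)
          from prm_prod[OF psubset.prems(1)[OF Q] fin cS this] c show False by blast
        qed
        have dP: "d \<in> P" if P: "P \<in> X - {Q}" for P
          unfolding d_def using P prmD(1)[OF psubset.prems(1), of P] c[OF P] idlD(1)[OF I b(1)]
          by (intro idlD(4) idl_prod_mem[OF _ fin cS P]) auto
        have "d \<in> I" unfolding d_def by (rule idlD(5)[OF I pS b(1)])
        then have "a + d \<in> I" using a idlD(3)[OF I] by blast
        moreover have "a + d \<notin> Q"
          using dQ True idl_add_cancel[OF prmD(1)[OF psubset.prems(1)[OF Q]]] by blast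
        moreover have "a + d \<notin> P" if "P \<in> X - {Q}" for P
          using that dP[OF that] a(2)[OF that] idl_add_cancel[of P d a] prmD(1)[OF psubset.prems(1), of P]
          by (auto simp: add.commute)
        ultimately show ?thesis by blast
      qed (use a in blast)
    qed
  qed
qed

text \<open>Regular sequences do not commute in general; \<open>reg J y\<close> is what allows the
  exchange. If \<open>x z = j + y s\<close>, then \<open>s\<close> is a multiple of \<open>x\<close>
  modulo \<open>J\<close>, and \<open>x\<close> can be cancelled.\<close>

lemma reg_swap:
  assumes J: "idl J" and S: "x \<in> S" "y \<in> S" and "reg J x" "reg (adj J x) y" "reg J y"
  shows "reg (adj J y) x"
  unfolding reg_def
proof (intro ballI impI)
  fix z assume z: "z \<in> S" "x * z \<in> adj J y"
  then obtain j s where j: "j \<in> J" "s \<in> S" "x * z = j + y * s" by (auto simp: adj_def)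
  have "y * s = - j + x * z" using j by simp
  then have "y * s \<in> adj J x" using adjI[of "- j" J z x] idlD(6)[OF J j(1)] z by simp
  then have "s \<in> adj J x" using assms(5) j by (auto simp: reg_def)
  then obtain j' t where t: "j' \<in> J" "t \<in> S" "s = j' + x * t" by (auto simp: adj_def)
  have "x * (z - y * t) = j + y * j'" using j t by (simp add: algebra_simps)
  also have "\<dots> \<in> J" using j t S by (intro idlD(3)[OF J] idlD(4)[OF J])
  finally have "z - y * t \<in> J" using assms(4) z t S by (auto simp: reg_def)
  then show "z \<in> adj J y" using adjI[of "z - y * t" J t y] t by simp
qed

end

section \<open>Depth in noetherian local rings\<close>

text \<open>\<open>max_cond\<close> is the noetherian property in a form that passes to
  localizations by contraction of ideals; \<open>m\<close> is the set of nonunits.\<close>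

locale noetherian_local = unital_subring S for S :: "'a::comm_ring_1 set" +
  fixes m :: "'a set"
  assumes max_cond: "F \<noteq> {} \<Longrightarrow> (\<And>J. J \<in> F \<Longrightarrow> idl J) \<Longrightarrow> \<exists>J\<in>F. \<forall>K\<in>F. J \<subseteq> K \<longrightarrow> K = J"
    and idl_m: "idl m" and one_notin_m: "1 \<notin> m"
    and unit: "s \<in> S \<Longrightarrow> s \<notin> m \<Longrightarrow> \<exists>t\<in>S. s * t = 1"
begin

lemma mS: "y \<in> m \<Longrightarrow> y \<in> S"
  using idlD(1)[OF idl_m] .

lemma proper_sub_m: "idl J \<Longrightarrow> 1 \<notin> J \<Longrightarrow> J \<subseteq> m"
proof
  fix s assume J: "idl J" "1 \<notin> J" and s: "s \<in> J"
  show "s \<in> m"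
  proof (rule ccontr)
    assume "s \<notin> m"
    then obtain t where "t \<in> S" "s * t = 1" using unit idlD(1)[OF J(1) s] by blast
    then show False using idlD(5)[OF J(1) _ s, of t] J(2) by simp
  qed
qed

lemma prm_m: "prm m"
  unfolding prm_def
proof (intro conjI ballI impI)
  fix a b assume ab: "a \<in> S" "b \<in> S" "a * b \<in> m"
  show "a \<in> m \<or> b \<in> m"
  proof (rule ccontr)
    assume nin: "\<not> (a \<in> m \<or> b \<in> m)"
    obtain t where t: "t \<in> S" "a * t = 1" using unit[OF ab(1)] nin by blast
    obtain u where u: "u \<in> S" "b * u = 1" using unit[OF ab(2)] nin by blast
    have "(a * b) * (t * u) = (a * t) * (b * u)" by (simp add: mult_ac)
    then have "(a * b) * (t * u) = 1" using t u by simp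
    then show False using idlD(5)[OF idl_m mult_in[OF t(1) u(1)] ab(3)] one_notin_m by simp
  qed
qed (use idl_m one_notin_m in auto)

text \<open>The maximal condition supplies \<open>L\<close> maximal among the ideals with
  \<open>J \<subseteq> L \<subset> K\<close>. If \<open>y w \<notin> L\<close>, then
  \<open>L + ywS = K\<close> contains \<open>w\<close>, so \<open>w (1 - y s) \<in> L\<close> for
  some \<open>s\<close>; as \<open>1 - y s\<close> is a unit, \<open>w \<in> L\<close> after all.
  Hence \<open>yK \<subseteq> L\<close> and
  \<open>K \<subseteq> J + yK \<subseteq> L\<close>.\<close>

lemma nakayama:
  assumes J: "idl J" and K: "idl K" and JK: "J \<subseteq> K" and y: "y \<in> m"
    and gen: "\<And>a. a \<in> K \<Longrightarrow> \<exists>j\<in>J. \<exists>b\<in>K. a = j + y * b"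
  shows "K = J"
proof (rule ccontr)
  assume ne: "K \<noteq> J"
  define F where "F = {L. idl L \<and> J \<subseteq> L \<and> L \<subset> K}"
  have "J \<in> F" using J JK ne by (auto simp: F_def)
  then have "F \<noteq> {}" by blast
  moreover have "\<And>L. L \<in> F \<Longrightarrow> idl L" by (simp add: F_def)
  ultimately obtain L where LF: "L \<in> F" and Lmax: "\<forall>L'\<in>F. L \<subseteq> L' \<longrightarrow> L' = L"
    using max_cond[of F] by blast
  have L: "idl L" "J \<subseteq> L" "L \<subset> K" using LF by (simp_all add: F_def)
  have max: "L' = L" if "idl L'" "L' \<subset> K" "L \<subseteq> L'" for L'
    using Lmax that L(2) by (simp add: F_def)
  have yL: "y * w \<in> L" if w: "w \<in> K" for w
  proof (rule ccontr)
    assume nin: "y * w \<notin> L"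
    have wS: "w \<in> S" "y * w \<in> K" using idlD(1)[OF K w] idlD(4)[OF K mS[OF y] w] by auto
    have "adj L (y * w) \<subseteq> K" using adj_least[OF K] L wS by blast
    moreover have "adj L (y * w) \<noteq> L" using adj_self[OF L(1), of "y * w"] nin by auto
    ultimately have "adj L (y * w) = K"
      using max[OF idl_adj[OF L(1)], of "y * w"] adj_sub[of L "y * w"] mS[OF y] wS by blast
    then have "w \<in> adj L (y * w)" using w by simp
    then obtain j s where j: "j \<in> L" "s \<in> S" "w = j + y * w * s" by (auto simp: adj_def)
    have "1 - y * s \<notin> m"
      using idlD(3)[OF idl_m, of "1 - y * s" "y * s"] idlD(5)[OF idl_m j(2) y] one_notin_m by auto
    then obtain t where t: "t \<in> S" "(1 - y * s) * t = 1" using unit[of "1 - y * s"] mS[OF y] j(2)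
      by blast
    have "w * (1 - y * s) = j" using j(3) by (simp add: algebra_simps)
    then have "w = t * j" using t(2) by (metis mult.assoc mult.commute mult.right_neutral)
    then have "w \<in> L" using idlD(4)[OF L(1) t(1) j(1)] by simp
    then show False using nin idlD(4)[OF L(1) mS[OF y]] by blast
  qed
  have "K \<subseteq> L"
  proof
    fix a assume "a \<in> K"
    then obtain j b where "j \<in> J" "b \<in> K" "a = j + y * b" using gen by blast
    then show "a \<in> L" using L yL idlD(3) by blast
  qed
  then show False using L by blast
qed

text \<open>\<open>X\<close> consists of the maximal annihilators: they are prime and cover the zero
  divisors modulo \<open>J\<close>. For finiteness, let finitely many witnesses \<open>w P\<close>
  generate together with \<open>J\<close> an ideal as large as possible. Every witness
  \<open>w Q\<close> lies in it, so a product of elements of these \<open>P\<close> annihilates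
  \<open>w Q\<close>; as \<open>Q\<close> is prime it contains some \<open>P\<close>, and maximality
  gives \<open>P = Q\<close>.\<close>

lemma associated_primes:
  assumes J: "idl J"
  shows "\<exists>X. finite X \<and> (\<forall>Q\<in>X. prm Q \<and> (\<exists>w\<in>S - J. Q = colon J w)) \<and> (\<forall>z\<in>S. \<not> reg J z \<longrightarrow> z \<in> \<Union>X)"
proof -
  define F where "F = {colon J w | w. w \<in> S - J}"
  define X where "X = {Q \<in> F. \<forall>Q'\<in>F. Q \<subseteq> Q' \<longrightarrow> Q' = Q}"
  have FI: "idl Q" if "Q \<in> F" for Q using that idl_colon[OF J] by (auto simp: F_def)
  have Xprm: "prm Q" if Q: "Q \<in> X" for Q
  proof -
    obtain w where w: "w \<in> S" "w \<notin> J" "Q = colon J w" using Q by (auto simp: X_def F_def)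
    show ?thesis unfolding prm_def
    proof (intro conjI ballI impI)
      show "idl Q" using FI Q by (auto simp: X_def)
      show "1 \<notin> Q" using w by (auto simp: colon_def)
      fix a b assume ab: "a \<in> S" "b \<in> S" "a * b \<in> Q"
      show "a \<in> Q \<or> b \<in> Q"
      proof (rule disjCI)
        assume "b \<notin> Q"
        then have bw: "b * w \<in> S - J" using w ab by (auto simp: colon_def)
        have "colon J w \<subseteq> colon J (b * w)"
          using idlD(4)[OF J ab(2)] by (auto simp: colon_def mult.left_commute[of _ b])
        moreover have "colon J (b * w) \<in> F" using bw by (auto simp: F_def)
        ultimately have "colon J (b * w) = Q" using Q w by (auto simp: X_def)
        moreover have "a \<in> colon J (b * w)" using ab w by (auto simp: colon_def mult.assoc)
        ultimately show "a \<in> Q" by simp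
      qed
    qed
  qed
  have cover: "z \<in> \<Union>X" if z: "z \<in> S" "\<not> reg J z" for z
  proof -
    obtain w where w: "w \<in> S - J" "z * w \<in> J" using z by (auto simp: reg_def)
    then have zc: "z \<in> colon J w" using z by (auto simp: colon_def)
    define F' where "F' = {Q \<in> F. colon J w \<subseteq> Q}"
    have "F' \<noteq> {}" using w by (auto simp: F'_def F_def)
    then obtain Q where Q: "Q \<in> F'" "\<forall>K\<in>F'. Q \<subseteq> K \<longrightarrow> K = Q"
      using max_cond[of F'] FI by (auto simp: F'_def)
    then have "Q \<in> X" by (auto simp: X_def F'_def)
    then show ?thesis using Q(1) zc by (auto simp: F'_def)
  qed
  have "\<forall>Q\<in>X. \<exists>w. w \<in> S - J \<and> Q = colon J w" by (auto simp: X_def F_def)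
  then obtain w where w: "\<And>Q. Q \<in> X \<Longrightarrow> w Q \<in> S - J \<and> Q = colon J (w Q)" by metis
  define gen where "gen B = {j + (\<Sum>Q\<in>B. s Q * w Q) | j s. j \<in> J \<and> (\<forall>Q. s Q \<in> S)}" for B
  have idl_gen: "idl (gen B)" if B: "B \<subseteq> X" for B
    unfolding idl_def
  proof (intro conjI ballI subsetI)
    show "a \<in> S" if a: "a \<in> gen B" for a
    proof -
      obtain j s where j: "a = j + (\<Sum>Q\<in>B. s Q * w Q)" "j \<in> J" "\<forall>Q. s Q \<in> S"
        using a by (auto simp: gen_def)
      have "(\<Sum>Q\<in>B. s Q * w Q) \<in> S" using j(3) w B by (intro sum_in) blast
      then show ?thesis using j idlD(1)[OF J] by blast
    qed
    have "0 = 0 + (\<Sum>Q\<in>B. 0 * w Q)" by simp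
    then show "0 \<in> gen B" unfolding gen_def using idlD(2)[OF J] zero_in
      by (intro CollectI exI[of _ 0] exI[of _ "\<lambda>_. 0"]) auto
  next
    fix a b assume "a \<in> gen B" "b \<in> gen B"
    then obtain j s j' s' where "a = j + (\<Sum>Q\<in>B. s Q * w Q)" "b = j' + (\<Sum>Q\<in>B. s' Q * w Q)"
       and js: "j \<in> J" "j' \<in> J" "\<forall>Q. s Q \<in> S" "\<forall>Q. s' Q \<in> S" by (auto simp: gen_def)
    then have "a + b = (j + j') + (\<Sum>Q\<in>B. (s Q + s' Q) * w Q)"
      by (simp add: algebra_simps sum.distrib)
    moreover have "j + j' \<in> J" "\<forall>Q. s Q + s' Q \<in> S" using js idlD(3)[OF J] by auto
    ultimately show "a + b \<in> gen B" unfolding gen_def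
      by (intro CollectI exI[of _ "j + j'"] exI[of _ "\<lambda>Q. s Q + s' Q"]) auto
  next
    fix t a assume t: "t \<in> S" "a \<in> gen B"
    then obtain j s where "a = j + (\<Sum>Q\<in>B. s Q * w Q)" and js: "j \<in> J" "\<forall>Q. s Q \<in> S"
      by (auto simp: gen_def)
    then have "t * a = t * j + (\<Sum>Q\<in>B. (t * s Q) * w Q)"
      by (simp add: algebra_simps sum_distrib_left)
    moreover have "t * j \<in> J" "\<forall>Q. t * s Q \<in> S" using js t idlD(4)[OF J] by auto
    ultimately show "t * a \<in> gen B" unfolding gen_def
      by (intro CollectI exI[of _ "t * j"] exI[of _ "\<lambda>Q. t * s Q"]) auto
  qed
  have mono: "gen B \<subseteq> gen (insert Q B)" and mem: "w Q \<in> gen (insert Q B)"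
    if B: "finite B" for B Q
  proof -
    have ext: "j + (\<Sum>P\<in>B. s P * w P) \<in> gen (insert Q B)" if "j \<in> J" "\<forall>P. s P \<in> S" for j s
    proof -
      have "(\<Sum>P\<in>B. s P * w P) = (\<Sum>P\<in>insert Q B. (if P \<in> B then s P else 0) * w P)"
        using B by (intro sum.mono_neutral_cong_left) auto
      then show ?thesis using that unfolding gen_def
        by (intro CollectI exI[of _ j] exI[of _ "\<lambda>P. if P \<in> B then s P else 0"]) auto
    qed
    then show "gen B \<subseteq> gen (insert Q B)" by (auto simp: gen_def)
    have "w Q = 0 + (\<Sum>P\<in>insert Q B. (if P = Q then 1 else 0) * w P)"
      using B by (simp add: if_distrib[of "\<lambda>x. x * _"] cong: if_cong)
    then show "w Q \<in> gen (insert Q B)" unfolding gen_def using idlD(2)[OF J]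
      by (intro CollectI exI[of _ 0] exI[of _ "\<lambda>P. if P = Q then 1 else 0"]) auto
  qed
  define G where "G = {gen B | B. finite B \<and> B \<subseteq> X}"
  have "gen {} \<in> G" by (auto simp: G_def)
  then have "G \<noteq> {}" by blast
  moreover have "idl K" if "K \<in> G" for K using that idl_gen by (auto simp: G_def)
  ultimately have "\<exists>K\<in>G. \<forall>K'\<in>G. K \<subseteq> K' \<longrightarrow> K' = K" by (rule max_cond)
  then obtain B where B: "finite B" "B \<subseteq> X" and Bmax: "\<forall>K\<in>G. gen B \<subseteq> K \<longrightarrow> K = gen B"
    by (auto simp only: G_def)
  have "X \<subseteq> B"
  proof
    fix Q assume Q: "Q \<in> X"
    have "gen (insert Q B) \<in> G" using B Q unfolding G_def by blast
    then have "gen (insert Q B) = gen B" using Bmax mono[OF B(1), of Q] by blast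
    then have "w Q \<in> gen B" using mem[OF B(1), of Q] by simp
    then obtain j s where js: "w Q = j + (\<Sum>P\<in>B. s P * w P)" "j \<in> J" "\<forall>P. s P \<in> S"
      by (auto simp: gen_def)
    have "\<exists>P\<in>B. P \<subseteq> Q"
    proof (rule ccontr)
      assume "\<not> ?thesis"
      then have "\<forall>P\<in>B. \<exists>a. a \<in> P \<and> a \<notin> Q" by blast
      then obtain a where a: "\<And>P. P \<in> B \<Longrightarrow> a P \<in> P \<and> a P \<notin> Q" by metis
      have aS: "a P \<in> S" if "P \<in> B" for P using a[OF that] B(2) that Xprm prmD(1) idlD(1) by blast
      have cS: "prod a B \<in> S" by (rule prod_in[OF aS])
      have "prod a B * w P \<in> J" if P: "P \<in> B" for P
      proof -
        have "prod a B \<in> P"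
          using P B Xprm[of P] prmD(1) a[OF P] by (intro idl_prod_mem[OF _ B(1) aS P]) auto
        then show ?thesis using w[of P] P B by (auto simp: colon_def)
      qed
      then have "prod a B * (s P * w P) \<in> J" if "P \<in> B" for P
        using that js(3) idlD(4)[OF J, of "s P" "prod a B * w P"] by (simp add: mult.left_commute)
      then have "prod a B * w Q \<in> J" unfolding js(1) distrib_left sum_distrib_left
        using js(2) cS by (intro idlD(3)[OF J] idlD(4)[OF J _ js(2)] idl_sum[OF J]) auto
      then have "prod a B \<in> Q" using w[OF Q] cS by (auto simp: colon_def)
      from prm_prod[OF Xprm[OF Q] B(1) aS this] a show False by blast
    qed
    then obtain P where P: "P \<in> B" "P \<subseteq> Q" by blast
    have "\<forall>Q'\<in>F. P \<subseteq> Q' \<longrightarrow> Q' = P" "Q \<in> F" using subsetD[OF B(2) P(1)] Q by (simp_all add: X_def)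
    then show "Q \<in> B" using P by metis
  qed
  then have "finite X" using B(1) by (rule finite_subset)
  moreover have "\<forall>Q\<in>X. prm Q \<and> (\<exists>w\<in>S - J. Q = colon J w)" using Xprm by (auto simp: X_def F_def)
  ultimately show ?thesis using cover by (intro exI[of _ X]) simp
qed

text \<open>Modulo each \<open>J\<close> in \<open>Js\<close> the elements that are not regular lie
  in finitely many primes \<open>colon J w\<close>, none of which contains \<open>I\<close>; prime
  avoidance applies to these together with \<open>Qs\<close>.\<close>

lemma exists_regular:
  assumes I: "idl I" and Js: "finite Js" "\<And>J. J \<in> Js \<Longrightarrow> idl J"
    "\<And>J w. J \<in> Js \<Longrightarrow> w \<in> S - J \<Longrightarrow> \<not> I \<subseteq> colon J w"
    and Qs: "finite Qs" "\<And>Q. Q \<in> Qs \<Longrightarrow> prm Q" "\<And>Q. Q \<in> Qs \<Longrightarrow> \<not> I \<subseteq> Q"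
  shows "\<exists>z\<in>I. (\<forall>J\<in>Js. reg J z) \<and> (\<forall>Q\<in>Qs. z \<notin> Q)"
proof -
  have "\<forall>J\<in>Js. \<exists>X. finite X \<and> (\<forall>Q\<in>X. prm Q \<and> (\<exists>w\<in>S - J. Q = colon J w))
    \<and> (\<forall>z\<in>S. \<not> reg J z \<longrightarrow> z \<in> \<Union>X)"
    using associated_primes Js(2) by blast
  then obtain X where X: "\<And>J. J \<in> Js \<Longrightarrow> finite (X J) \<and> (\<forall>Q\<in>X J. prm Q \<and> (\<exists>w\<in>S - J. Q = colon J w))
    \<and> (\<forall>z\<in>S. \<not> reg J z \<longrightarrow> z \<in> \<Union>(X J))"
    by metis
  have "\<exists>z\<in>I. \<forall>Q\<in>Qs \<union> (\<Union>J\<in>Js. X J). z \<notin> Q"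
  proof (rule prime_avoidance[OF I])
    show "finite (Qs \<union> (\<Union>J\<in>Js. X J))" using Qs Js X by blast
    show "prm Q" if "Q \<in> Qs \<union> (\<Union>J\<in>Js. X J)" for Q using that Qs X by blast
    show "\<not> I \<subseteq> Q" if "Q \<in> Qs \<union> (\<Union>J\<in>Js. X J)" for Q
    proof (cases "Q \<in> Qs")
      case False
      then obtain J where J: "J \<in> Js" "Q \<in> X J" using \<open>Q \<in> Qs \<union> (\<Union>J\<in>Js. X J)\<close> by blast
      then obtain w where "w \<in> S - J" "Q = colon J w" using X[OF J(1)] by blast
      then show ?thesis using Js(3)[OF J(1)] by simp
    qed (rule Qs(3))
  qed
  then obtain z where z: "z \<in> I" "\<And>Q. Q \<in> Qs \<union> (\<Union>J\<in>Js. X J) \<Longrightarrow> z \<notin> Q" by blast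
  have "reg J z" if J: "J \<in> Js" for J
  proof (rule ccontr)
    assume "\<not> reg J z"
    then have "z \<in> \<Union>(X J)" using X[OF J] idlD(1)[OF I z(1)] by blast
    then show False using z(2) J by blast
  qed
  then show ?thesis using z by (intro bexI[OF _ z(1)]) simp
qed

section \<open>Regular sequences modulo an ideal and their exchange\<close>

fun rs :: "'a set \<Rightarrow> 'a list \<Rightarrow> bool" where
  "rs J [] = True"
| "rs J (y # ys) = (y \<in> m \<and> reg J y \<and> rs (adj J y) ys)"

lemma rs_append: "rs J (xs @ ys) \<longleftrightarrow> rs J xs \<and> rs (foldl adj J xs) ys"
  by (induction xs arbitrary: J) auto

text \<open>Repeated use of \<open>reg_swap\<close>: being regular modulo every initial ideal,
  \<open>z\<close> can be moved from the end of the sequence to its front.\<close>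

lemma rs_adj_front:
  assumes "idl J" "rs J ys" "z \<in> m" "\<And>i. i \<le> length ys \<Longrightarrow> reg (foldl adj J (take i ys)) z"
  shows "rs (adj J z) ys"
  using assms
proof (induction ys arbitrary: J)
  case (Cons y ys)
  have y: "y \<in> m" "reg J y" "rs (adj J y) ys" using Cons.prems by auto
  have "reg J z" "reg (adj J y) z" using Cons.prems(4)[of 0] Cons.prems(4)[of 1] by auto
  then have "reg (adj J z) y" using reg_swap[OF Cons.prems(1) mS mS] y Cons.prems(3) by blast
  moreover have "rs (adj (adj J y) z) ys"
    using Cons.prems(3) Cons.prems(4)[of "Suc _"] y mS
    by (intro Cons.IH idl_adj[OF Cons.prems(1)]) auto
  ultimately show ?case using y adj_commute[of J y z] by simp
qed simp

text \<open>If \<open>S/(J, f)\<close> had an element killed by \<open>x\<close> and \<open>y\<close>, then so would \<open>S/(J, x)\<close>.\<close>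

lemma no_socle_after_exchange:
  assumes J: "idl J" and xy: "x \<in> m" "y \<in> m" "reg J x" "reg (adj J x) y"
    and f: "f \<in> S" "reg J f" and w: "w \<in> S" "m \<subseteq> colon (adj J f) w"
  shows "w \<in> adj J f"
proof -
  have "x * w \<in> adj J f" "y * w \<in> adj J f" using xy w by (auto simp: colon_def)
  then obtain j v j2 v2 where jv: "j \<in> J" "v \<in> S" "x * w = j + f * v" "j2 \<in> J" "v2 \<in> S"
    "y * w = j2 + f * v2"
    by (auto simp: adj_def)
  have S: "x \<in> S" "y \<in> S" using xy mS by auto
  have "f * (y * v - x * v2) = y * (x * w - j) - x * (y * w - j2)"
    using jv(3,6) by (simp add: algebra_simps)
  also have "\<dots> = x * j2 - y * j" by (simp add: algebra_simps)
  also have "\<dots> \<in> J" using jv S by (intro idlD(7)[OF J] idlD(4)[OF J])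
  finally have "y * v - x * v2 \<in> J" using f jv S by (auto simp: reg_def)
  then have "y * v \<in> adj J x" using adjI[of "y * v - x * v2" J v2 x] jv by simp
  then have "v \<in> adj J x" using xy(4) jv by (auto simp: reg_def)
  then obtain j' t where t: "j' \<in> J" "t \<in> S" "v = j' + x * t" by (auto simp: adj_def)
  have "x * (w - f * t) = j + f * j'" using jv t by (simp add: algebra_simps)
  also have "\<dots> \<in> J" using jv t f by (intro idlD(3)[OF J] idlD(4)[OF J])
  finally have "w - f * t \<in> J" using xy(3) w t f by (auto simp: reg_def)
  then show ?thesis using adjI[of "w - f * t" J t f] t by simp
qed

lemma foldl_adj_idl: "idl J \<Longrightarrow> set ys \<subseteq> S \<Longrightarrow> idl (foldl adj J ys)"
  by (induction ys arbitrary: J) (auto intro: idl_adj)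

lemma rs_set: "rs J ys \<Longrightarrow> set ys \<subseteq> m"
  by (induction ys arbitrary: J) auto

lemma rs_nth: "rs J ys \<Longrightarrow> i < length ys \<Longrightarrow> reg (foldl adj J (take i ys)) (ys ! i)"
  by (induction ys arbitrary: J i) (auto simp: nth_Cons take_Cons split: nat.splits)

lemma rs_take: "rs J ys \<Longrightarrow> rs J (take i ys)"
  using rs_append[of J "take i ys" "drop i ys"] by simp

text \<open>This stands in for the equality of lengths of maximal regular sequences: passing to
  \<open>J + fS\<close> costs one term. In the inductive step choose \<open>z\<close> in
  \<open>m\<close> regular modulo \<open>J + fS\<close> and modulo all ideals generated by
  \<open>J\<close> and a proper initial segment of \<open>ys\<close>; with \<open>z\<close> moved to
  the front, the induction runs modulo \<open>J + zS\<close> on the sequence shortened by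
  one.\<close>

theorem regular_sequence_exchange:
  assumes "idl J" "rs J ys" "length ys = Suc k" "f \<in> m" "reg J f"
  shows "\<exists>zs. length zs = k \<and> rs (adj J f) zs"
  using assms
proof (induction k arbitrary: J ys)
  case 0
  show ?case by (intro exI[of _ "[]"]) auto
next
  case (Suc k)
  note J = Suc.prems(1)
  have ysm: "set ys \<subseteq> m" using rs_set Suc.prems(2) by blast
  have fS: "f \<in> S" using mS Suc.prems(4) .
  define Js where "Js = insert (adj J f) ((\<lambda>i. foldl adj J (take i ys)) ` {..Suc k})"
  have J_i: "idl (foldl adj J (take i ys))" for i
    using foldl_adj_idl[OF J] ysm mS set_take_subset[of i ys] by blast
  have "\<exists>z\<in>m. (\<forall>J\<in>Js. reg J z) \<and> (\<forall>Q\<in>{}. z \<notin> Q)"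
  proof (rule exists_regular[OF idl_m])
    show "finite Js" by (simp add: Js_def)
    show "idl K" if "K \<in> Js" for K using that J_i idl_adj[OF J fS] by (auto simp: Js_def)
    fix K w assume K: "K \<in> Js" and w: "w \<in> S - K"
    show "\<not> m \<subseteq> colon K w"
    proof
      assume sub: "m \<subseteq> colon K w"
      show False
      proof (cases "K = adj J f")
        case True
        \<comment> \<open>In the inductive step \<open>ys\<close> has at least two terms, as the
          socle argument requires.\<close>
        obtain x y ys' where ys: "ys = x # y # ys'"
          using Suc.prems(3) by (cases ys; cases "tl ys") auto
        then have "w \<in> adj J f"
          using Suc.prems(2,5) fS w sub True
          by (intro no_socle_after_exchange[OF J, of x y]) auto
        then show False using w True by blast
      next
        case False
        then obtain i where i: "i \<le> Suc k" "K = foldl adj J (take i ys)" using K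
          by (auto simp: Js_def)
        then have "reg K (ys ! i)" "ys ! i \<in> m" using rs_nth[OF Suc.prems(2), of i] Suc.prems(3) ysm
          by auto
        then show False using sub w by (auto simp: reg_def colon_def)
      qed
    qed
  qed auto
  then obtain z where z: "z \<in> m" "reg (adj J f) z"
    and zi: "\<And>i. i \<le> Suc k \<Longrightarrow> reg (foldl adj J (take i ys)) z" by (auto simp: Js_def)
  have zS: "z \<in> S" using mS z by blast
  have Jz: "reg J z" using zi[of 0] by simp
  have "rs (adj J z) (take (Suc k) ys)"
    using zi Suc.prems(3) by (intro rs_adj_front[OF J rs_take[OF Suc.prems(2)] z(1)]) (auto simp: min_def)
  moreover have "reg (adj J z) f" by (rule reg_swap[OF J fS zS Suc.prems(5) z(2) Jz])
  ultimately obtain zs where zs: "length zs = k" "rs (adj (adj J z) f) zs"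
    using Suc.IH[OF idl_adj[OF J zS], of "take (Suc k) ys"] Suc.prems(3,4) by auto
  then have "rs (adj J f) (z # zs)" using z adj_commute[of J z f] by simp
  then show ?case using zs by (intro exI[of _ "z # zs"]) auto
qed

section \<open>Chains of primes above annihilators\<close>

definition prime_chain :: "'a set \<Rightarrow> nat \<Rightarrow> bool" where
  "prime_chain I r \<longleftrightarrow> (\<exists>q. (\<forall>i\<le>r. prm (q i)) \<and> (\<forall>i<r. q i \<subset> q (Suc i)) \<and> I \<subseteq> q 0)"

lemma prime_chain_mono: "prime_chain I' r \<Longrightarrow> I \<subseteq> I' \<Longrightarrow> prime_chain I r"
  unfolding prime_chain_def by blast

text \<open>This is the inequality between the depth of \<open>S/J\<close> and the dimension of
  \<open>S/Q\<close> for \<open>Q\<close> associated to \<open>J\<close>, phrased with annihilators.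
  An element \<open>v\<close> outside \<open>J + yS\<close> with \<open>y ^ i * v\<close> in
  \<open>J + wS\<close> is annihilated modulo \<open>J\<close> by whatever annihilates
  \<open>w\<close>. Induction gives a chain above the annihilator of \<open>v\<close> modulo
  \<open>J + yS\<close>, and a prime not containing \<open>y\<close> is inserted below that
  chain.\<close>

theorem prime_chain_colon:
  assumes "idl J" "rs J ys" "w \<in> S - J"
  shows "prime_chain (colon J w) (length ys)"
  using assms
proof (induction ys arbitrary: J w)
  case Nil
  have "colon J w \<subseteq> m"
    using Nil proper_sub_m[OF idl_colon[of J w]] by (auto simp: colon_def)
  then show ?case unfolding prime_chain_def using prm_m by auto
next
  case (Cons y ys)
  note J = Cons.prems(1)
  have y: "y \<in> m" "reg J y" "rs (adj J y) ys" using Cons.prems by auto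
  have yS: "y \<in> S" using mS y(1) .
  have Jy: "idl (adj J y)" by (rule idl_adj[OF J yS])
  have wS: "w \<in> S" using Cons.prems by blast
  \<comment> \<open>The saturation of \<open>J + wS\<close> by powers of \<open>y\<close>. Were it
    contained in \<open>J + yS\<close>, Nakayama would make it equal to \<open>J\<close>, although
    it contains \<open>w\<close>.\<close>
  define N where "N = {z \<in> S. \<exists>i. y ^ i * z \<in> adj J w}"
  have Jw: "idl (adj J w)" by (rule idl_adj[OF J wS])
  have N: "idl N" unfolding idl_def
  proof (intro conjI ballI)
    show "N \<subseteq> S" by (auto simp: N_def)
    show "0 \<in> N" using idlD(2)[OF Jw] by (auto simp: N_def)
  next
    fix a b assume "a \<in> N" "b \<in> N"
    then obtain i k where ik: "a \<in> S" "b \<in> S" "y ^ i * a \<in> adj J w" "y ^ k * b \<in> adj J w"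
      by (auto simp: N_def)
    have "y ^ (i + k) * (a + b) = y ^ k * (y ^ i * a) + y ^ i * (y ^ k * b)"
      by (simp add: algebra_simps power_add)
    also have "\<dots> \<in> adj J w"
      by (intro idlD(3)[OF Jw] idlD(4)[OF Jw _ ik(3)] idlD(4)[OF Jw _ ik(4)] power_in yS)
    finally show "a + b \<in> N" using ik by (auto simp: N_def)
  next
    fix s a assume s: "s \<in> S" "a \<in> N"
    then obtain i where i: "a \<in> S" "y ^ i * a \<in> adj J w" by (auto simp: N_def)
    have "y ^ i * (s * a) \<in> adj J w" using idlD(4)[OF Jw s(1) i(2)] by (simp add: mult.left_commute)
    then show "s * a \<in> N" using s i by (auto simp: N_def)
  qed
  have JN: "J \<subseteq> N" using adj_sub[of J w] idlD(1)[OF J] by (auto simp: N_def intro!: exI[of _ 0])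
  have wN: "w \<in> N" using adj_self[OF J, of w] wS by (auto simp: N_def intro!: exI[of _ 0])
  have "\<not> N \<subseteq> adj J y"
  proof
    assume sub: "N \<subseteq> adj J y"
    have "N = J"
    proof (rule nakayama[OF J N JN y(1)])
      fix a assume a: "a \<in> N"
      then obtain j s where j: "j \<in> J" "s \<in> S" "a = j + y * s" using sub by (auto simp: adj_def)
      have "y * s = a - j" using j by simp
      then have "y * s \<in> N" using idlD(7)[OF N a, of j] JN j(1) by (simp only: subsetD)
      then obtain i where "y ^ i * (y * s) \<in> adj J w" by (auto simp: N_def)
      then have "y ^ Suc i * s \<in> adj J w" by (simp add: mult_ac)
      then have "s \<in> N" using j unfolding N_def by blast
      then show "\<exists>j\<in>J. \<exists>b\<in>N. a = j + y * b" using j by blast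
    qed
    then show False using wN Cons.prems(3) by blast
  qed
  then obtain v i where v: "v \<in> S" "y ^ i * v \<in> adj J w" "v \<notin> adj J y" by (auto simp: N_def)
  have colon_v: "c * v \<in> J" if c: "c \<in> colon J w" for c
  proof -
    obtain j s where j: "j \<in> J" "s \<in> S" "y ^ i * v = j + w * s" using v(2) by (auto simp: adj_def)
    have cS: "c \<in> S" "c * w \<in> J" using c by (auto simp: colon_def)
    have "y ^ i * (c * v) = c * j + (c * w) * s" using j by (simp add: algebra_simps)
    also have "\<dots> \<in> J"
      using idlD(3)[OF J idlD(4)[OF J cS(1) j(1)] idlD(5)[OF J j(2) cS(2)]] .
    finally have "y ^ i * (c * v) \<in> J" .
    then show ?thesis
    proof (induction i)
      case (Suc i)
      have "y * (y ^ i * (c * v)) \<in> J" using Suc.prems by (simp add: mult_ac)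
      then show ?case using y(2) yS cS v Suc.IH unfolding reg_def by (meson mult_in power_in)
    qed simp
  qed
  have "v \<in> S - adj J y" using v by blast
  from Cons.IH[OF Jy y(3) this] obtain q where q: "\<And>i. i \<le> length ys \<Longrightarrow> prm (q i)"
    "\<And>i. i < length ys \<Longrightarrow> q i \<subset> q (Suc i)" "colon (adj J y) v \<subseteq> q 0" by (auto simp: prime_chain_def)
  have q0: "prm (q 0)" using q(1) by simp
  \<comment> \<open>A prime missing \<open>T\<close> is contained in \<open>q 0\<close> and avoids
    \<open>y\<close>, whereas \<open>y \<in> q 0\<close>; so the new inclusion is strict.\<close>
  define T where "T = {y ^ i * s | i s. s \<in> S - q 0}"
  have "\<exists>Q. prm Q \<and> colon J v \<subseteq> Q \<and> Q \<inter> T = {} \<and> (\<forall>a\<in>S - Q. \<exists>p\<in>Q. \<exists>r\<in>S. p + a * r \<in> T)"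
  proof (rule exists_prm_disjoint)
    show "idl (colon J v)" using idl_colon[OF J] v by blast
    have "y ^ 0 * 1 \<in> T" unfolding T_def using prmD(2)[OF q0] by blast
    then show "1 \<in> T" by simp
    fix a b assume "a \<in> T" "b \<in> T"
    then obtain i s k t where st: "a = y ^ i * s" "b = y ^ k * t" "s \<in> S - q 0" "t \<in> S - q 0"
      by (auto simp: T_def)
    have "a * b = y ^ (i + k) * (s * t)" using st by (simp add: power_add mult_ac)
    moreover have "s * t \<in> S - q 0" using st prmD(3)[OF q0] by blast
    ultimately show "a * b \<in> T" unfolding T_def by blast
  next
    have "s \<in> q 0" if s: "s \<in> S" "y ^ i * s * v \<in> J" for i s
      using s(2)
    proof (induction i)
      case 0
      then have "s \<in> colon (adj J y) v" using s adj_sub[of J y] by (auto simp: colon_def)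
      then show ?case using q(3) by blast
    next
      case (Suc i)
      have "y * (y ^ i * s * v) \<in> J" using Suc.prems by (simp add: mult_ac)
      then show ?case using y(2) yS s v Suc.IH unfolding reg_def by (meson mult_in power_in)
    qed
    then show "colon J v \<inter> T = {}" by (auto simp: colon_def T_def)
  qed
  then obtain Q where Q: "prm Q" "colon J v \<subseteq> Q" "Q \<inter> T = {}" by blast
  have "Q \<subseteq> q 0"
  proof
    fix a assume a: "a \<in> Q"
    show "a \<in> q 0"
    proof (rule ccontr)
      assume "a \<notin> q 0"
      then have "y ^ 0 * a \<in> T" using idlD(1)[OF prmD(1)[OF Q(1)] a] unfolding T_def by blast
      then show False using Q(3) a by auto
    qed
  qed
  moreover have "y \<in> q 0"
    using q(3) adjI[of 0 J v y] idlD(2)[OF J] v yS by (auto simp: colon_def)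
  moreover have "y \<notin> Q"
  proof -
    have "y ^ 1 * 1 \<in> T" unfolding T_def using prmD(2)[OF q0] by blast
    then show ?thesis using Q(3) by auto
  qed
  ultimately have sub: "Q \<subset> q 0" by blast
  have wQ: "colon J w \<subseteq> Q" using colon_v Q(2) by (auto simp: colon_def)
  define q' where "q' i = (case i of 0 \<Rightarrow> Q | Suc i \<Rightarrow> q i)" for i
  have "(\<forall>i\<le>Suc (length ys). prm (q' i)) \<and> (\<forall>i<Suc (length ys). q' i \<subset> q' (Suc i))
    \<and> colon J w \<subseteq> q' 0"
    using q Q(1) wQ sub by (auto simp: q'_def less_Suc_eq_0_disj split: nat.splits)
  then show ?case unfolding prime_chain_def by auto
qed

text \<open>After \<open>a1\<close> and \<open>a2\<close> regular sequences of length
  \<open>k + 1\<close> and \<open>k\<close> remain, so at both stages the annihilator of a nonzero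
  class lies below a prime chain of length \<open>k\<close> and cannot contain \<open>I\<close>.
  Avoiding \<open>Qs\<close> is what later makes \<open>a2\<close> coprime to
  \<open>a1\<close>.\<close>

theorem exists_regular_triple:
  assumes rs: "rs {0} ys" "length ys = Suc (Suc k)" and I: "idl I" "I \<subseteq> m"
    and chain: "\<not> prime_chain I k"
    and a1: "a1 \<in> I" "reg {0} a1"
    and Qs: "finite Qs" "\<And>Q. Q \<in> Qs \<Longrightarrow> prm Q" "\<And>Q. Q \<in> Qs \<Longrightarrow> \<not> I \<subseteq> Q"
  shows "\<exists>a2\<in>I. (\<forall>Q\<in>Qs. a2 \<notin> Q) \<and> (\<exists>a3\<in>I. reg (adj (adj {0} a1) a2) a3)"
proof -
  let ?J1 = "adj {0} a1"
  have a1S: "a1 \<in> S" "a1 \<in> m" using a1 I mS by auto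
  have J1: "idl ?J1" by (rule idl_adj[OF idl_zero a1S(1)])
  obtain y1 where y1: "rs ?J1 y1" "length y1 = Suc k"
    using regular_sequence_exchange[OF idl_zero rs a1S(2) a1(2)] by blast
  have no: "\<not> I \<subseteq> colon J w" if "idl J" "rs J zs" "length zs \<ge> k" "w \<in> S - J" for J w zs
  proof
    assume "I \<subseteq> colon J w"
    moreover have "prime_chain (colon J w) (length (take k zs))"
      using that by (intro prime_chain_colon rs_take) auto
    ultimately show False using chain prime_chain_mono that by auto
  qed
  have "\<exists>z\<in>I. (\<forall>J\<in>{?J1}. reg J z) \<and> (\<forall>Q\<in>Qs. z \<notin> Q)"
    using J1 no[OF J1 y1(1)] y1(2) Qs by (intro exists_regular[OF I(1)]) auto
  then obtain a2 where a2: "a2 \<in> I" "reg ?J1 a2" "\<forall>Q\<in>Qs. a2 \<notin> Q" by blast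
  let ?J2 = "adj ?J1 a2"
  have a2S: "a2 \<in> S" "a2 \<in> m" using a2 I mS by auto
  have J2: "idl ?J2" by (rule idl_adj[OF J1 a2S(1)])
  obtain y2 where y2: "rs ?J2 y2" "length y2 = k"
    using regular_sequence_exchange[OF J1 y1 a2S(2) a2(2)] by blast
  have "\<exists>z\<in>I. (\<forall>J\<in>{?J2}. reg J z) \<and> (\<forall>Q\<in>{}. z \<notin> Q)"
    using J2 no[OF J2 y2(1)] y2(2) by (intro exists_regular[OF I(1)]) auto
  then show ?thesis using a2 by blast
qed

end


section \<open>Localizations inside a fraction field\<close>

lemma (in cring) ideal_criterion:
  assumes "J \<subseteq> carrier R" "\<zero> \<in> J" and add: "\<And>a b. a \<in> J \<Longrightarrow> b \<in> J \<Longrightarrow> a \<oplus> b \<in> J"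
    and mult: "\<And>s a. s \<in> carrier R \<Longrightarrow> a \<in> J \<Longrightarrow> s \<otimes> a \<in> J"
  shows "ideal J R"
proof (rule idealI[OF ring_axioms])
  have neg: "\<ominus> x \<in> J" if "x \<in> J" for x
  proof -
    have "x \<in> carrier R" using that assms(1) by blast
    then have "\<ominus> x = (\<ominus> \<one>) \<otimes> x" using l_minus[of \<one> x] by simp
    then show ?thesis using mult[OF _ that, of "\<ominus> \<one>"] by simp
  qed
  show "subgroup J (add_monoid R)"
    by (rule group.subgroupI[OF a_group])
      (use assms neg in \<open>auto simp: a_inv_def[symmetric]\<close>)
  show "x \<otimes> a \<in> J" "a \<otimes> x \<in> J" if "a \<in> J" "x \<in> carrier R" for a x
    using mult[OF that(2,1)] m_comm[of a x] that assms(1) by (auto dest: subsetD)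
qed

lemma (in cring) nonzerodivisor_quotD:
  assumes J: "ideal J R" and x: "x \<in> carrier R" and nz: "nonzerodivisor (R Quot J) (J +> x)"
    and y: "y \<in> carrier R" "x \<otimes> y \<in> J"
  shows "y \<in> J"
proof -
  interpret J: ideal J R by (rule J)
  have "J +> y \<in> carrier (R Quot J)"
    using y(1) by (auto simp: FactRing_def A_RCOSETS_def')
  moreover have "(J +> x) \<otimes>\<^bsub>R Quot J\<^esub> (J +> y) = \<zero>\<^bsub>R Quot J\<^esub>"
    using J.rcoset_mult_add[OF x y(1)] J.a_rcos_const[OF y(2)] by (simp add: FactRing_def)
  ultimately have "J +> y = J" using nz by (simp add: nonzerodivisor_def FactRing_def)
  then show "y \<in> J" using J.a_rcos_self[OF y(1)] by simp
qed

text \<open>An infinite supremum may be attained by no member, but a finite lower bound of it is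
  still reached; the successor turns the strict inequality for \<open>k\<close> into the
  bound.\<close>

lemma enat_le_SupD:
  assumes "enat (Suc k) \<le> Sup X"
  shows "\<exists>x\<in>X. enat (Suc k) \<le> x"
proof -
  have "enat k < Sup X" using assms by (meson enat_ord_simps(2) lessI less_le_trans)
  then obtain x where "x \<in> X" "enat k < x" by (auto simp: less_Sup_iff)
  then show ?thesis by (intro bexI[of _ x]) (auto simp: Suc_ile_eq)
qed

text \<open>The link to HOL-Algebra, in whose terms \<open>cohen_macaulay\<close> is stated: ideals
  and primes of this record are \<open>idl\<close> and \<open>prm\<close>.\<close>

definition set_ring :: "'a::comm_ring_1 set \<Rightarrow> 'a ring" where
  "set_ring A = \<lparr>carrier = A, mult = (*), one = 1, zero = 0, add = (+)\<rparr>"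

context unital_subring
begin

lemma cring_set_ring: "cring (set_ring S)"
  unfolding set_ring_def by (rule cring_type_subset) auto

lemma ideal_set_ring_iff: "ideal J (set_ring S) \<longleftrightarrow> idl J"
proof
  interpret R: cring "set_ring S" by (rule cring_set_ring)
  show "idl J" if "ideal J (set_ring S)"
  proof -
    interpret J: ideal J "set_ring S" by (rule that)
    show ?thesis
      using J.a_subset J.zero_closed J.a_closed J.I_l_closed by (auto simp: idl_def set_ring_def)
  qed
  show "ideal J (set_ring S)" if "idl J"
    using that by (intro R.ideal_criterion) (auto simp: idl_def set_ring_def)
qed

lemma primeideal_set_ring_iff: "primeideal Q (set_ring S) \<longleftrightarrow> prm Q"
proof
  assume Q: "primeideal Q (set_ring S)"
  interpret Q: primeideal Q "set_ring S" by (rule Q)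
  have "idl Q" using ideal_set_ring_iff Q.ideal_axioms by blast
  moreover have "1 \<notin> Q" using Q.I_notcarr Q.one_imp_carrier by (auto simp: set_ring_def)
  ultimately show "prm Q" using Q.I_prime by (auto simp: prm_def set_ring_def)
next
  assume Q: "prm Q"
  show "primeideal Q (set_ring S)"
    using Q ideal_set_ring_iff cring_set_ring
    by (intro primeidealI) (auto simp: prm_def set_ring_def)
qed

lemma noetherian_max_cond:
  assumes noeth: "noetherian_ring (set_ring S)" and F: "F \<noteq> {}" "\<And>J. J \<in> F \<Longrightarrow> idl J"
  shows "\<exists>J\<in>F. \<forall>K\<in>F. J \<subseteq> K \<longrightarrow> K = J"
proof (rule subset_Zorn_nonempty[OF F(1)])
  interpret noetherian_ring "set_ring S" by (rule noeth)
  fix C assume C: "C \<noteq> {}" "subset.chain F C"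
  then have "subset.chain {I. ideal I (set_ring S)} C"
    using F(2) ideal_set_ring_iff by (auto simp: subset_chain_def)
  then have "\<Union>C \<in> C" by (rule ideal_chain_is_trivial[OF C(1)])
  then show "\<Union>C \<in> F" using C(2) by (auto simp: subset_chain_def)
qed

end

text \<open>\<open>A\<close> lies in an integral domain, so its localization at \<open>M\<close>
  embeds in the field of fractions. There it is again a \<open>unital_subring\<close>, and the local
  theory applies to it rather than to classes of pairs.\<close>

locale localized_subring = unital_subring A for A :: "'a::idom set" +
  fixes M :: "'a set"
  assumes prm_M: "prm M"
begin

abbreviation "L \<equiv> localization (set_ring A) M"

definition SM :: "'a fract set" where "SM = {Fract a s | a s. a \<in> A \<and> s \<in> A - M}"

definition ext :: "'a set \<Rightarrow> 'a fract set" where "ext J = {Fract a s | a s. a \<in> J \<and> s \<in> A - M}"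

definition cont :: "'a fract set \<Rightarrow> 'a set" where "cont K = {a \<in> A. Fract a 1 \<in> K}"

text \<open>The chosen representative is immaterial: in a domain, equivalent pairs have the same
  quotient.\<close>

definition frac_val :: "('a \<times> 'a) set \<Rightarrow> 'a fract" where
  "frac_val X = (case SOME p. p \<in> X of (a, s) \<Rightarrow> Fract a s)"

lemma idl_M: "idl M" using prmD(1)[OF prm_M] .

lemma compl: "s \<in> A - M \<Longrightarrow> s \<in> A" "s \<in> A - M \<Longrightarrow> s \<noteq> 0"
  using idlD(2)[OF idl_M] by auto

lemma compl_mult: "s \<in> A - M \<Longrightarrow> t \<in> A - M \<Longrightarrow> s * t \<in> A - M"
  using prmD(3)[OF prm_M] by blast

lemma compl_one: "1 \<in> A - M"
  using prmD(2)[OF prm_M] by blast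

sublocale P: primeideal M "set_ring A"
  using primeideal_set_ring_iff prm_M by simp

lemma Fract_in_SM: "a \<in> A \<Longrightarrow> s \<in> A - M \<Longrightarrow> Fract a s \<in> SM"
  by (auto simp: SM_def)

sublocale S: unital_subring SM
proof
  show "0 \<in> SM" "1 \<in> SM"
    using compl_one Fract_in_SM[of 0 1] Fract_in_SM[of 1 1]
      by (auto simp: Zero_fract_def One_fract_def)
  fix x y assume "x \<in> SM" "y \<in> SM"
  then obtain a s b t where *: "a \<in> A" "s \<in> A - M" "x = Fract a s" "b \<in> A" "t \<in> A - M"
    "y = Fract b t"
    by (auto simp: SM_def)
  have "s \<noteq> 0" "t \<noteq> 0" using * compl by blast+
  then show "x + y \<in> SM" "x * y \<in> SM"
    using * Fract_in_SM[of "a * t + b * s" "s * t"] Fract_in_SM[of "a * b"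
      "s * t"] compl_mult[of s t]
      add_in[of "a * t" "b * s"] by auto
next
  fix x assume "x \<in> SM"
  then obtain a s where "a \<in> A" "s \<in> A - M" "x = Fract a s" by (auto simp: SM_def)
  then show "- x \<in> SM" using Fract_in_SM[of "- a" s] by auto
qed

lemma Fract_mult_cancel_SM:
  assumes "a \<in> A" "s \<in> A - M"
  shows "Fract a 1 = Fract s 1 * Fract a s" "Fract a s = Fract 1 s * Fract a 1"
  using compl(2)[OF assms(2)] by (simp_all add: eq_fract)

section \<open>Extension and contraction of ideals\<close>

lemma idl_ext: assumes J: "idl J" shows "S.idl (ext J)"
  unfolding S.idl_def
proof (intro conjI ballI)
  show "ext J \<subseteq> SM" using idlD(1)[OF J] by (auto simp: ext_def SM_def)
  show "0 \<in> ext J" unfolding ext_def Zero_fract_def using idlD(2)[OF J] compl_one by blast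
next
  fix x y assume "x \<in> ext J" "y \<in> ext J"
  then obtain a s b t where *: "a \<in> J" "s \<in> A - M" "x = Fract a s" "b \<in> J" "t \<in> A - M"
    "y = Fract b t"
    by (auto simp: ext_def)
  have "s \<noteq> 0" "t \<noteq> 0" using * compl by blast+
  then have "x + y = Fract (a * t + b * s) (s * t)" using * by simp
  moreover have "a * t + b * s \<in> J" using * by (intro idlD(3)[OF J] idlD(5)[OF J]) auto
  ultimately show "x + y \<in> ext J" using compl_mult *(2,5) unfolding ext_def by blast
next
  fix x y assume "x \<in> SM" "y \<in> ext J"
  then obtain a s b t where *: "a \<in> A" "s \<in> A - M" "x = Fract a s" "b \<in> J" "t \<in> A - M"
    "y = Fract b t"
    by (auto simp: ext_def SM_def)
  then have "x * y = Fract (a * b) (s * t)" by simp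
  then show "x * y \<in> ext J" using compl_mult * idlD(4)[OF J *(1,4)] unfolding ext_def by blast
qed

lemma Fract_in_ext:
  assumes Q: "prm Q" "Q \<subseteq> M" and a: "a \<in> A" "s \<in> A - M"
  shows "Fract a s \<in> ext Q \<longleftrightarrow> a \<in> Q"
proof
  assume "Fract a s \<in> ext Q"
  then obtain b t where b: "b \<in> Q" "t \<in> A - M" "Fract a s = Fract b t" by (auto simp: ext_def)
  have "s \<noteq> 0" "t \<noteq> 0" using b a compl by blast+
  then have "a * t = b * s" using b(3) by (simp add: eq_fract)
  then have "a * t \<in> Q" using idlD(5)[OF prmD(1)[OF Q(1)] _ b(1)] a by simp
  then show "a \<in> Q" using prmD(3)[OF Q(1)] a b(2) Q(2) by blast
qed (use a in \<open>auto simp: ext_def\<close>)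

lemma prm_ext:
  assumes Q: "prm Q" "Q \<subseteq> M"
  shows "S.prm (ext Q)"
  unfolding S.prm_def
proof (intro conjI ballI impI)
  show "S.idl (ext Q)" using idl_ext prmD(1)[OF Q(1)] .
  show "1 \<notin> ext Q" using Fract_in_ext[OF Q one_in compl_one] prmD(2)[OF Q(1)]
    by (simp add: One_fract_def)
  fix x y assume "x \<in> SM" "y \<in> SM" and xy: "x * y \<in> ext Q"
  then obtain a s b t where *: "a \<in> A" "s \<in> A - M" "x = Fract a s" "b \<in> A" "t \<in> A - M"
    "y = Fract b t"
    by (auto simp: SM_def)
  then have "a * b \<in> Q" using xy Fract_in_ext[OF Q, of "a * b" "s * t"] compl_mult by auto
  then show "x \<in> ext Q \<or> y \<in> ext Q"
    using prmD(3)[OF Q(1)] * Fract_in_ext[OF Q] by auto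
qed

lemma ext_strict_mono:
  assumes "prm Q" "Q \<subseteq> M" "prm Q'" "Q' \<subseteq> M" "Q \<subset> Q'"
  shows "ext Q \<subset> ext Q'"
proof -
  obtain a where a: "a \<in> Q'" "a \<notin> Q" using assms(5) by blast
  then have aA: "a \<in> A" using idlD(1)[OF prmD(1)[OF assms(3)]] by blast
  have "Fract a 1 \<in> ext Q'" "Fract a 1 \<notin> ext Q"
    using Fract_in_ext[OF assms(1,2) aA compl_one] Fract_in_ext[OF assms(3,4) aA compl_one] a
      by auto
  moreover have "ext Q \<subseteq> ext Q'" using assms(5) by (auto simp: ext_def)
  ultimately show ?thesis by blast
qed

lemma idl_cont: assumes K: "S.idl K" shows "idl (cont K)"
  unfolding idl_def
proof (intro conjI ballI)
  show "cont K \<subseteq> A" by (auto simp: cont_def)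
  show "0 \<in> cont K" using S.idlD(2)[OF K] by (auto simp: cont_def Zero_fract_def)
  show "a + b \<in> cont K" if "a \<in> cont K" "b \<in> cont K" for a b
    using that S.idlD(3)[OF K, of "Fract a 1" "Fract b 1"] by (auto simp: cont_def)
  show "s * a \<in> cont K" if "s \<in> A" "a \<in> cont K" for s a
    using that S.idlD(4)[OF K, of "Fract s 1" "Fract a 1"] Fract_in_SM[OF _ compl_one]
      by (auto simp: cont_def)
qed

lemma Fract_in_idl_iff:
  assumes K: "S.idl K" and a: "a \<in> A" "s \<in> A - M"
  shows "Fract a s \<in> K \<longleftrightarrow> a \<in> cont K"
proof
  assume "Fract a s \<in> K"
  then have "Fract s 1 * Fract a s \<in> K" using S.idlD(4)[OF K] Fract_in_SM[OF _ compl_one] a by blast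
  then show "a \<in> cont K" using Fract_mult_cancel_SM(1)[OF a] a by (simp add: cont_def)
next
  assume "a \<in> cont K"
  then have "Fract a 1 \<in> K" by (simp add: cont_def)
  then have "Fract 1 s * Fract a 1 \<in> K" using S.idlD(4)[OF K] Fract_in_SM[OF one_in a(2)] by blast
  then show "Fract a s \<in> K" by simp
qed

text \<open>An ideal of the localization is determined by its contraction, so maximal conditions and
  strict inclusions can be checked in \<open>A\<close>.\<close>

lemma cont_mono_iff: 
  assumes K: "S.idl K" "S.idl K'"
  shows "cont K \<subseteq> cont K' \<longleftrightarrow> K \<subseteq> K'"
proof
  assume sub: "cont K \<subseteq> cont K'"
  show "K \<subseteq> K'"
  proof
    fix x assume x: "x \<in> K"
    then have "x \<in> SM" using S.idlD(1)[OF K(1)] by blast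
    then obtain a s where "a \<in> A" "s \<in> A - M" "x = Fract a s" by (auto simp: SM_def)
    then show "x \<in> K'" using x sub Fract_in_idl_iff K by blast
  qed
qed (auto simp: cont_def)

lemma prm_cont: assumes Q: "S.prm Q" shows "prm (cont Q)"
  unfolding prm_def
proof (intro conjI ballI impI)
  show "idl (cont Q)" using idl_cont S.prmD(1)[OF Q] .
  show "1 \<notin> cont Q" using S.prmD(2)[OF Q] by (auto simp: cont_def One_fract_def)
  fix a b assume ab: "a \<in> A" "b \<in> A" "a * b \<in> cont Q"
  then have "Fract a 1 * Fract b 1 \<in> Q" by (simp add: cont_def)
  then show "a \<in> cont Q \<or> b \<in> cont Q"
    using S.prmD(3)[OF Q, of "Fract a 1" "Fract b 1"] Fract_in_SM[OF _ compl_one] ab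
      by (auto simp: cont_def)
qed

lemma noetherian_local_SM:
  assumes noeth: "noetherian_ring (set_ring A)"
  shows "noetherian_local SM (ext M)"
proof
  fix F :: "'a fract set set" assume F: "F \<noteq> {}" "\<And>J. J \<in> F \<Longrightarrow> S.idl J"
  have "\<exists>J\<in>cont ` F. \<forall>K\<in>cont ` F. J \<subseteq> K \<longrightarrow> K = J"
    by (rule noetherian_max_cond[OF noeth]) (use F idl_cont in auto)
  then obtain J where J: "J \<in> F" "\<forall>K\<in>F. cont J \<subseteq> cont K \<longrightarrow> cont K = cont J" by auto
  have "K = J" if "K \<in> F" "J \<subseteq> K" for K
    using J(2) that cont_mono_iff[OF F(2)[OF J(1)] F(2)[OF that(1)]]
      cont_mono_iff[OF F(2)[OF that(1)] F(2)[OF J(1)]] by blast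
  then show "\<exists>J\<in>F. \<forall>K\<in>F. J \<subseteq> K \<longrightarrow> K = J" using J(1) by blast
next
  show "S.idl (ext M)" "1 \<notin> ext M"
    using prm_ext[OF prm_M] S.prmD by blast+
next
  fix x assume "x \<in> SM" "x \<notin> ext M"
  then obtain a s where a: "a \<in> A" "s \<in> A - M" "x = Fract a s" "a \<notin> M"
    using Fract_in_ext[OF prm_M] by (auto simp: SM_def)
  then have "a \<noteq> 0" "s \<noteq> 0" using idlD(2)[OF idl_M] by auto
  then have "x * Fract s a = 1" using a by (simp add: eq_fract One_fract_def)
  then show "\<exists>y\<in>SM. x * y = 1" using a Fract_in_SM[of s a] by blast
qed

subsection \<open>Comparison with the localization as a set of equivalence classes\<close>

lemma set_ring_simps [simp]:
  "carrier (set_ring B) = B" "x \<otimes>\<^bsub>set_ring B\<^esub> y = x * y" "x \<oplus>\<^bsub>set_ring B\<^esub> y = x + y"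
  "\<one>\<^bsub>set_ring B\<^esub> = 1" "\<zero>\<^bsub>set_ring B\<^esub> = 0"
  by (simp_all add: set_ring_def)

lemma frac_val_loc_frac:
  assumes "a \<in> A" "s \<in> A - M"
  shows "frac_val (loc_frac (set_ring A) M a s) = Fract a s"
proof -
  let ?X = "loc_frac (set_ring A) M a s"
  have "(a, s) \<in> ?X"
    using assms compl_one by (auto simp: loc_frac_def P.loc_rel_iff)
  then have "(SOME p. p \<in> ?X) \<in> ?X" by (rule someI)
  moreover obtain b t where bt: "(SOME p. p \<in> ?X) = (b, t)" by (cases "SOME p. p \<in> ?X") auto
  ultimately have "((a, s), (b, t)) \<in> loc_rel (set_ring A) M" by (simp add: loc_frac_def)
  then obtain u where u: "u \<in> A - M" "u * (a * t) = u * (b * s)" "b \<in> A" "t \<in> A - M"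
    by (auto simp: P.loc_rel_iff)
  have "u \<noteq> 0" "s \<noteq> 0" "t \<noteq> 0" using u assms compl(2) by blast+
  then have "Fract b t = Fract a s" using u(2) by (simp add: eq_fract)
  then show ?thesis using bt by (simp add: frac_val_def)
qed

lemma L_E:
  assumes "x \<in> carrier L"
  obtains a s where "a \<in> A" "s \<in> A - M" "x = loc_frac (set_ring A) M a s" "frac_val x = Fract a s"
  using assms P.loc_carrierE[of x] frac_val_loc_frac by auto

sublocale L: cring L by (rule P.localization_cring)

lemma frac_val_mult: "x \<in> carrier L \<Longrightarrow> y \<in> carrier L \<Longrightarrow> frac_val (x \<otimes>\<^bsub>L\<^esub> y) = frac_val x * frac_val y"
  by (elim L_E) (use P.loc_mult frac_val_loc_frac[OF mult_in compl_mult] in auto)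

lemma frac_val_add: "x \<in> carrier L \<Longrightarrow> y \<in> carrier L \<Longrightarrow> frac_val (x \<oplus>\<^bsub>L\<^esub> y) = frac_val x + frac_val y"
  by (elim L_E) (use P.loc_add frac_val_loc_frac[OF add_in[OF mult_in mult_in] compl_mult] compl in auto)

lemma frac_val_one: "frac_val \<one>\<^bsub>L\<^esub> = 1" and frac_val_zero: "frac_val \<zero>\<^bsub>L\<^esub> = 0"
  using P.loc_one P.loc_zero frac_val_loc_frac[OF _ compl_one]
    by (auto simp: One_fract_def Zero_fract_def)

lemma frac_val_in: "x \<in> carrier L \<Longrightarrow> frac_val x \<in> SM"
  by (elim L_E) (auto simp: SM_def)

lemma frac_val_surj: assumes "y \<in> SM" obtains x where "x \<in> carrier L" "frac_val x = y"
proof -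
  obtain a s where a: "a \<in> A" "s \<in> A - M" "y = Fract a s" using assms by (auto simp: SM_def)
  then have "loc_frac (set_ring A) M a s \<in> carrier L" using P.loc_frac_closed[of a s] by simp
  then show ?thesis using that a frac_val_loc_frac by blast
qed

lemma frac_val_inj:
  assumes "x \<in> carrier L" "y \<in> carrier L" "frac_val x = frac_val y"
  shows "x = y"
proof -
  obtain a s where a: "a \<in> A" "s \<in> A - M" "x = loc_frac (set_ring A) M a s" "frac_val x = Fract a s"
    using assms by (elim L_E) auto
  obtain b t where b: "b \<in> A" "t \<in> A - M" "y = loc_frac (set_ring A) M b t" "frac_val y = Fract b t"
    using assms by (elim L_E) auto
  have "s \<noteq> 0" "t \<noteq> 0" using a b compl(2) by blast+
  then have "a * t = b * s" using assms(3) a b by (simp add: eq_fract)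
  then show ?thesis unfolding a(3) b(3) using a b by (intro P.loc_frac_eqI') auto
qed

lemma ideal_vimage:
  assumes K: "S.idl K"
  shows "ideal {x \<in> carrier L. frac_val x \<in> K} L"
  by (rule L.ideal_criterion)
    (use S.idlD[OF K] in \<open>auto simp: frac_val_zero frac_val_add frac_val_mult frac_val_in\<close>)

lemma primeideal_vimage:
  assumes Q: "S.prm Q"
  shows "primeideal {x \<in> carrier L. frac_val x \<in> Q} L" (is "primeideal ?Q L")
proof (rule primeidealI)
  show "ideal ?Q L" using ideal_vimage S.prmD(1)[OF Q] .
  show "cring L" by (rule L.cring_axioms)
  have "\<one>\<^bsub>L\<^esub> \<notin> ?Q" using S.prmD(2)[OF Q] by (simp add: frac_val_one)
  then show "carrier L \<noteq> ?Q" by auto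
  show "a \<in> ?Q \<or> b \<in> ?Q" if "a \<in> carrier L" "b \<in> carrier L" "a \<otimes>\<^bsub>L\<^esub> b \<in> ?Q" for a b
    using that S.prmD(3)[OF Q, of "frac_val a" "frac_val b"] frac_val_in
      by (auto simp: frac_val_mult)
qed

lemma krull_dim_localization_ge:
  assumes q: "\<And>i. i \<le> r \<Longrightarrow> prm (q i) \<and> q i \<subseteq> M" "\<And>i. i < r \<Longrightarrow> q i \<subset> q (Suc i)"
  shows "enat r \<le> krull_dim L"
proof -
  define p where "p i = {x \<in> carrier L. frac_val x \<in> ext (q i)}" for i
  have "primeideal (p i) L" if "i \<le> r" for i
    unfolding p_def using that q by (intro primeideal_vimage prm_ext) auto
  moreover have "p i \<subset> p (Suc i)" if i: "i < r" for i
  proof -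
    have s: "ext (q i) \<subset> ext (q (Suc i))" using i q(1)[of i] q(1)[of "Suc i"] q(2)
      by (intro ext_strict_mono) auto
    then obtain y where y: "y \<in> ext (q (Suc i))" "y \<notin> ext (q i)" by blast
    have "y \<in> SM" using y(1) S.idlD(1) S.prmD(1) prm_ext q(1)[of "Suc i"] i by (meson Suc_leI)
    then obtain x where "x \<in> carrier L" "frac_val x = y" by (rule frac_val_surj)
    then show ?thesis using y s unfolding p_def by blast
  qed
  ultimately show ?thesis unfolding krull_dim_def by (intro Sup_upper) blast
qed

text \<open>\<open>frac_val\<close> is an isomorphism onto \<open>SM\<close>. By induction on
  \<open>i\<close> it matches the ideal generated by the first \<open>i\<close> terms with the
  iterated \<open>adj\<close> (the fact \<open>JK\<close>); then regularity transfers term by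
  term.\<close>

lemma regular_sequence_localization:
  assumes xs: "regular_sequence L xs" "set xs \<subseteq> P.loc_max_ideal"
    and noeth: "noetherian_ring (set_ring A)"
  shows "noetherian_local.rs SM (ext M) {0} (map frac_val xs)"
proof -
  interpret N: noetherian_local SM "ext M" by (rule noetherian_local_SM[OF noeth])
  have xL: "set xs \<subseteq> carrier L" using xs(1) by (simp add: regular_sequence_def)
  have sub: "set (take i xs) \<subseteq> carrier L" for i using xL set_take_subset[of i xs] by blast
  define J where "J i = Idl\<^bsub>L\<^esub> (set (take i xs))" for i
  have J: "ideal (J i) L" for i unfolding J_def by (rule L.genideal_ideal[OF sub])
  define K where "K i = foldl S.adj {0} (map frac_val (take i xs))" for i
  have K: "S.idl (K i)" for i
  proof -
    have "set (map frac_val (take i xs)) \<subseteq> SM" using sub[of i] frac_val_in by auto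
    then show ?thesis unfolding K_def by (rule N.foldl_adj_idl[OF S.idl_zero])
  qed
  have KSuc: "K (Suc i) = S.adj (K i) (frac_val (xs ! i))" if "i < length xs" for i
    using that by (simp add: K_def take_Suc_conv_app_nth)
  have JK: "frac_val x \<in> K i \<longleftrightarrow> x \<in> J i" if "i \<le> length xs" "x \<in> carrier L" for i x
    using that
  proof (induction i arbitrary: x)
    case 0
    have "x \<in> J 0 \<longleftrightarrow> x = \<zero>\<^bsub>L\<^esub>"
    proof
      have "J 0 \<subseteq> {\<zero>\<^bsub>L\<^esub>}" unfolding J_def by (rule L.genideal_minimal[OF L.zeroideal]) simp
      then show "x \<in> J 0 \<Longrightarrow> x = \<zero>\<^bsub>L\<^esub>" by blast
      show "x = \<zero>\<^bsub>L\<^esub> \<Longrightarrow> x \<in> J 0" using additive_subgroup.zero_closed[OF ideal.axioms(1)[OF J]]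
        by simp
    qed
    then show ?case using frac_val_inj[OF 0(2) L.zero_closed] by (auto simp: K_def frac_val_zero)
  next
    case (Suc i)
    have i: "i < length xs" using Suc.prems by simp
    have xi: "xs ! i \<in> carrier L" using xL i by auto
    have Jsub: "J i \<subseteq> J (Suc i)"
      unfolding J_def
      by (rule L.genideal_minimal[OF L.genideal_ideal[OF sub]])
        (use L.genideal_self[OF sub[of "Suc i"]] set_take_subset_set_take[of i "Suc i" xs] in auto)
    have xiJ: "xs ! i \<in> J (Suc i)"
      using L.genideal_self[OF sub[of "Suc i"]] i unfolding J_def
        by (auto simp: take_Suc_conv_app_nth)
    show ?case
    proof
      assume "frac_val x \<in> K (Suc i)"
      then obtain j s where js: "j \<in> K i" "s \<in> SM" "frac_val x = j + frac_val (xs ! i) * s"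
        using KSuc[OF i] by (auto simp: S.adj_def)
      obtain j' where j': "j' \<in> carrier L" "frac_val j' = j"
        using frac_val_surj S.idlD(1)[OF K js(1)] .
      obtain s' where s': "s' \<in> carrier L" "frac_val s' = s" using frac_val_surj js(2) .
      have "x = j' \<oplus>\<^bsub>L\<^esub> xs ! i \<otimes>\<^bsub>L\<^esub> s'"
        using js j' s' xi Suc.prems by (intro frac_val_inj) (auto simp: frac_val_add frac_val_mult)
      moreover have "j' \<in> J (Suc i)" using Suc.IH[of j'] j' js(1) i Jsub by auto
      moreover have "xs ! i \<otimes>\<^bsub>L\<^esub> s' \<in> J (Suc i)" using ideal.I_r_closed[OF J xiJ s'(1)] .
      ultimately show "x \<in> J (Suc i)" using additive_subgroup.a_closed[OF ideal.axioms(1)[OF J]]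
        by simp
    next
      assume x: "x \<in> J (Suc i)"
      have "set (take (Suc i) xs) \<subseteq> {x \<in> carrier L. frac_val x \<in> K (Suc i)}"
      proof
        fix y assume y: "y \<in> set (take (Suc i) xs)"
        then have yL: "y \<in> carrier L" using sub by blast
        from y consider "y = xs ! i" | "y \<in> set (take i xs)" using i
          by (auto simp: take_Suc_conv_app_nth)
        then have "frac_val y \<in> K (Suc i)"
        proof cases
          case 1
          then show ?thesis using S.adj_self[OF K] KSuc[OF i] by simp
        next
          case 2
          then have "y \<in> J i" using L.genideal_self[OF sub] unfolding J_def by blast
          then show ?thesis using Suc.IH[of y] yL i S.adj_sub KSuc[OF i] by auto
        qed
        then show "y \<in> {x \<in> carrier L. frac_val x \<in> K (Suc i)}" using yL by simp
      qed
      then have "J (Suc i) \<subseteq> {x \<in> carrier L. frac_val x \<in> K (Suc i)}"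
        unfolding J_def by (rule L.genideal_minimal[OF ideal_vimage[OF K]])
      then show "frac_val x \<in> K (Suc i)" using x by blast
    qed
  qed
  have regK: "S.reg (K i) (frac_val (xs ! i))" if i: "i < length xs" for i
    unfolding S.reg_def
  proof (intro ballI impI)
    fix z assume z: "z \<in> SM" "frac_val (xs ! i) * z \<in> K i"
    obtain y where y: "y \<in> carrier L" "frac_val y = z" using frac_val_surj z(1) .
    have xi: "xs ! i \<in> carrier L" using xL i by auto
    have "nonzerodivisor (L Quot J i) (J i +>\<^bsub>L\<^esub> xs ! i)"
      using xs(1) i by (auto simp: regular_sequence_def J_def Let_def)
    moreover have "xs ! i \<otimes>\<^bsub>L\<^esub> y \<in> J i" using JK[of i "xs ! i \<otimes>\<^bsub>L\<^esub> y"] z y xi i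
      by (simp add: frac_val_mult)
    ultimately have "y \<in> J i" using L.nonzerodivisor_quotD[OF J xi _ y(1)] by blast
    then show "z \<in> K i" using JK[of i y] y i by simp
  qed
  have xm: "frac_val x \<in> ext M" if "x \<in> set xs" for x
  proof -
    obtain a s where "a \<in> M" "s \<in> A - M" "x = loc_frac (set_ring A) M a s"
      using xs(2) \<open>x \<in> set xs\<close> by (auto simp: P.loc_max_ideal_def)
    then show ?thesis using frac_val_loc_frac[of a s] idlD(1)[OF idl_M] by (auto simp: ext_def)
  qed
  have "N.rs {0} (map frac_val (take i xs))" if "i \<le> length xs" for i
    using that
  proof (induction i)
    case (Suc i)
    then show ?case using regK[of i] xm[of "xs ! i"]
      by (simp add: take_Suc_conv_app_nth N.rs_append K_def)
  qed simp
  from this[of "length xs"] show ?thesis by simp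
qed

text \<open>The chain bounds the dimension, hence the depth, from below. Some regular sequence is at
  least as long as wanted, and it is truncated.\<close>

lemma cohen_macaulay_regular_sequence:
  assumes cm: "cohen_macaulay (set_ring A)" and max: "maximalideal M (set_ring A)"
    and q: "\<And>i. i \<le> Suc r \<Longrightarrow> prm (q i) \<and> q i \<subseteq> M" "\<And>i. i < Suc r \<Longrightarrow> q i \<subset> q (Suc i)"
  shows "\<exists>ys. length ys = Suc r \<and> noetherian_local.rs SM (ext M) {0} ys"
proof -
  have noeth: "noetherian_ring (set_ring A)" using cm by (simp add: cohen_macaulay_def)
  interpret N: noetherian_local SM "ext M" by (rule noetherian_local_SM[OF noeth])
  have "enat (Suc r) \<le> krull_dim L" using q
    by (intro krull_dim_localization_ge[where q = q]) simp_all
  also have "\<dots> = depth L" using cm max by (simp add: cohen_macaulay_def)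
  finally have "\<exists>x\<in>{enat (length xs) | xs. regular_sequence L xs
    \<and> set xs \<subseteq> (THE M. maximalideal M L)}. enat (Suc r) \<le> x"
    unfolding depth_def by (rule enat_le_SupD)
  moreover have "(THE M. maximalideal M L) = P.loc_max_ideal"
    using P.maximalideal_localization_iff by simp
  ultimately obtain xs where xs: "regular_sequence L xs" "set xs \<subseteq> P.loc_max_ideal"
    "Suc r \<le> length xs"
    by auto
  have "N.rs {0} (take (Suc r) (map frac_val xs))"
    using N.rs_take regular_sequence_localization[OF xs(1,2) noeth] by blast
  then show ?thesis using xs(3) by (intro exI[of _ "take (Suc r) (map frac_val xs)"]) auto
qed

end


section \<open>Substitutions of variables\<close>

abbreviation monom_at :: "'a \<Rightarrow> 'b \<Rightarrow> ('a \<Rightarrow>\<^sub>0 'b::zero)" where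
  "monom_at \<equiv> Poly_Mapping.single"

abbreviation supp :: "('a \<Rightarrow>\<^sub>0 'b::zero) \<Rightarrow> 'a set" where
  "supp \<equiv> Poly_Mapping.keys"

abbreviation coeff_of :: "('a \<Rightarrow>\<^sub>0 'b::zero) \<Rightarrow> 'a \<Rightarrow> 'b" where
  "coeff_of \<equiv> Poly_Mapping.lookup"

definition mvar :: "nat \<Rightarrow> 'k::field mpoly" where
  "mvar i = monom_at (monom_at i 1) 1"

definition mconst :: "'k \<Rightarrow> 'k::field mpoly" where
  "mconst c = monom_at 0 c"

definition polys :: "nat \<Rightarrow> 'k::field mpoly set" where
  "polys n = {f. \<forall>m \<in> supp f. supp m \<subseteq> {1..n}}"

definition push :: "(nat \<Rightarrow> nat) \<Rightarrow> (nat \<Rightarrow>\<^sub>0 nat) \<Rightarrow> (nat \<Rightarrow>\<^sub>0 nat)" where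
  "push h m = (\<Sum>i\<in>supp m. monom_at (h i) (coeff_of m i))"

text \<open>A linear form in the exponents, used to tell monomials apart.\<close>

definition weight :: "(nat \<Rightarrow> nat) \<Rightarrow> (nat \<Rightarrow>\<^sub>0 nat) \<Rightarrow> nat" where
  "weight h m = (\<Sum>i\<in>supp m. h i * coeff_of m i)"

text \<open>Variables go to variables, and \<open>h\<close> may identify some of them. For a
  permutation this is the action \<open>perm_poly\<close>; for the map to orbit representatives it
  is reduction modulo \<open>P\<close>.\<close>

definition subst :: "(nat \<Rightarrow> nat) \<Rightarrow> 'k::field mpoly \<Rightarrow> 'k mpoly" where
  "subst h f = (\<Sum>m\<in>supp f. monom_at (push h m) (coeff_of f m))"

lemma push_add: "push h (m + m') = push h m + push h m'"
  unfolding push_def by (rule setsum_keys_plus_distrib) (simp_all add: single_add)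

lemma push_zero [simp]: "push h 0 = 0"
  by (simp add: push_def)

lemma push_single [simp]: "push h (monom_at i k) = monom_at (h i) k"
  by (simp add: push_def)

lemma weight_add: "weight h (m + m') = weight h m + weight h m'"
  unfolding weight_def by (rule setsum_keys_plus_distrib) (simp_all add: algebra_simps)

lemma weight_zero [simp]: "weight h 0 = 0"
  by (simp add: weight_def)

lemma weight_single [simp]: "weight h (monom_at i k) = h i * k"
  by (simp add: weight_def)

lemma push_push: "push h (push h' m) = push (h \<circ> h') m"
  by (induction m rule: mpoly_induct) (simp_all add: push_add)

lemma weight_push: "weight h (push h' m) = weight (h \<circ> h') m"
  by (induction m rule: mpoly_induct) (simp_all add: push_add weight_add)

lemma keys_add_nat:
  fixes m m' :: "nat \<Rightarrow>\<^sub>0 nat"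
  shows "supp (m + m') = supp m \<union> supp m'"
  by (auto simp: in_keys_iff lookup_add)

lemma push_cong:
  "supp m \<subseteq> S \<Longrightarrow> (\<And>i. i \<in> S \<Longrightarrow> h i = h' i) \<Longrightarrow> push h m = push h' m"
  unfolding push_def by (intro sum.cong) auto

lemma keys_push: "supp (push h m) = h ` supp m"
  by (induction m rule: mpoly_induct) (auto simp: push_add keys_add_nat)

lemma push_eq_zero_iff [simp]: "push h m = 0 \<longleftrightarrow> m = 0"
  using keys_push[of h m] by (metis image_is_empty keys_eq_empty)

lemma push_id: "push id m = m"
  by (induction m rule: mpoly_induct) (simp_all add: push_add)

lemma push_perm:
  assumes "bij \<sigma>" shows "push \<sigma> m = Poly_Mapping.map_key (inv' \<sigma>) m"
proof -
  have inj: "inj (inv' \<sigma>)" using assms by (simp add: bij_imp_bij_inv bij_is_inj)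
  show ?thesis
  proof (induction m rule: mpoly_induct)
    case (single i c)
    then show ?case using map_key_single[OF inj, of "\<sigma> i" c] assms by (simp add: bij_is_inj)
  qed (simp add: push_add map_key_plus[OF inj])
qed

lemma subst_add: "subst h (f + g) = subst h f + subst h g"
  unfolding subst_def by (rule setsum_keys_plus_distrib) (simp_all add: single_add)

lemma subst_zero [simp]: "subst h 0 = 0"
  by (simp add: subst_def)

lemma subst_single: "subst h (monom_at m c) = monom_at (push h m) c"
  by (simp add: subst_def)

lemma subst_uminus: "subst h (- f) = - subst h f"
  using subst_add[of h "- f" f] by (simp add: eq_neg_iff_add_eq_0)

lemma subst_diff: "subst h (f - g) = subst h f - subst h g"
  using subst_add[of h f "- g"] by (simp add: subst_uminus)

lemma subst_mult: "subst h (f * g) = subst h f * subst h g"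
proof (induction f rule: mpoly_induct)
  case (single m c)
  show ?case
    by (induction g rule: mpoly_induct)
      (simp_all add: mult_single subst_single push_add subst_add distrib_left)
qed (simp add: subst_add distrib_right)

lemma subst_mconst [simp]: "subst h (mconst c) = mconst c"
  by (simp add: mconst_def subst_single)

lemma mconst_one [simp]: "mconst 1 = 1" and mconst_zero [simp]: "mconst 0 = 0"
  by (simp_all add: mconst_def)

lemma subst_one [simp]: "subst h 1 = 1"
  using subst_mconst[of h 1] by simp

lemma subst_mvar [simp]: "subst h (mvar i) = mvar (h i)"
  by (simp add: mvar_def subst_single)

lemma subst_sum: "subst h (sum f X) = (\<Sum>x\<in>X. subst h (f x))"
  by (induction X rule: infinite_finite_induct) (simp_all add: subst_add)

lemma subst_prod: "subst h (prod f X) = (\<Prod>x\<in>X. subst h (f x))"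
  by (induction X rule: infinite_finite_induct) (simp_all add: subst_mult)

lemma subst_power: "subst h (f ^ k) = subst h f ^ k"
  by (induction k) (simp_all add: subst_mult)

lemma subst_subst: "subst h (subst h' f) = subst (h \<circ> h') f"
  by (induction f rule: mpoly_induct) (simp_all add: subst_single push_push subst_add comp_def)

lemma subst_id [simp]: "subst id f = f"
  by (induction f rule: mpoly_induct) (simp_all add: subst_single push_id[unfolded id_def] push_id subst_add)

lemma subst_ident [simp]: "subst (\<lambda>i. i) f = f"
  using subst_id[of f] by (simp only: id_def)

lemma perm_poly_eq_subst: "bij \<sigma> \<Longrightarrow> perm_poly \<sigma> f = subst \<sigma> f"
  by (induction f rule: mpoly_induct)
    (simp_all add: perm_poly_single subst_single push_perm perm_poly_add subst_add)

lemma subst_cong: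
  assumes "f \<in> polys n" "\<And>i. i \<in> {1..n} \<Longrightarrow> h i = h' i"
  shows "subst h f = subst h' f"
  unfolding subst_def
proof (rule sum.cong[OF refl])
  fix m assume "m \<in> supp f"
  then have "supp m \<subseteq> {1..n}" using assms(1) by (auto simp: polys_def)
  then have "push h m = push h' m" by (rule push_cong) (rule assms(2))
  then show "monom_at (push h m) (coeff_of f m) = monom_at (push h' m) (coeff_of f m)"
    by simp
qed

lemma mpoly_sum_monomials: "f = (\<Sum>m\<in>supp f. mconst (coeff_of f m) * monom_at m 1)"
proof -
  have "subst id f = (\<Sum>m\<in>supp f. mconst (coeff_of f m) * monom_at m 1)"
    unfolding subst_def by (intro sum.cong) (simp_all add: push_id mconst_def mult_single)
  then show ?thesis by simp
qed

lemma coeff_subst_zero: "coeff_of (subst h f) 0 = coeff_of f 0"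
  by (induction f rule: mpoly_induct)
    (simp_all add: subst_single subst_add lookup_add lookup_single when_def)

lemma coeff_mult_zero:
  fixes f g :: "'k::field mpoly"
  shows "coeff_of (f * g) 0 = coeff_of f 0 * coeff_of g 0"
proof (induction f rule: mpoly_induct)
  case (single m c)
  have zero: "m + m' = 0 \<longleftrightarrow> m = 0 \<and> m' = 0" for m m' :: "nat \<Rightarrow>\<^sub>0 nat"
    by (auto simp: poly_mapping_eq_iff fun_eq_iff lookup_add)
  show ?case
    by (induction g rule: mpoly_induct)
      (auto simp: mult_single lookup_single when_def zero distrib_left lookup_add)
qed (simp add: lookup_add distrib_right)

lemma coeff_mconst_zero [simp]: "coeff_of (mconst c) 0 = c"
  by (simp add: mconst_def)

lemma mconst_eq_zero_iff [simp]: "mconst c = 0 \<longleftrightarrow> c = 0"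
  using coeff_mconst_zero[of c] by (metis lookup_zero mconst_zero)

lemma mconst_mult: "mconst (a * b) = mconst a * mconst b"
  by (simp add: mconst_def mult_single)

lemma mconst_add: "mconst (a + b) = mconst a + mconst b"
  by (simp add: mconst_def single_add)

lemma mvar_power: "mvar i ^ k = monom_at (monom_at i k) 1"
  by (induction k) (simp_all add: mvar_def mult_single single_add[symmetric])

lemma mvar_inj: "mvar i = (mvar j :: 'k::field mpoly) \<longleftrightarrow> i = j"
proof
  assume "mvar i = (mvar j :: 'k mpoly)"
  then have "supp (mvar i :: 'k mpoly) = supp (mvar j :: 'k mpoly)" by simp
  then have "monom_at i (1::nat) = monom_at j 1" by (simp add: mvar_def)
  then show "i = j" by (metis keys_single one_neq_zero singleton_inject)
qed simp

lemma keys_neg_mpoly: "supp (- f) = supp (f :: 'k::field mpoly)"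
  by (auto simp: in_keys_iff)

interpretation polys: unital_subring "polys n :: 'k::field mpoly set" for n
proof
  show "0 \<in> (polys n :: 'k mpoly set)" "1 \<in> (polys n :: 'k mpoly set)" by (auto simp: polys_def)
  fix f g :: "'k mpoly" assume f: "f \<in> polys n" and g: "g \<in> polys n"
  show "f + g \<in> polys n" using f g Poly_Mapping.keys_add[of f g] by (auto simp: polys_def)
  show "f * g \<in> polys n" unfolding polys_def
  proof (rule CollectI, rule ballI)
    fix m assume "m \<in> supp (f * g)"
    then obtain a b where "a \<in> supp f" "b \<in> supp g" "m = a + b"
      using keys_mult[of f g] by blast
    moreover from this have "supp a \<subseteq> {1..n}" "supp b \<subseteq> {1..n}"
      using f g by (simp_all add: polys_def)
    ultimately show "supp m \<subseteq> {1..n}" by (simp add: keys_add_nat)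
  qed
qed (simp add: polys_def keys_neg_mpoly)

lemma mvar_in_polys [simp]: "mvar i \<in> polys n \<longleftrightarrow> i \<in> {1..n}"
  by (auto simp: polys_def mvar_def)

lemma mconst_in_polys [simp]: "mconst c \<in> polys n"
  by (auto simp: polys_def mconst_def)

lemma subst_in_polys:
  assumes "f \<in> polys n" "\<And>i. i \<in> {1..n} \<Longrightarrow> h i \<in> {1..n}"
  shows "subst h f \<in> polys n"
  unfolding subst_def
proof (rule polys.sum_in)
  fix m assume "m \<in> supp f"
  then have "supp m \<subseteq> {1..n}" using assms(1) by (auto simp: polys_def)
  then show "monom_at (push h m) (coeff_of f m) \<in> polys n"
    using assms(2) by (auto simp: polys_def keys_push)
qed

text \<open>Modulo \<open>Q\<close> each variable equals its image, so the substitution is trivial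
  there; the differences are telescoped through powers, products of monomials and linear
  combinations.\<close>

lemma diff_subst_in_ideal:
  assumes Q: "polys.idl n Q" and h: "\<And>i. i \<in> {1..n} \<Longrightarrow> h i \<in> {1..n}"
    and gen: "\<And>i. i \<in> {1..n} \<Longrightarrow> mvar i - mvar (h i) \<in> Q" and f: "f \<in> polys n"
  shows "f - subst h f \<in> (Q :: 'k::field mpoly set)"
proof -
  have mono: "supp m \<subseteq> {1..n} \<longrightarrow> 
    monom_at m (1::'k) - monom_at (push h m) 1 \<in> Q" for m
  proof (induction m rule: mpoly_induct)
    case (single i k)
    show ?case
    proof (cases "k = 0")
      case True
      then show ?thesis using polys.idlD(2)[OF Q] by simp
    next
      case False
      have "mvar i ^ k - mvar (h i) ^ k \<in> Q" if i: "i \<in> {1..n}"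
      proof (induction k)
        case (Suc k)
        have "mvar i ^ Suc k - mvar (h i) ^ Suc k =
          mvar i * (mvar i ^ k - mvar (h i) ^ k) + (mvar i - mvar (h i)) * mvar (h i) ^ k"
          by (simp add: algebra_simps)
        also have "\<dots> \<in> Q" using Suc gen[OF i] i h[OF i]
          by (intro polys.idlD(3)[OF Q] polys.idlD(4)[OF Q _ Suc] polys.idlD(5)[OF Q _ gen[OF i]] polys.power_in) auto
        finally show ?case .
      qed (simp add: polys.idlD(2)[OF Q])
      then show ?thesis using False by (simp add: mvar_power)
    qed
  next
    case (sum m m')
    show ?case
    proof
      assume "supp (m + m') \<subseteq> {1..n}"
      then have k: "supp m \<subseteq> {1..n}" "supp m' \<subseteq> {1..n}" by (auto simp: keys_add_nat)
      have "monom_at (m + m') (1::'k) - monom_at (push h (m + m')) 1 =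
        monom_at m 1 * (monom_at m' 1 - monom_at (push h m') 1) +
        (monom_at m 1 - monom_at (push h m) 1) * monom_at (push h m') 1"
        by (simp add: algebra_simps mult_single push_add)
      also have "\<dots> \<in> Q"
        using sum k h by (intro polys.idlD(3)[OF Q] polys.idlD(4)[OF Q, of _ "_ - _"] polys.idlD(5)[OF Q, of _ "_ - _"])
          (auto simp: polys_def keys_push)
      finally show "monom_at (m + m') (1::'k) - monom_at (push h (m + m')) 1 \<in> Q" .
    qed
  qed
  have "f - subst h f = (\<Sum>m\<in>supp f. mconst (coeff_of f m) *
      (monom_at m 1 - monom_at (push h m) 1))"
    by (subst (1) mpoly_sum_monomials[of f])
      (simp add: subst_def sum_subtractf[symmetric] mconst_def mult_single right_diff_distrib)
  also have "\<dots> \<in> Q"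
    using f mono by (intro polys.idl_sum[OF Q] polys.idlD(4)[OF Q] mconst_in_polys) (simp add: polys_def)
  finally show ?thesis .
qed

text \<open>\<open>id(j := i)\<close> replaces \<open>x_j\<close> by \<open>x_i\<close>, which
  changes nothing modulo the principal ideal of \<open>x_i - x_j\<close>; so \<open>f\<close> is
  congruent to 0.\<close>

lemma linear_form_dvd:
  assumes ij: "i \<in> {1..n}" "j \<in> {1..n}" and f: "f \<in> polys n" "subst (id(j := i)) f = 0"
  shows "\<exists>c\<in>polys n. f = (mvar i - mvar j) * c"
proof -
  let ?l = "mvar i - mvar j :: 'k::field mpoly"
  have l: "?l \<in> polys n" using ij by (intro polys.diff_in) auto
  have Q: "polys.idl n (polys.adj n {0} ?l)" by (rule polys.idl_adj[OF polys.idl_zero l])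
  have "f - subst (id(j := i)) f \<in> polys.adj n {0} ?l"
  proof (rule diff_subst_in_ideal[OF Q _ _ f(1)])
    fix k assume "k \<in> {1..n}"
    show "mvar k - mvar ((id(j := i)) k) \<in> polys.adj n {0} ?l"
      using polys.idlD(2)[OF Q] polys.idlD(6)[OF Q polys.adj_self[OF polys.idl_zero, of ?l n]]
      by (cases "k = j") simp_all
  qed (use ij in auto)
  then show ?thesis using f(2) by (auto simp: polys.adj_def)
qed

text \<open>\<open>cancels n a d\<close> is the form in which coprimality of \<open>a\<close> and \<open>d\<close> is used; since each
  \<open>x\<^sub>i - x\<^sub>j\<close> is prime, no unique factorization is needed to establish it.\<close>

definition cancels :: "nat \<Rightarrow> 'k::field mpoly \<Rightarrow> 'k mpoly \<Rightarrow> bool" where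
  "cancels n a d \<longleftrightarrow> d \<noteq> 0 \<and> (\<forall>w\<in>polys n. \<forall>v. d * v = a * w \<longrightarrow> (\<exists>c\<in>polys n. w = d * c))"

lemma cancels_mult:
  assumes "cancels n a d" "cancels n a e" shows "cancels n a (d * e)"
  unfolding cancels_def
proof (intro conjI ballI allI impI)
  show "d * e \<noteq> 0" using assms by (simp add: cancels_def)
  fix w v assume w: "w \<in> polys n" "d * e * v = a * w"
  then have "d * (e * v) = a * w" by (simp add: mult.assoc)
  then obtain c where c: "c \<in> polys n" "w = d * c" using assms(1) w(1) unfolding cancels_def
    by blast
  have "d * (e * v) = d * (a * c)" using w c by (simp add: mult_ac)
  then have "e * v = a * c" using assms(1) by (simp add: cancels_def)
  then obtain c' where "c' \<in> polys n" "c = e * c'" using assms(2) c(1) unfolding cancels_def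
    by blast
  then show "\<exists>c\<in>polys n. w = d * e * c" using c by (auto simp: mult.assoc)
qed

lemma cancels_one: "cancels n a 1"
  by (auto simp: cancels_def)

lemma cancels_prod: "(\<And>x. x \<in> X \<Longrightarrow> cancels n a (f x)) \<Longrightarrow> cancels n a (prod f X)"
  by (induction X rule: infinite_finite_induct) (auto intro: cancels_mult cancels_one)

lemma cancels_power: "cancels n a d \<Longrightarrow> cancels n a (d ^ k)"
  by (induction k) (auto intro: cancels_mult cancels_one)

text \<open>Replacing \<open>x_j\<close> by \<open>x_i\<close> kills the left side of
  \<open>(x_i - x_j) v = a w\<close> but not \<open>a\<close>; in a domain it then kills
  \<open>w\<close>.\<close>

lemma cancels_linear_form:
  assumes ij: "i \<in> {1..n}" "j \<in> {1..n}" "i \<noteq> j" and a: "subst (id(j := i)) a \<noteq> 0"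
  shows "cancels n a (mvar i - mvar j :: 'k::field mpoly)"
  unfolding cancels_def
proof (intro conjI ballI allI impI)
  show "mvar i - mvar j \<noteq> (0 :: 'k mpoly)" using mvar_inj[of i j, where 'k = 'k] ij(3) by simp
  fix w v assume w: "w \<in> polys n" "(mvar i - mvar j) * v = a * w"
  have "subst (id(j := i)) (a * w) = 0" using ij by (simp flip: w(2) add: subst_mult subst_diff)
  then have "subst (id(j := i)) w = 0" using a by (simp add: subst_mult)
  then show "\<exists>c\<in>polys n. w = (mvar i - mvar j) * c" by (rule linear_form_dvd[OF ij(1,2) w(1)])
qed

section \<open>Chains of primes and algebraic independence\<close>

text \<open>Stated for families: a repeated value gives a relation at once, and an injective family
  reduces to the dimension bound for the span of \<open>B\<close>.\<close>

lemma linear_dependence: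
  fixes v :: "'e \<Rightarrow> 'k::field mpoly"
  assumes E: "finite E" and B: "finite (B :: 'k mpoly set)" "card B < card E"
    and span: "\<And>e m. e \<in> E \<Longrightarrow> m \<in> supp (v e) \<Longrightarrow> monom_at m 1 \<in> B"
  shows "\<exists>c. (\<exists>e\<in>E. c e \<noteq> 0) \<and> (\<Sum>e\<in>E. mconst (c e) * v e) = 0"
proof -
  interpret V: vector_space "\<lambda>c f :: 'k mpoly. mconst c * f"
    by unfold_locales (simp_all add: mconst_mult mconst_add algebra_simps)
  show ?thesis
  proof (cases "inj_on v E")
    case False
    then obtain x y where xy: "x \<in> E" "y \<in> E" "x \<noteq> y" "v x = v y" by (auto simp: inj_on_def)
    define c where "c e = (if e = x then 1 else if e = y then - 1 else 0 :: 'k)" for e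
    have "(\<Sum>e\<in>E. mconst (c e) * v e) = (\<Sum>e\<in>{x, y}. mconst (c e) * v e)"
      using E xy by (intro sum.mono_neutral_right) (auto simp: c_def)
    also have "\<dots> = 0" using xy V.scale_minus_left[of 1 "v y"] by (simp add: c_def)
    finally show ?thesis using xy by (intro exI[of _ c]) (auto simp: c_def)
  next
    case True
    have "v e \<in> V.span B" if e: "e \<in> E" for e
    proof -
      have "(\<Sum>m\<in>supp (v e). mconst (coeff_of (v e) m) * monom_at m 1) \<in> V.span B"
        using span[OF e] by (intro V.span_sum V.span_scale V.span_base)
      then show ?thesis using mpoly_sum_monomials[of "v e"] by simp
    qed
    then have "v ` E \<subseteq> V.span B" by blast
    moreover have "card (v ` E) = card E" using True by (rule card_image)
    ultimately have "V.dependent (v ` E)" using V.independent_span_bound[OF B(1), of "v ` E"] B(2)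
      by auto
    then obtain u where u: "\<exists>x\<in>v ` E. u x \<noteq> 0" "(\<Sum>x\<in>v ` E. mconst (u x) * x) = 0"
      using V.dependent_finite[of "v ` E"] E by auto
    then show ?thesis using sum.reindex[OF True, of "\<lambda>x. mconst (u x) * x"]
      by (intro exI[of _ "u \<circ> v"]) auto
  qed
qed

text \<open>Each exponent is bounded separately, not the total degree, so that the monomials in
  \<open>d\<close> variables are counted by a power of \<open>D + 1\<close>.\<close>

definition deg_le :: "nat \<Rightarrow> 'k::field mpoly \<Rightarrow> bool" where
  "deg_le D f \<longleftrightarrow> (\<forall>m\<in>supp f. \<forall>i. coeff_of m i \<le> D)"

lemma deg_le_mult: "deg_le D f \<Longrightarrow> deg_le D' g \<Longrightarrow> deg_le (D + D') (f * g)"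
  unfolding deg_le_def
proof (intro ballI allI)
  fix m i assume *: "\<forall>m\<in>supp f. \<forall>i. coeff_of m i \<le> D" "\<forall>m\<in>supp g. \<forall>i. coeff_of m i \<le> D'"
    "m \<in> supp (f * g)"
  then obtain a b where "a \<in> supp f" "b \<in> supp g" "m = a + b"
    using keys_mult[of f g] by blast
  then show "coeff_of m i \<le> D + D'" using *(1,2) by (auto simp: lookup_add intro: add_mono)
qed

lemma deg_le_one: "deg_le D 1"
  by (simp add: deg_le_def)

lemma deg_le_power: "deg_le D f \<Longrightarrow> deg_le (k * D) (f ^ k)"
  by (induction k) (auto intro: deg_le_mult deg_le_one)

lemma deg_le_mono: "deg_le D f \<Longrightarrow> D \<le> D' \<Longrightarrow> deg_le D' f"
  unfolding deg_le_def by (meson le_trans)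

lemma deg_le_exists: "\<exists>D. deg_le D f"
proof -
  have "finite (\<Union>m\<in>supp f. coeff_of m ` supp m)" by simp
  then obtain D where D: "\<forall>x\<in>(\<Union>m\<in>supp f. coeff_of m ` supp m). x \<le> D"
    using finite_nat_set_iff_bounded_le by blast
  have "coeff_of m i \<le> D" if "m \<in> supp f" for m i
    using D that by (cases "i \<in> supp m") (auto simp: in_keys_iff)
  then show ?thesis by (auto simp: deg_le_def)
qed

lemma card_bounded_monomials:
  assumes R: "finite R"
  shows "finite {monom_at (m :: nat \<Rightarrow>\<^sub>0 nat) (1::'k::field) | m. supp m \<subseteq> R
    \<and> (\<forall>i. coeff_of m i \<le> (D::nat))}"
    and "card {monom_at (m :: nat \<Rightarrow>\<^sub>0 nat) (1::'k::field) | m. supp m \<subseteq> R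
      \<and> (\<forall>i. coeff_of m i \<le> (D::nat))}
      \<le> (D + 1) ^ card R"
proof -
  let ?B = "{monom_at (m :: nat \<Rightarrow>\<^sub>0 nat) (1::'k) | m. supp m \<subseteq> R \<and> (\<forall>i. coeff_of m i \<le> D)}"
  let ?P = "R \<rightarrow>\<^sub>E {..D}"
  let ?f = "\<lambda>h. monom_at (\<Sum>i\<in>R. monom_at i (h i)) (1::'k)"
  have sub: "?B \<subseteq> ?f ` ?P"
  proof
    fix x assume "x \<in> ?B"
    then obtain m where m: "x = monom_at m 1" "supp m \<subseteq> R" "\<forall>i. coeff_of m i \<le> D" by blast
    have "(\<Sum>i\<in>R. monom_at i (restrict (coeff_of m) R i)) = (\<Sum>i\<in>R. monom_at (id i) (coeff_of m i))"
      by (intro sum.cong) auto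
    also have "\<dots> = push id m"
      unfolding push_def using m(2) R by (intro sum.mono_neutral_right) (auto simp: in_keys_iff)
    finally have "x = ?f (restrict (coeff_of m) R)" using m(1) by (simp add: push_id)
    moreover have "restrict (coeff_of m) R \<in> ?P" using m(3) by auto
    ultimately show "x \<in> ?f ` ?P" by blast
  qed
  have fin: "finite ?P" using R by (intro finite_PiE) auto
  show "finite ?B" using sub fin by (meson finite_imageI finite_subset)
  have "card ?B \<le> card ?P" using sub fin by (meson card_image_le card_mono finite_imageI le_trans)
  then show "card ?B \<le> (D + 1) ^ card R" using R by (simp add: card_PiE)
qed

text \<open>The running index \<open>j\<close> lets the recursion on the exponent list follow the
  chain of primes upwards.\<close>

fun list_monomial :: "(nat \<Rightarrow> 'a::comm_monoid_mult) \<Rightarrow> nat \<Rightarrow> nat list \<Rightarrow> 'a" where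
  "list_monomial t j [] = 1"
| "list_monomial t j (a # e) = t j ^ a * list_monomial t (Suc j) e"

definition exponents :: "nat \<Rightarrow> nat \<Rightarrow> nat list set" where
  "exponents N l = {e. set e \<subseteq> {..<N} \<and> length e = l}"

lemma exponents_Suc: "exponents N (Suc l) = (\<lambda>(a, e). a # e) ` ({..<N} \<times> exponents N l)"
  unfolding exponents_def by (auto simp: length_Suc_conv image_def)

lemma finite_exponents: "finite (exponents N l)" and card_exponents: "card (exponents N l) = N ^ l"
  unfolding exponents_def by (simp_all add: finite_lists_length_eq card_lists_length_eq)

lemma deg_le_list_monomial:
  assumes t: "\<And>i. deg_le D (t i)"
  shows "set e \<subseteq> {..<N} \<Longrightarrow> deg_le (length e * (N * D)) (list_monomial t j e)"
proof (induction e arbitrary: j)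
  case (Cons a e)
  have "deg_le (N * D) (t j ^ a)"
    using deg_le_mono[OF deg_le_power[OF t, of a]] Cons.prems by auto
  then show ?case using deg_le_mult Cons by fastforce
qed (simp add: deg_le_one)

context
  fixes A :: "'k::field mpoly set"
  assumes A: "unital_subring A" and const: "\<And>c. mconst c \<in> A"
begin

interpretation A: unital_subring A by (rule A)

lemma prm_const: "A.prm Q \<Longrightarrow> mconst c \<in> Q \<Longrightarrow> c = 0"
proof (rule ccontr)
  assume Q: "A.prm Q" "mconst c \<in> Q" "c \<noteq> 0"
  have "mconst (inverse c) * mconst c \<in> Q" using A.idlD(4)[OF A.prmD(1)[OF Q(1)] const Q(2)] .
  then show False using A.prmD(2)[OF Q(1)] Q(3) by (simp flip: mconst_mult)
qed

text \<open>Sort the relation by powers of \<open>t j\<close>. The lowest one that can occur is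
  cancelled because \<open>t j \<notin> q j\<close>; modulo \<open>q (Suc j)\<close>, which contains
  \<open>t j\<close>, only its coefficient \<open>G a\<close> remains, and this is a relation among
  the later \<open>t i\<close>. In the end a constant lies in a prime and must be 0.\<close>

lemma chain_algebraically_independent:
  assumes q: "\<And>i. i \<le> R \<Longrightarrow> A.prm (q i)" "\<And>i. i < R \<Longrightarrow> q i \<subseteq> q (Suc i)"
    and t: "\<And>i. i < R \<Longrightarrow> t i \<in> q (Suc i) - q i"
  shows "j + l = R \<Longrightarrow> (\<Sum>e\<in>exponents N l. mconst (c e) * list_monomial t j e) \<in> q j \<Longrightarrow>
    e \<in> exponents N l \<Longrightarrow> c e = 0"
proof (induction l arbitrary: j c e)
  case 0
  have "exponents N 0 = {[]}" by (auto simp: exponents_def)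
  then show ?case using 0 prm_const[OF q(1), of R] by simp
next
  case (Suc l)
  have j: "j < R" using Suc.prems by simp
  have prm: "A.prm (q j)" "A.prm (q (Suc j))" using q(1) j by auto
  note I = A.prmD(1)[OF prm(1)] and I' = A.prmD(1)[OF prm(2)]
  have tj: "t j \<in> q (Suc j)" "t j \<notin> q j" "t j \<in> A" using t[OF j] A.idlD(1)[OF I'] by auto
  have tA: "t i \<in> A" if "i < R" for i using t[OF that] A.idlD(1) A.prmD(1) q(1)[of "Suc i"] that
    by fastforce
  have mA: "list_monomial t i e \<in> A" if "i + length e \<le> R" for i e
    using that by (induction e arbitrary: i) (auto intro!: A.mult_in A.power_in tA)
  define G where "G a = (\<Sum>e\<in>exponents N l. mconst (c (a # e)) * list_monomial t (Suc j) e)" for a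
  have GA: "G a \<in> A" for a unfolding G_def
    using Suc.prems(1) by (intro A.sum_in A.mult_in const mA) (auto simp: exponents_def)
  have "(\<Sum>e\<in>exponents N (Suc l). mconst (c e) * list_monomial t j e) =
    (\<Sum>(a, e)\<in>{..<N} \<times> exponents N l. mconst (c (a # e)) * (t j ^ a * list_monomial t (Suc j) e))"
    unfolding exponents_Suc by (subst sum.reindex) (auto simp: inj_on_def case_prod_beta intro!: sum.cong)
  also have "\<dots> = (\<Sum>a<N. t j ^ a * G a)"
    unfolding G_def sum_distrib_left by (subst sum.cartesian_product[symmetric]) (simp add: mult_ac)
  finally have S: "(\<Sum>a<N. t j ^ a * G a) \<in> q j" using Suc.prems(2) by simp
  have zero: "\<forall>e\<in>exponents N l. c (a # e) = 0" if "a < N" for a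
    using that
  proof (induction a rule: less_induct)
    case (less a)
    have G0: "G b = 0" if "b < a" for b unfolding G_def using less.IH[OF that] that less.prems
      by simp
    define rest where "rest = (\<Sum>b\<in>{a<..<N}. t j ^ (b - Suc a) * G b)"
    have restA: "rest \<in> A" unfolding rest_def by (intro A.sum_in A.mult_in A.power_in tj GA)
    have "(\<Sum>b<N. t j ^ b * G b) = (\<Sum>b\<in>{a..<N}. t j ^ b * G b)"
      using G0 by (intro sum.mono_neutral_right) auto
    also have "{a..<N} = insert a {a<..<N}" using less.prems by auto
    also have "(\<Sum>b\<in>insert a {a<..<N}. t j ^ b * G b) = t j ^ a * G a + (\<Sum>b\<in>{a<..<N}. t j ^ b * G b)"
      by simp
    also have "(\<Sum>b\<in>{a<..<N}. t j ^ b * G b) = t j ^ a * (t j * rest)"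
      unfolding rest_def sum_distrib_left
    proof (rule sum.cong[OF refl])
      fix b assume "b \<in> {a<..<N}"
      then have "b = a + Suc (b - Suc a)" by simp
      then have "t j ^ b = t j ^ a * (t j * t j ^ (b - Suc a))" by (metis power_Suc power_add)
      then show "t j ^ b * G b = t j ^ a * (t j * (t j ^ (b - Suc a) * G b))"
        by (simp add: mult.assoc)
    qed
    finally have "t j ^ a * (G a + t j * rest) \<in> q j" using S by (simp add: distrib_left)
    then have "G a + t j * rest \<in> q j"
      using A.prmD(3)[OF prm(1), of "t j ^ a"
        "G a + t j * rest"] A.prm_power[OF prm(1) tj(3)] tj GA restA by blast
    then have "G a + t j * rest \<in> q (Suc j)" using q(2)[OF j] by blast
    moreover have "t j * rest \<in> q (Suc j)" using A.idlD(5)[OF I' restA tj(1)] .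
    ultimately have "G a \<in> q (Suc j)" using A.idlD(7)[OF I'] by fastforce
    then show ?case using Suc.IH[of "Suc j" "\<lambda>e. c (a # e)"] Suc.prems(1) unfolding G_def by simp
  qed
  then show ?case using Suc.prems(3) unfolding exponents_Suc by auto
qed

text \<open>Independence against counting: the \<open>t i\<close> have \<open>N ^ R\<close>
  monomials with exponents below \<open>N\<close>, while the images under \<open>h\<close> involve
  only as many variables as \<open>h\<close> has values and have exponents bounded linearly in
  \<open>N\<close>. If \<open>R\<close> were larger than that number, the images would satisfy a
  linear relation, which \<open>q0\<close> lifts to a relation modulo \<open>q 0\<close>.\<close>

theorem prime_chain_length_le:
  assumes sub: "A \<subseteq> polys n" and h: "\<And>i. i \<in> {1..n} \<Longrightarrow> h i \<in> {1..n}"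
    and q: "\<And>i. i \<le> R \<Longrightarrow> A.prm (q i)" "\<And>i. i < R \<Longrightarrow> q i \<subset> q (Suc i)"
    and q0: "\<And>a. a \<in> A \<Longrightarrow> subst h a = 0 \<Longrightarrow> a \<in> q 0"
  shows "R \<le> card (h ` {1..n})"
proof (rule ccontr)
  define d where "d = card (h ` {1..n})"
  assume "\<not> R \<le> card (h ` {1..n})"
  then have Rd: "Suc d \<le> R" by (simp add: d_def)
  have "\<forall>i. \<exists>x. i < R \<longrightarrow> x \<in> q (Suc i) - q i" using q(2) by blast
  then obtain t0 where t0: "\<And>i. i < R \<Longrightarrow> t0 i \<in> q (Suc i) - q i" by metis
  \<comment> \<open>The value 0 beyond \<open>R\<close> makes the degree and membership statements
    hold for every index.\<close>
  define t where "t i = (if i < R then t0 i else 0)" for i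
  have t: "t i \<in> q (Suc i) - q i" if "i < R" for i using t0[OF that] that by (simp add: t_def)
  have tA: "t i \<in> A" for i
    using t[of i] A.idlD(1)[OF A.prmD(1)[OF q(1)[of "Suc i"]]] by (cases "i < R") (auto simp: t_def)
  have mA: "list_monomial t i e \<in> A" for i e
    by (induction e arbitrary: i) (auto intro!: A.mult_in A.power_in tA)
  have hm: "subst h (list_monomial t i e) = list_monomial (\<lambda>i. subst h (t i)) i e" for i e
    by (induction e arbitrary: i) (auto simp: subst_mult subst_power)
  have "\<forall>i. \<exists>D. deg_le D (subst h (t i))" using deg_le_exists by blast
  then obtain D' where D': "\<And>i. deg_le (D' i) (subst h (t i))" by metis
  define D where "D = (\<Sum>i<R. D' i)"
  have D: "deg_le D (subst h (t i))" for i
  proof (cases "i < R")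
    case True
    then have "D' i \<le> D" unfolding D_def by (intro member_le_sum) auto
    then show ?thesis using deg_le_mono[OF D'] by blast
  qed (simp add: t_def deg_le_def)
  \<comment> \<open>\<open>C\<close> is chosen so that \<open>R * (N * D) + 1 \<le> N * C\<close>,
    and \<open>N\<close> exceeds \<open>C ^ d\<close>; hence
    \<open>(N * C) ^ d < N ^ Suc d \<le> N ^ R\<close>.\<close>
  define C where "C = D * R + 1"
  define N where "N = C ^ d + 1"
  define B where "B = {monom_at m (1::'k) | m. supp m \<subseteq> h ` {1..n}
    \<and> (\<forall>i. coeff_of m i \<le> R * (N * D))}"
  have "R * (N * D) + 1 \<le> N * C" by (simp add: C_def N_def algebra_simps)
  have "card B \<le> (R * (N * D) + 1) ^ d"
    unfolding B_def d_def by (rule card_bounded_monomials) simp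
  also have "\<dots> \<le> (N * C) ^ d" using \<open>R * (N * D) + 1 \<le> N * C\<close> by (rule power_mono) simp
  also have "\<dots> = N ^ d * C ^ d" by (rule power_mult_distrib)
  also have "\<dots> < N ^ d * N" by (rule mult_strict_left_mono) (simp_all add: N_def)
  also have "\<dots> = N ^ Suc d" by simp
  also have "\<dots> \<le> N ^ R" using Rd by (intro power_increasing) (simp_all add: N_def)
  finally have card: "card B < card (exponents N R)" by (simp add: card_exponents)
  have "\<exists>c. (\<exists>e\<in>exponents N R. c e \<noteq> 0) \<and>
    (\<Sum>e\<in>exponents N R. mconst (c e) * subst h (list_monomial t 0 e)) = 0"
  proof (rule linear_dependence[OF finite_exponents _ card])
    show "finite B" unfolding B_def by (rule card_bounded_monomials) simp
    fix e m assume e: "e \<in> exponents N R" and m: "m \<in> supp (subst h (list_monomial t 0 e))"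
    have "deg_le (R * (N * D)) (subst h (list_monomial t 0 e))"
      using deg_le_list_monomial[of D "\<lambda>i. subst h (t i)" e N 0] D e unfolding hm
        by (auto simp: exponents_def)
    moreover have "supp m \<subseteq> h ` {1..n}"
    proof -
      have "supp (subst h (list_monomial t 0 e)) \<subseteq>
        (\<Union>m\<in>supp (list_monomial t 0 e). {push h m})"
        unfolding subst_def by (rule order_trans[OF keys_sum]) auto
      then obtain m' where "m' \<in> supp (list_monomial t 0 e)" "m = push h m'" using m by blast
      moreover have "list_monomial t 0 e \<in> polys n" using mA sub by blast
      ultimately show ?thesis by (auto simp: keys_push polys_def)
    qed
    ultimately show "monom_at m 1 \<in> B" using m by (auto simp: B_def deg_le_def)
  qed
  then obtain c e where c: "e \<in> exponents N R" "c e \<noteq> 0"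
    "(\<Sum>e\<in>exponents N R. mconst (c e) * subst h (list_monomial t 0 e)) = 0" by blast
  let ?s = "\<Sum>e\<in>exponents N R. mconst (c e) * list_monomial t 0 e"
  have "subst h ?s = 0" using c(3) by (simp add: subst_sum subst_mult)
  moreover have "?s \<in> A" by (intro A.sum_in A.mult_in const mA)
  ultimately have "?s \<in> q 0" by (rule q0[rotated])
  then have "c e = 0"
    using chain_algebraically_independent[where R = R and q = q and t = t and j = 0 and l =
      R and N = N and c = c and e = e] q t c(1) by (auto simp: psubset_eq)
  then show False using c(2) by simp
qed

end


section \<open>Independence of characters modulo a prime\<close>

text \<open>Artin's argument modulo \<open>Q\<close>: evaluate the relation at \<open>d * b\<close>
  and subtract \<open>\<chi> x d\<close> times its value at \<open>b\<close>. The term of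
  \<open>x\<close> disappears and the other coefficients are multiplied by
  \<open>\<chi> i d - \<chi> x d\<close>, which is outside \<open>Q\<close> for suitable
  \<open>d\<close>.\<close>

lemma (in unital_subring) independent_characters_mod_prime:
  assumes Q: "prm Q" and C: "1 \<in> C" "\<And>a b. a \<in> C \<Longrightarrow> b \<in> C \<Longrightarrow> a * b \<in> C"
    and chi: "\<And>i b. i \<in> X \<Longrightarrow> b \<in> C \<Longrightarrow> \<chi> i b \<in> S" "\<And>i. i \<in> X \<Longrightarrow> \<chi> i 1 = 1"
      "\<And>i a b. i \<in> X \<Longrightarrow> a \<in> C \<Longrightarrow> b \<in> C \<Longrightarrow> \<chi> i (a * b) = \<chi> i a * \<chi> i b"
    and dist: "\<And>i j. i \<in> X \<Longrightarrow> j \<in> X \<Longrightarrow> i \<noteq> j \<Longrightarrow> \<exists>b\<in>C. \<chi> i b - \<chi> j b \<notin> Q"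
    and "finite X" and c: "\<And>i. i \<in> X \<Longrightarrow> c i \<in> S" and zero: "\<And>b. b \<in> C \<Longrightarrow> (\<Sum>i\<in>X. c i * \<chi> i b) \<in> Q"
  shows "\<forall>i\<in>X. c i \<in> Q"
  using \<open>finite X\<close> chi dist c zero
proof (induction X arbitrary: c rule: finite_induct)
  case (insert x X)
  note I = prmD(1)[OF Q]
  have other: "c i \<in> Q" if i: "i \<in> X" for i
  proof -
    have "i \<noteq> x" using i insert.hyps by blast
    then obtain d where d: "d \<in> C" "\<chi> x d - \<chi> i d \<notin> Q" using insert.prems(4)[of x i] i by blast
    have "\<forall>i\<in>X. c i * (\<chi> i d - \<chi> x d) \<in> Q"
    proof (rule insert.IH)
      fix b assume b: "b \<in> C"
      have "(\<Sum>i\<in>X. c i * (\<chi> i d - \<chi> x d) * \<chi> i b) =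
        (\<Sum>i\<in>insert x X. c i * \<chi> i (d * b)) - \<chi> x d * (\<Sum>i\<in>insert x X. c i * \<chi> i b)"
        using insert.hyps insert.prems(3) b d(1)
        by (simp add: algebra_simps sum_distrib_left sum_subtractf sum.distrib)
      also have "\<dots> \<in> Q"
        using insert.prems(1,6) b d(1) C(2) by (intro idlD(7)[OF I] idlD(4)[OF I]) auto
      finally show "(\<Sum>i\<in>X. c i * (\<chi> i d - \<chi> x d) * \<chi> i b) \<in> Q" .
    qed (use insert.prems(1-5) d in \<open>auto intro!: mult_in diff_in\<close>)
    then have "c i * (\<chi> i d - \<chi> x d) \<in> Q" using i by blast
    moreover have "\<chi> i d - \<chi> x d \<notin> Q" using d(2) idlD(6)[OF I, of "\<chi> i d - \<chi> x d"] by auto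
    moreover have "c i \<in> S" "\<chi> i d - \<chi> x d \<in> S" using insert.prems(1,5) i d(1) by auto
    ultimately show ?thesis using prmD(3)[OF Q] by blast
  qed
  have "(\<Sum>i\<in>insert x X. c i * \<chi> i 1) \<in> Q" using insert.prems(6) C(1) by blast
  moreover have "(\<Sum>i\<in>insert x X. c i * \<chi> i 1) = (\<Sum>i\<in>X. c i) + c x"
    using insert.hyps insert.prems(2) by (simp add: add.commute)
  moreover have "(\<Sum>i\<in>X. c i) \<in> Q" using other by (intro idl_sum[OF I])
  ultimately have "c x \<in> Q" using idl_add_cancel[OF I] by metis
  then show ?case using other by blast
qed simp

section \<open>Polynomials with roots permuted by ring endomorphisms\<close>

definition ring_endo :: "('r::comm_ring_1 \<Rightarrow> 'r) \<Rightarrow> bool" where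
  "ring_endo s \<longleftrightarrow> s 1 = 1 \<and> (\<forall>a b. s (a + b) = s a + s b) \<and> (\<forall>a b. s (a * b) = s a * s b)"

lemma ring_endoD:
  assumes "ring_endo s"
  shows "s 0 = 0" "s 1 = 1" "s (a + b) = s a + s b" "s (a * b) = s a * s b" "s (- a) = - s a"
    "s (a - b) = s a - s b"
proof -
  have *: "s (a + b) = s a + s b" for a b using assms by (simp add: ring_endo_def)
  show z: "s 0 = 0" using *[of 0 0] by simp
  have neg: "s (- b) = - s b" for b using *[of b "- b"] z
    by (simp add: eq_neg_iff_add_eq_0 add.commute)
  show "s (- a) = - s a" by (rule neg)
  show "s (a - b) = s a - s b" using *[of a "- b"] neg by simp
qed (use assms in \<open>auto simp: ring_endo_def\<close>)

lemma ring_endo_sum: "ring_endo s \<Longrightarrow> s (sum f X) = (\<Sum>x\<in>X. s (f x))"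
  by (induction X rule: infinite_finite_induct) (simp_all add: ring_endoD)

lemma ring_endo_map_poly: assumes s: "ring_endo s" shows "ring_endo (map_poly s)"
  unfolding ring_endo_def
proof (intro conjI allI)
  note [simp] = coeff_map_poly[of s] ring_endoD[OF s]
  show "map_poly s 1 = 1" by (simp add: map_poly_1')
  show "map_poly s (p + q) = map_poly s p + map_poly s q" for p q
    by (rule poly_eqI) simp
  show "map_poly s (p * q) = map_poly s p * map_poly s q" for p q
    by (rule poly_eqI) (simp add: coeff_mult ring_endo_sum[OF s])
qed

lemma map_poly_root_product:
  assumes s: "ring_endo s"
  shows "map_poly s (\<Prod>h\<in>H. [:- x h, 1:]) = (\<Prod>h\<in>H. [:- s (x h), 1:])"
proof (induction H rule: infinite_finite_induct)
  case (insert h H)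
  have "map_poly s [:- x h, 1:] = [:- s (x h), 1:]"
    by (simp add: map_poly_pCons ring_endoD[OF s])
  then show ?case
    by (simp only: prod.insert[OF insert.hyps] ring_endoD(4)[OF ring_endo_map_poly[OF s]] insert.IH)
qed (simp_all add: map_poly_1' ring_endoD[OF s])

lemma ring_endo_subst: "ring_endo (subst h)"
  by (simp add: ring_endo_def subst_add subst_mult)

context unital_subring
begin

definition over :: "'a set \<Rightarrow> 'a poly set" where
  "over J = {f. \<forall>i. coeff f i \<in> J}"

lemma unital_subring_over: "unital_subring (over S)"
proof
  show "1 \<in> over S" by (auto simp: over_def coeff_1)
  show "f * g \<in> over S" if "f \<in> over S" "g \<in> over S" for f g
    using that by (auto simp: over_def coeff_mult intro!: sum_in)
qed (auto simp: over_def)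

interpretation T: unital_subring "over S" by (rule unital_subring_over)

text \<open>Gauss's argument: if \<open>a\<close> and \<open>b\<close> are the lowest indices at
  which \<open>f\<close> and \<open>g\<close> have coefficients outside \<open>Q\<close>, then
  modulo \<open>Q\<close> the coefficient of the product at \<open>a + b\<close> is the product of
  these two.\<close>

lemma prm_over:
  assumes Q: "prm Q"
  shows "unital_subring.prm (over S) (over Q)"
proof -
  note I = prmD(1)[OF Q]
  have idl: "T.idl (over Q)" unfolding T.idl_def
  proof (intro conjI ballI)
    show "over Q \<subseteq> over S" using idlD(1)[OF I] by (auto simp: over_def)
    show "0 \<in> over Q" using idlD(2)[OF I] by (auto simp: over_def)
    show "f + g \<in> over Q" if "f \<in> over Q" "g \<in> over Q" for f g
      using that idlD(3)[OF I] by (auto simp: over_def)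
    show "f * g \<in> over Q" if "f \<in> over S" "g \<in> over Q" for f g
      using that by (auto simp: over_def coeff_mult intro!: idl_sum[OF I] idlD(4)[OF I])
  qed
  show ?thesis unfolding T.prm_def
  proof (intro conjI ballI impI)
    show "T.idl (over Q)" by (rule idl)
    have "coeff 1 0 \<notin> Q" using prmD(2)[OF Q] by simp
    then show "1 \<notin> over Q" unfolding over_def by blast
    fix f g assume fg: "f \<in> over S" "g \<in> over S" "f * g \<in> over Q"
    show "f \<in> over Q \<or> g \<in> over Q"
    proof (rule ccontr)
      assume "\<not> ?thesis"
      then have ex: "\<exists>i. coeff f i \<notin> Q" "\<exists>i. coeff g i \<notin> Q" by (auto simp: over_def)
      define a where "a = (LEAST i. coeff f i \<notin> Q)"
      define b where "b = (LEAST i. coeff g i \<notin> Q)"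
      have a: "coeff f a \<notin> Q" "\<And>i. i < a \<Longrightarrow> coeff f i \<in> Q"
        unfolding a_def using LeastI_ex[OF ex(1)] not_less_Least by blast+
      have b: "coeff g b \<notin> Q" "\<And>i. i < b \<Longrightarrow> coeff g i \<in> Q"
        unfolding b_def using LeastI_ex[OF ex(2)] not_less_Least by blast+
      have "coeff (f * g) (a + b) =
        (\<Sum>i\<in>{..a + b} - {a}. coeff f i * coeff g (a + b - i)) + coeff f a * coeff g b"
        unfolding coeff_mult by (subst sum.remove[of _ a]) (auto simp: add.commute)
      moreover have "(\<Sum>i\<in>{..a + b} - {a}. coeff f i * coeff g (a + b - i)) \<in> Q"
      proof (rule idl_sum[OF I])
        fix i assume i: "i \<in> {..a + b} - {a}"
        have S: "coeff f i \<in> S" "coeff g (a + b - i) \<in> S" using fg by (auto simp: over_def)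
        show "coeff f i * coeff g (a + b - i) \<in> Q"
        proof (cases "i < a")
          case True
          then show ?thesis using idlD(5)[OF I S(2) a(2)] by blast
        next
          case False
          then have "a + b - i < b" using i by auto
          then show ?thesis using idlD(4)[OF I S(1) b(2)] by blast
        qed
      qed
      moreover have "coeff (f * g) (a + b) \<in> Q" using fg(3) by (auto simp: over_def)
      ultimately have "coeff f a * coeff g b \<in> Q" using idl_add_cancel[OF I] by metis
      moreover have "coeff f a \<in> S" "coeff g b \<in> S" using fg by (auto simp: over_def)
      ultimately show False using prmD(3)[OF Q] a(1) b(1) by blast
    qed
  qed
qed

lemma poly_in_ideal:
  assumes J: "idl J" and F: "\<And>i. coeff F i \<in> J" and x: "x \<in> S"
  shows "poly F x \<in> J"
  unfolding poly_altdef using F x by (intro idl_sum[OF J] idlD(5)[OF J]) auto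

end

section \<open>The inertia group and its cocycle\<close>

text \<open>\<open>r\<close> labels the orbits of the chosen element. \<open>gen\<close> makes the
  image of \<open>\<phi>\<close> cyclic of order \<open>p\<close>, generated by the value at
  \<open>\<sigma>0\<close>; \<open>trans\<close> says that every element with a nonzero value has
  the fibres of \<open>r\<close> as its orbits.\<close>

locale inertia_cocycle =
  fixes n :: nat and G :: "(nat \<Rightarrow> nat) set" and r :: "nat \<Rightarrow> nat"
    and \<phi> :: "(nat \<Rightarrow> nat) \<Rightarrow> 'k::field" and p :: nat and \<sigma>0 :: "nat \<Rightarrow> nat" and I :: "(nat \<Rightarrow> nat) set"
  assumes G: "subgroup G (sym_group n)"
    and r: "\<And>i. i \<in> {1..n} \<Longrightarrow> r i \<in> {1..n}"
    and I_def: "I = {\<sigma> \<in> G. \<forall>i\<in>{1..n}. r (\<sigma> i) = r i}"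
    and phi: "\<And>\<sigma> \<tau>. \<sigma> \<in> I \<Longrightarrow> \<tau> \<in> I \<Longrightarrow> \<phi> (\<sigma> \<circ> \<tau>) = \<phi> \<sigma> + \<phi> \<tau>"
    and s0: "\<sigma>0 \<in> I" "\<phi> \<sigma>0 \<noteq> 0"
    and gen: "\<And>\<sigma>. \<sigma> \<in> I \<Longrightarrow> \<exists>j. \<phi> \<sigma> = of_nat j * \<phi> \<sigma>0"
    and trans: "\<And>\<sigma> i. \<sigma> \<in> I \<Longrightarrow> \<phi> \<sigma> \<noteq> 0 \<Longrightarrow> i \<in> {1..n} \<Longrightarrow> \<exists>j. (\<sigma> ^^ j) i = r i"
    and char: "CHAR('k) = p" "prime p"
begin

abbreviation "R \<equiv> polys n :: 'k mpoly set"
abbreviation "act \<equiv> subst :: (nat \<Rightarrow> nat) \<Rightarrow> 'k mpoly \<Rightarrow> 'k mpoly"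

lemma G_perm: "\<sigma> \<in> G \<Longrightarrow> \<sigma> permutes {1..n}"
  using subgroup.mem_carrier[OF G] by (simp add: sym_group_carrier)

lemma G_id: "id \<in> G"
  using subgroup.one_closed[OF G] by (simp add: sym_group_one)

lemma G_comp: "\<sigma> \<in> G \<Longrightarrow> \<tau> \<in> G \<Longrightarrow> \<sigma> \<circ> \<tau> \<in> G"
  using subgroup.m_closed[OF G] by (simp add: sym_group_mult)

lemma G_inv: "\<sigma> \<in> G \<Longrightarrow> inv' \<sigma> \<in> G"
  using subgroup.m_inv_closed[OF G, of \<sigma>] subgroup.mem_carrier[OF G, of \<sigma>] by simp

lemma G_finite: "finite G"
  by (rule finite_subset[OF _ finite_permutations[of "{1..n}"]]) (use G_perm in auto)

lemma G_in: "\<sigma> \<in> G \<Longrightarrow> i \<in> {1..n} \<Longrightarrow> \<sigma> i \<in> {1..n}"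
  using permutes_in_image[OF G_perm] by blast

lemma G_inv_comp: "\<sigma> \<in> G \<Longrightarrow> inv' \<sigma> \<circ> \<sigma> = id" "\<sigma> \<in> G \<Longrightarrow> \<sigma> \<circ> inv' \<sigma> = id"
  using permutes_inv_o[OF G_perm] by auto

lemma I_G: "\<sigma> \<in> I \<Longrightarrow> \<sigma> \<in> G"
  by (simp add: I_def)

lemma I_id: "id \<in> I"
  using G_id by (simp add: I_def)

lemma I_comp: "\<sigma> \<in> I \<Longrightarrow> \<tau> \<in> I \<Longrightarrow> \<sigma> \<circ> \<tau> \<in> I"
  using G_comp G_in by (auto simp: I_def)

lemma I_inv: assumes "\<sigma> \<in> I" shows "inv' \<sigma> \<in> I"
proof -
  have s: "\<sigma> \<in> G" using I_G assms .
  have "r (inv' \<sigma> i) = r i" if i: "i \<in> {1..n}" for i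
  proof -
    have "r (\<sigma> (inv' \<sigma> i)) = r (inv' \<sigma> i)" using assms G_in[OF G_inv[OF s] i] by (simp add: I_def)
    then show ?thesis using fun_cong[OF G_inv_comp(2)[OF s], of i] by simp
  qed
  then show ?thesis using G_inv[OF s] by (simp add: I_def)
qed

lemma I_pow: "\<sigma> \<in> I \<Longrightarrow> \<sigma> ^^ j \<in> I"
  by (induction j) (simp_all add: I_id[unfolded id_def] I_id I_comp)

lemma phi_id: "\<phi> id = 0"
  using phi[OF I_id I_id] by (metis add_cancel_right_right comp_id)

lemma phi_inv: "\<sigma> \<in> I \<Longrightarrow> \<phi> (inv' \<sigma>) = - \<phi> \<sigma>"
  using phi[OF I_inv, of \<sigma> \<sigma>] G_inv_comp(1)[OF I_G] phi_id by (simp add: eq_neg_iff_add_eq_0)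

lemma phi_pow: "\<sigma> \<in> I \<Longrightarrow> \<phi> (\<sigma> ^^ j) = of_nat j * \<phi> \<sigma>"
  by (induction j) (simp_all add: phi_id phi I_pow algebra_simps)

definition K :: "(nat \<Rightarrow> nat) set" where "K = {\<sigma> \<in> I. \<phi> \<sigma> = 0}"

lemma K_I: "\<kappa> \<in> K \<Longrightarrow> \<kappa> \<in> I"
  by (simp add: K_def)

lemma K_conj: "\<kappa> \<in> K \<Longrightarrow> \<sigma> \<in> I \<Longrightarrow> inv' \<sigma> \<circ> (\<kappa> \<circ> \<sigma>) \<in> K"
  by (simp add: K_def phi phi_inv I_comp I_inv)

lemma K_comp: "\<kappa> \<in> K \<Longrightarrow> \<kappa>' \<in> K \<Longrightarrow> \<kappa> \<circ> \<kappa>' \<in> K" and K_inv: "\<kappa> \<in> K \<Longrightarrow> inv' \<kappa> \<in> K" and K_id: "id \<in> K"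
  by (simp_all add: K_def phi phi_inv I_comp I_inv I_id phi_id)

lemma s0_pow_p: "\<sigma>0 ^^ p \<in> K"
  using I_pow[OF s0(1)] phi_pow[OF s0(1)] of_nat_CHAR[where 'a = 'k] char(1) by (simp add: K_def)

lemma I_decomp: assumes "\<sigma> \<in> I" obtains j \<kappa> where "\<kappa> \<in> K" "\<sigma> = (\<sigma>0 ^^ j) \<circ> \<kappa>"
  "\<phi> \<sigma> = of_nat j * \<phi> \<sigma>0"
proof -
  obtain j where j: "\<phi> \<sigma> = of_nat j * \<phi> \<sigma>0" using gen[OF assms] by blast
  let ?\<kappa> = "inv' (\<sigma>0 ^^ j) \<circ> \<sigma>"
  have I: "\<sigma>0 ^^ j \<in> I" by (rule I_pow[OF s0(1)])
  have "?\<kappa> \<in> K" using I_comp[OF I_inv[OF I] assms] phi[OF I_inv[OF I] assms] phi_inv[OF I] phi_pow[OF s0(1)] j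
    by (simp add: K_def)
  moreover have "\<sigma> = (\<sigma>0 ^^ j) \<circ> ?\<kappa>"
    using G_inv_comp(2)[OF I_G[OF I]] by (metis comp_assoc id_comp)
  ultimately show ?thesis using that j by blast
qed

lemma act_in: "\<sigma> \<in> G \<Longrightarrow> f \<in> R \<Longrightarrow> act \<sigma> f \<in> R"
  by (rule subst_in_polys) (use G_in in auto)

lemma r_act: "\<sigma> \<in> I \<Longrightarrow> f \<in> R \<Longrightarrow> act r (act \<sigma> f) = act r f"
  unfolding subst_subst by (rule subst_cong) (auto simp: I_def)

definition fixed :: "(nat \<Rightarrow> nat) set \<Rightarrow> 'k mpoly set" where
  "fixed H = {f \<in> R. \<forall>\<sigma>\<in>H. act \<sigma> f = f}"

lemma unital_subring_fixed: "unital_subring (fixed H)"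
  by unfold_locales (auto simp: fixed_def subst_add subst_mult subst_uminus)

lemma fixedD: "f \<in> fixed H \<Longrightarrow> f \<in> R" "f \<in> fixed H \<Longrightarrow> \<sigma> \<in> H \<Longrightarrow> act \<sigma> f = f"
  by (auto simp: fixed_def)

lemma fixed_mono: "H \<subseteq> H' \<Longrightarrow> fixed H' \<subseteq> fixed H"
  by (auto simp: fixed_def)

lemma mconst_fixed: "mconst c \<in> fixed H"
  by (simp add: fixed_def)

interpretation A: unital_subring "fixed G" by (rule unital_subring_fixed)
interpretation RI: unital_subring "fixed I" by (rule unital_subring_fixed)
interpretation C: unital_subring "fixed K" by (rule unital_subring_fixed)

text \<open>The invariants under \<open>H\<close> that annihilate the class of \<open>\<phi>\<close> in \<open>H\<^sup>1(I, R)\<close>.\<close>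

definition killers :: "(nat \<Rightarrow> nat) set \<Rightarrow> 'k mpoly set" where
  "killers H = {a \<in> fixed H. \<exists>u\<in>R. \<forall>\<sigma>\<in>I. act \<sigma> u - u = a * mconst (\<phi> \<sigma>)}"

lemma act_fixed_K: assumes "f \<in> fixed K" "\<sigma> \<in> I" shows "act \<sigma> f \<in> fixed K"
proof -
  have "act \<kappa> (act \<sigma> f) = act \<sigma> f" if k: "\<kappa> \<in> K" for \<kappa>
  proof -
    have "\<kappa> \<circ> \<sigma> = \<sigma> \<circ> (inv' \<sigma> \<circ> (\<kappa> \<circ> \<sigma>))"
      using G_inv_comp(2)[OF I_G[OF assms(2)]] by (metis comp_assoc id_comp)
    then have "act \<kappa> (act \<sigma> f) = act \<sigma> (act (inv' \<sigma> \<circ> (\<kappa> \<circ> \<sigma>)) f)" by (simp add: subst_subst)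
    then show ?thesis using fixedD(2)[OF assms(1) K_conj[OF k assms(2)]] by simp
  qed
  then show ?thesis using act_in[OF I_G[OF assms(2)] fixedD(1)[OF assms(1)]]
    by (simp add: fixed_def)
qed

lemma idl_killers:
  assumes IH: "I \<subseteq> H"
  shows "unital_subring.idl (fixed H) (killers H)"
proof -
  interpret H: unital_subring "fixed H" by (rule unital_subring_fixed)
  show ?thesis unfolding H.idl_def
  proof (intro conjI ballI)
    show "killers H \<subseteq> fixed H" by (auto simp: killers_def)
    show "0 \<in> killers H" by (auto simp: killers_def intro!: bexI[of _ 0])
  next
    fix a b assume ab: "a \<in> killers H" "b \<in> killers H"
    then obtain u v where uv: "u \<in> R" "\<forall>\<sigma>\<in>I. act \<sigma> u - u = a * mconst (\<phi> \<sigma>)"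
      "v \<in> R" "\<forall>\<sigma>\<in>I. act \<sigma> v - v = b * mconst (\<phi> \<sigma>)" by (auto simp: killers_def)
    have "act \<sigma> (u + v) - (u + v) = (a + b) * mconst (\<phi> \<sigma>)" if "\<sigma> \<in> I" for \<sigma>
    proof -
      have "act \<sigma> (u + v) - (u + v) = (act \<sigma> u - u) + (act \<sigma> v - v)" by (simp add: subst_add)
      then show ?thesis using uv that by (simp add: distrib_right)
    qed
    then show "a + b \<in> killers H" using ab uv by (auto simp: killers_def intro!: bexI[of _ "u + v"])
  next
    fix s a assume s: "s \<in> fixed H" and a: "a \<in> killers H"
    then obtain u where u: "u \<in> R" "\<forall>\<sigma>\<in>I. act \<sigma> u - u = a * mconst (\<phi> \<sigma>)"
      by (auto simp: killers_def)
    have "act \<sigma> (s * u) - s * u = s * a * mconst (\<phi> \<sigma>)" if "\<sigma> \<in> I" for \<sigma>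
    proof -
      have "act \<sigma> (s * u) - s * u = s * (act \<sigma> u - u)"
        using fixedD(2)[OF s, of \<sigma>] that IH by (auto simp: subst_mult right_diff_distrib)
      then show ?thesis using u that by (simp add: mult.assoc)
    qed
    then show "s * a \<in> killers H"
      using s a u fixedD(1)[OF s] by (auto simp: killers_def intro!: bexI[of _ "s * u"])
  qed
qed

text \<open>The indeterminate of the coefficient ring \<open>R[t]\<close> makes \<open>\<Sum> x\<^sub>i t\<^sup>i\<close> a generic
  element, so that a single \<open>\<kappa>\<close> works for all variables at once.\<close>

lemma exists_inertial_lift:
  assumes Q: "polys.prm n Q" and triv: "\<And>c. c \<in> fixed K \<Longrightarrow> act \<sigma>0 c - c \<in> Q"
  shows "\<exists>\<kappa>\<in>K. \<forall>i\<in>{1..n}. mvar i - mvar ((\<sigma>0 \<circ> \<kappa>) i) \<in> Q"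
proof -
  interpret T: unital_subring "polys.over R" by (rule polys.unital_subring_over)
  have QT: "T.prm (polys.over Q)" by (rule polys.prm_over[OF Q])
  define X :: "'k mpoly poly" where "X = (\<Sum>i\<in>{1..n}. monom (mvar i) i)"
  have coeff_X: "coeff X i = (if i \<in> {1..n} then mvar i else 0)" for i
    by (auto simp: X_def coeff_sum coeff_monom)
  have XR: "X \<in> polys.over R" by (auto simp: polys.over_def coeff_X)
  define s where "s h = map_poly (act h)" for h
  have s: "ring_endo (s h)" for h unfolding s_def by (intro ring_endo_map_poly ring_endo_subst)
  have coeff_s: "coeff (s h f) i = act h (coeff f i)" for h f i
    by (simp add: s_def coeff_map_poly)
  have s_comp: "s h (s h' f) = s (h \<circ> h') f" for h h' f
    by (rule poly_eqI) (simp add: coeff_s subst_subst)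
  have s_id: "s id f = f" for f by (rule poly_eqI) (simp add: coeff_s)
  have finK: "finite K" using G_finite I_G K_I by (meson finite_subset subsetI)
  \<comment> \<open>\<open>X\<close> is a root of \<open>F\<close>, and \<open>\<sigma>0\<close>
    does not change the \<open>K\<close>-invariant coefficients modulo \<open>Q\<close>. So the
    transform of \<open>F\<close> by \<open>\<sigma>0\<close>, whose roots are the images of
    \<open>X\<close> under the \<open>\<sigma>0 \<circ> \<kappa>\<close>, also vanishes at
    \<open>X\<close> modulo \<open>Q\<close>; primality selects one factor.\<close>
  define F where "F = (\<Prod>\<kappa>\<in>K. [:- s \<kappa> X, 1:])"
  have F_inv: "map_poly (s \<kappa>) F = F" if k: "\<kappa> \<in> K" for \<kappa>
  proof -
    have "map_poly (s \<kappa>) F = (\<Prod>\<kappa>'\<in>K. [:- s (\<kappa> \<circ> \<kappa>') X, 1:])"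
      unfolding F_def map_poly_root_product[OF s] s_comp ..
    also have "\<dots> = F" unfolding F_def
    proof (rule prod.reindex_bij_witness[where i = "\<lambda>h. inv' \<kappa> \<circ> h" and j = "\<lambda>h. \<kappa> \<circ> h"])
      note c = G_inv_comp[OF I_G[OF K_I[OF k]]]
      show "inv' \<kappa> \<circ> (\<kappa> \<circ> h) = h" "\<kappa> \<circ> (inv' \<kappa> \<circ> h) = h" for h
        using c by (metis comp_assoc id_comp)+
    qed (use k K_comp K_inv in auto)
    finally show ?thesis .
  qed
  have F_R: "coeff F l \<in> polys.over R" for l
  proof -
    have U: "unital_subring (T.over (polys.over R))" by (rule T.unital_subring_over)
    have "F \<in> T.over (polys.over R)" unfolding F_def
    proof (rule unital_subring.prod_in[OF U])
      fix \<kappa> assume k: "\<kappa> \<in> K"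
      have "s \<kappa> X \<in> polys.over R"
        using XR act_in[OF I_G[OF K_I[OF k]]] by (auto simp: polys.over_def coeff_s)
      then show "[:- s \<kappa> X, 1:] \<in> T.over (polys.over R)"
        by (auto simp: T.over_def coeff_pCons split: nat.split)
    qed
    then show ?thesis by (auto simp: T.over_def)
  qed
  have F_C: "coeff (coeff F l) i \<in> fixed K" for l i
  proof -
    have "act \<kappa> (coeff (coeff F l) i) = coeff (coeff F l) i" if "\<kappa> \<in> K" for \<kappa>
    proof -
      have "coeff (coeff (map_poly (s \<kappa>) F) l) i = act \<kappa> (coeff (coeff F l) i)"
        by (simp add: coeff_map_poly ring_endoD(1)[OF s] coeff_s)
      then show ?thesis using F_inv[OF that] by simp
    qed
    then show ?thesis using F_R[of l] by (auto simp: fixed_def polys.over_def)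
  qed
  have "coeff (map_poly (s \<sigma>0) F - F) l \<in> polys.over Q" for l
    using triv[OF F_C] by (auto simp: polys.over_def coeff_map_poly ring_endoD(1)[OF s] coeff_s)
  then have "poly (map_poly (s \<sigma>0) F - F) X \<in> polys.over Q"
    by (rule T.poly_in_ideal[OF T.prmD(1)[OF QT] _ XR])
  moreover have "poly F X = 0"
    unfolding F_def poly_prod using finK K_id
      by (intro prod_zero) (auto intro!: bexI[of _ id] simp: s_id)
  moreover have "poly (map_poly (s \<sigma>0) F) X = (\<Prod>\<kappa>\<in>K. X - s (\<sigma>0 \<circ> \<kappa>) X)"
    unfolding F_def map_poly_root_product[OF s] s_comp poly_prod by simp
  ultimately have prod: "(\<Prod>\<kappa>\<in>K. X - s (\<sigma>0 \<circ> \<kappa>) X) \<in> polys.over Q" by simp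
  have inR: "X - s (\<sigma>0 \<circ> \<kappa>) X \<in> polys.over R" if "\<kappa> \<in> K" for \<kappa>
    using XR act_in[OF I_G[OF I_comp[OF s0(1) K_I[OF that]]]] by (auto simp: polys.over_def coeff_s)
  obtain \<kappa> where k: "\<kappa> \<in> K" "X - s (\<sigma>0 \<circ> \<kappa>) X \<in> polys.over Q"
    using T.prm_prod[OF QT finK inR prod] by blast
  have "mvar i - mvar ((\<sigma>0 \<circ> \<kappa>) i) \<in> Q" if "i \<in> {1..n}" for i
  proof -
    have "coeff (X - s (\<sigma>0 \<circ> \<kappa>) X) i \<in> Q" using k(2) unfolding polys.over_def by blast
    then show ?thesis using that by (simp add: coeff_s coeff_X)
  qed
  then show ?thesis using k(1) by blast
qed

text \<open>The lift \<open>h = \<sigma>0 \<circ> \<kappa>\<close> has a nonzero value under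
  \<open>\<phi>\<close>, so its powers lead from each \<open>i\<close> to \<open>r i\<close>.
  Composing the congruences between \<open>x_i\<close> and \<open>x_(h i)\<close> gives those
  between \<open>x_i\<close> and \<open>x_(r i)\<close>, which generate \<open>P\<close>.\<close>

lemma inertial_prime:
  assumes Q: "polys.prm n Q" and triv: "\<And>c. c \<in> fixed K \<Longrightarrow> act \<sigma>0 c - c \<in> Q"
    and f: "f \<in> R" "act r f = 0"
  shows "f \<in> Q"
proof -
  note I = polys.prmD(1)[OF Q]
  obtain \<kappa> where k: "\<kappa> \<in> K" "\<And>i. i \<in> {1..n} \<Longrightarrow> mvar i - mvar ((\<sigma>0 \<circ> \<kappa>) i) \<in> Q"
    using exists_inertial_lift[OF Q triv] by blast
  define h where "h = \<sigma>0 \<circ> \<kappa>"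
  have h: "h \<in> I" "\<phi> h \<noteq> 0" using k(1) s0 by (auto simp: h_def K_def phi I_comp)
  have "mvar i - mvar (r i) \<in> Q" if i: "i \<in> {1..n}" for i
  proof -
    have "mvar i - mvar ((h ^^ j) i) \<in> Q" for j
    proof (induction j)
      case (Suc j)
      have "(h ^^ j) i \<in> {1..n}" using G_in[OF I_G[OF I_pow[OF h(1)]] i] .
      then have "mvar ((h ^^ j) i) - mvar (h ((h ^^ j) i)) \<in> Q" by (rule k(2)[folded h_def])
      then have "(mvar i - mvar ((h ^^ j) i)) + (mvar ((h ^^ j) i) - mvar (h ((h ^^ j) i))) \<in> Q"
        by (rule polys.idlD(3)[OF I Suc])
      then show ?case by simp
    qed (simp add: polys.idlD(2)[OF I])
    then show ?thesis using trans[OF h i] by metis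
  qed
  then have "f - act r f \<in> Q" by (intro diff_subst_in_ideal[OF I r _ f(1)])
  then show ?thesis using f(2) by simp
qed

text \<open>The splitting is explicit: with \<open>t\<close> the trace and \<open>v\<close> the sum
  of the \<open>j\<close>-th conjugates weighted by \<open>j\<close>, characteristic
  \<open>p\<close> gives \<open>act \<sigma>0 v = v - t\<close>, and \<open>u\<close> is
  \<open>v\<close> times the constant \<open>- \<phi> \<sigma>0\<close>.\<close>

lemma trace_mem_killers:
  assumes b: "b \<in> fixed K"
  shows "(\<Sum>j<p. act (\<sigma>0 ^^ j) b) \<in> killers I"
proof -
  define B where "B j = act (\<sigma>0 ^^ j) b" for j
  have BK: "B j \<in> fixed K" for j unfolding B_def by (rule act_fixed_K[OF b I_pow[OF s0(1)]])
  have B_Suc: "act \<sigma>0 (B j) = B (Suc j)" for j by (simp add: B_def subst_subst)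
  have B_p: "B p = B 0" using fixedD(2)[OF b s0_pow_p] by (simp add: B_def)
  define t where "t = (\<Sum>j<p. B j)"
  define v where "v = (\<Sum>j<p. of_nat j * B j)"
  have shift: "(\<Sum>j<p. f (Suc j)) = (\<Sum>j<p. f j) + f p - f 0" for f :: "nat \<Rightarrow> 'k mpoly"
    by (induction p) (simp_all add: algebra_simps)
  have act_of_nat: "act h (of_nat j) = of_nat j" for h j
    by (induction j) (simp_all add: subst_add)
  have t0: "act \<sigma>0 t = t" unfolding t_def subst_sum B_Suc using shift[of B] B_p by simp
  have char0: "of_nat p = (0 :: 'k mpoly)"
  proof -
    have "of_nat j = mconst (of_nat j :: 'k)" for j by (induction j) (simp_all add: mconst_add)
    then show ?thesis using of_nat_CHAR[where 'a = 'k] char(1) by simp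
  qed
  have v0: "act \<sigma>0 v = v - t"
  proof -
    have "act \<sigma>0 v = (\<Sum>j<p. of_nat j * B (Suc j))"
      unfolding v_def subst_sum subst_mult B_Suc act_of_nat ..
    also have "\<dots> = (\<Sum>j<p. of_nat (Suc j) * B (Suc j)) - (\<Sum>j<p. B (Suc j))"
      by (simp add: algebra_simps sum.distrib)
    also have "(\<Sum>j<p. of_nat (Suc j) * B (Suc j)) = v"
      unfolding v_def using shift[of "\<lambda>j. of_nat j * B j"] char0 by simp
    also have "(\<Sum>j<p. B (Suc j)) = t" unfolding t_def using shift[of B] B_p by simp
    finally show ?thesis .
  qed
  have tK: "t \<in> fixed K" unfolding t_def by (intro C.sum_in BK)
  have vK: "v \<in> fixed K" unfolding v_def by (intro C.sum_in C.mult_in C.of_nat_in BK)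
  have pow_t: "act (\<sigma>0 ^^ j) t = t" for j
  proof (induction j)
    case (Suc j)
    have e: "act (\<sigma>0 ^^ Suc j) t = act \<sigma>0 (act (\<sigma>0 ^^ j) t)" by (simp add: subst_subst comp_def)
    show ?case unfolding e Suc t0 ..
  qed simp
  have pow_v: "act (\<sigma>0 ^^ j) v = v - of_nat j * t" for j
  proof (induction j)
    case (Suc j)
    have e: "act (\<sigma>0 ^^ Suc j) v = act \<sigma>0 (act (\<sigma>0 ^^ j) v)" by (simp add: subst_subst comp_def)
    show ?case unfolding e Suc by (simp add: t0 v0 subst_diff subst_mult act_of_nat algebra_simps)
  qed simp
  define u where "u = mconst (- \<phi> \<sigma>0) * v"
  have eq: "act \<sigma> u - u = t * mconst (\<phi> \<sigma>)" and t_inv: "act \<sigma> t = t" if s: "\<sigma> \<in> I" for \<sigma>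
  proof -
    obtain j \<kappa> where j: "\<kappa> \<in> K" "\<sigma> = (\<sigma>0 ^^ j) \<circ> \<kappa>" "\<phi> \<sigma> = of_nat j * \<phi> \<sigma>0" using I_decomp[OF s] .
    have "act \<sigma> t = act (\<sigma>0 ^^ j) (act \<kappa> t)" by (simp add: j(2) subst_subst)
    then show "act \<sigma> t = t" using fixedD(2)[OF tK j(1)] pow_t by simp
    have "act \<sigma> v = act (\<sigma>0 ^^ j) (act \<kappa> v)" by (simp add: j(2) subst_subst)
    then have "act \<sigma> v = v - of_nat j * t" using fixedD(2)[OF vK j(1)] pow_v by simp
    moreover have "mconst (\<phi> \<sigma>) = of_nat j * mconst (\<phi> \<sigma>0)"
    proof -
      have "of_nat j = mconst (of_nat j :: 'k)" for j by (induction j) (simp_all add: mconst_add)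
      then show ?thesis using j(3) by (simp add: mconst_mult)
    qed
    moreover have "mconst (- \<phi> \<sigma>0) = - mconst (\<phi> \<sigma>0)" by (simp add: mconst_def single_uminus)
    moreover have "act \<sigma> u - u = mconst (- \<phi> \<sigma>0) * (act \<sigma> v - v)"
      by (simp add: u_def subst_mult right_diff_distrib)
    ultimately show "act \<sigma> u - u = t * mconst (\<phi> \<sigma>)" by (simp add: mult_ac)
  qed
  have "u \<in> R" unfolding u_def using fixedD(1)[OF vK] by (intro polys.mult_in) auto
  then have "t \<in> killers I" using eq t_inv fixedD(1)[OF tK] by (auto simp: killers_def fixed_def)
  then show ?thesis by (simp add: t_def B_def)
qed

text \<open>If all traces lay in \<open>Q\<close>, the \<open>p\<close> maps
  \<open>act (\<sigma>0 ^^ j)\<close> on \<open>fixed K\<close> would satisfy modulo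
  \<open>Q\<close> a relation with all coefficients 1, so two of them would agree modulo
  \<open>Q\<close>. As \<open>p\<close> is prime, a multiple of the difference of exponents is 1
  modulo \<open>p\<close>; then \<open>\<sigma>0\<close> is trivial modulo \<open>Q\<close>, and
  \<open>inertial_prime\<close> puts \<open>P\<close> inside \<open>Q\<close>.\<close>

lemma exists_killer_notin:
  assumes Q: "polys.prm n Q" and P: "\<not> {f \<in> R. act r f = 0} \<subseteq> Q"
  shows "\<exists>t\<in>killers I. t \<notin> Q"
proof (rule ccontr)
  assume none: "\<not> ?thesis"
  note idl = polys.prmD(1)[OF Q]
  have nontriv: "\<not> (\<forall>c\<in>fixed K. act \<sigma>0 c - c \<in> Q)" using inertial_prime[OF Q] P by blast
  have pow_red: "act (\<sigma>0 ^^ (p * q)) d = d" if "d \<in> fixed K" for q d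
  proof (induction q)
    case (Suc q)
    have "act (\<sigma>0 ^^ (p * Suc q)) d = act (\<sigma>0 ^^ (p * q)) (act (\<sigma>0 ^^ p) d)"
      by (simp add: subst_subst funpow_add[symmetric] add.commute)
    then show ?case using Suc fixedD(2)[OF that s0_pow_p] by simp
  qed simp
  have aux: False if ij: "i < j" "j < p"
    and all: "\<And>b. b \<in> fixed K \<Longrightarrow> act (\<sigma>0 ^^ j) b - act (\<sigma>0 ^^ i) b \<in> Q" for i j
  proof -
    define e where "e = j - i"
    have e: "0 < e" "e < p" using ij by (auto simp: e_def)
    have step: "act (\<sigma>0 ^^ e) d - d \<in> Q" if d: "d \<in> fixed K" for d
    proof -
      \<comment> \<open>Undoes the shift by \<open>i\<close> with natural exponents, since
        \<open>\<sigma>0 ^^ p\<close> fixes \<open>d\<close>.\<close>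
      define c where "c = act (\<sigma>0 ^^ (p - i)) d"
      have cK: "c \<in> fixed K" unfolding c_def by (rule act_fixed_K[OF d I_pow[OF s0(1)]])
      have "act (\<sigma>0 ^^ i) c = act (\<sigma>0 ^^ p) d"
        unfolding c_def subst_subst using ij by (simp add: funpow_add[symmetric])
      then have "act (\<sigma>0 ^^ i) c = d" using fixedD(2)[OF d s0_pow_p] by simp
      moreover have "act (\<sigma>0 ^^ j) c = act (\<sigma>0 ^^ e) (act (\<sigma>0 ^^ i) c)"
        using ij by (simp add: subst_subst e_def funpow_add[symmetric])
      ultimately show ?thesis using all[OF cK] by simp
    qed
    have steps: "act (\<sigma>0 ^^ (e * m)) d - d \<in> Q" if d: "d \<in> fixed K" for d m
    proof (induction m)
      case (Suc m)
      let ?d = "act (\<sigma>0 ^^ (e * m)) d"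
      have "act (\<sigma>0 ^^ (e * Suc m)) d = act (\<sigma>0 ^^ e) ?d"
        by (simp add: subst_subst funpow_add[symmetric])
      moreover have "(act (\<sigma>0 ^^ e) ?d - ?d) + (?d - d) \<in> Q"
        by (rule polys.idlD(3)[OF idl step[OF act_fixed_K[OF d I_pow[OF s0(1)]]] Suc])
      ultimately show ?case by simp
    qed (simp add: polys.idlD(2)[OF idl])
    have "coprime e p" using e char(2) by (metis coprime_commute nat_dvd_not_less prime_imp_coprime)
    then obtain m q where mq: "e * m = p * q + 1"
      using bezout_nat[of e p] e by (metis coprime_imp_gcd_eq_1 neq0_conv)
    have "act \<sigma>0 d - d \<in> Q" if d: "d \<in> fixed K" for d
    proof -
      have "act (\<sigma>0 ^^ (e * m)) d = act \<sigma>0 (act (\<sigma>0 ^^ (p * q)) d)" by (simp add: subst_subst mq)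
      then show ?thesis using steps[OF d, of m] pow_red[OF d] by simp
    qed
    then show False using nontriv by blast
  qed
  have "\<forall>j\<in>{..<p}. (1 :: 'k mpoly) \<in> Q"
  proof (rule polys.independent_characters_mod_prime[OF Q, where C = "fixed K" and \<chi> =
    "\<lambda>j. act (\<sigma>0 ^^ j)"])
    show "act (\<sigma>0 ^^ i) b \<in> R" if "i \<in> {..<p}" "b \<in> fixed K" for i b
      using act_in[OF I_G[OF I_pow[OF s0(1)]] fixedD(1)[OF that(2)]] .
    show "\<exists>b\<in>fixed K. act (\<sigma>0 ^^ i) b - act (\<sigma>0 ^^ j) b \<notin> Q" if ij: "i \<in> {..<p}" "j \<in> {..<p}"
      "i \<noteq> j" for i j
    proof (rule ccontr)
      assume "\<not> ?thesis"
      then have *: "act (\<sigma>0 ^^ i) b - act (\<sigma>0 ^^ j) b \<in> Q" if "b \<in> fixed K" for b using that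
        by blast
      then have "act (\<sigma>0 ^^ j) b - act (\<sigma>0 ^^ i) b \<in> Q" if "b \<in> fixed K" for b
        using polys.idlD(6)[OF idl *[OF that]] by simp
      then show False using * aux[of i j] aux[of j i] ij by (cases "i < j") auto
    qed
    show "(\<Sum>j<p. 1 * act (\<sigma>0 ^^ j) b) \<in> Q" if "b \<in> fixed K" for b
      using none trace_mem_killers[OF that] by auto
  qed (auto simp: subst_mult)
  moreover have "0 \<in> {..<p}" using char by (simp add: prime_gt_0_nat)
  ultimately show False using polys.prmD(2)[OF Q] by blast
qed

section \<open>Norms and primes lying over a prime of invariants\<close>

definition orbit_norm :: "'k mpoly \<Rightarrow> 'k mpoly" where
  "orbit_norm f = (\<Prod>\<tau>\<in>G. act \<tau> f)"

lemma orbit_norm_fixed: assumes "f \<in> R" shows "orbit_norm f \<in> fixed G"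
proof -
  have "act \<sigma> (orbit_norm f) = orbit_norm f" if s: "\<sigma> \<in> G" for \<sigma>
  proof -
    have "act \<sigma> (orbit_norm f) = (\<Prod>\<tau>\<in>G. act (\<sigma> \<circ> \<tau>) f)"
      by (simp only: orbit_norm_def subst_prod subst_subst)
    also have "\<dots> = orbit_norm f" unfolding orbit_norm_def
    proof (rule prod.reindex_bij_witness[where i = "\<lambda>h. inv' \<sigma> \<circ> h" and j = "\<lambda>h. \<sigma> \<circ> h"])
      show "inv' \<sigma> \<circ> (\<sigma> \<circ> h) = h" "\<sigma> \<circ> (inv' \<sigma> \<circ> h) = h" for h
        using G_inv_comp[OF s] by (metis comp_assoc id_comp)+
    qed (use s G_comp G_inv in auto)
    finally show ?thesis .
  qed
  then show ?thesis using act_in assms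
    by (auto simp: fixed_def orbit_norm_def intro!: polys.prod_in)
qed

text \<open>Take \<open>Q\<close> maximal among the ideals missing the invariants outside
  \<open>q\<close>. If some \<open>a \<in> q\<close> were outside \<open>Q\<close>, maximality would
  give an invariant \<open>x = y + a s\<close> outside \<open>q\<close> with
  \<open>y \<in> Q\<close>. The norm of \<open>y\<close> is \<open>x ^ card G + a z\<close> with
  \<open>z\<close> invariant; it lies in \<open>Q\<close>, hence in \<open>q\<close>, which forces
  \<open>x \<in> q\<close>.\<close>

lemma exists_prime_over:
  assumes q: "A.prm q"
  shows "\<exists>Q. polys.prm n Q \<and> q \<subseteq> Q \<and> Q \<inter> fixed G \<subseteq> q"
proof -
  note iq = A.prmD(1)[OF q]
  have "\<exists>Q. polys.prm n Q \<and> {0} \<subseteq> Q \<and> Q \<inter> (fixed G - q) = {} \<and>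
      (\<forall>a\<in>R - Q. \<exists>x\<in>Q. \<exists>s\<in>R. x + a * s \<in> fixed G - q)"
  proof (rule polys.exists_prm_disjoint[OF polys.idl_zero])
    show "1 \<in> fixed G - q" using A.prmD(2)[OF q] by blast
    show "a * b \<in> fixed G - q" if "a \<in> fixed G - q" "b \<in> fixed G - q" for a b
      using that A.prmD(3)[OF q, of a b] by auto
  qed (use A.idlD(2)[OF iq] in auto)
  then obtain Q where Q: "polys.prm n Q" "Q \<inter> (fixed G - q) = {}"
    and meet: "\<forall>a\<in>R - Q. \<exists>x\<in>Q. \<exists>s\<in>R. x + a * s \<in> fixed G - q" by (elim exE conjE) (rule that)
  note iQ = polys.prmD(1)[OF Q(1)]
  have "q \<subseteq> Q"
  proof
    fix a assume a: "a \<in> q"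
    have aA: "a \<in> fixed G" using A.idlD(1)[OF iq a] .
    show "a \<in> Q"
    proof (rule ccontr)
      assume nin: "a \<notin> Q"
      then have a0: "a \<noteq> 0" using polys.idlD(2)[OF iQ] by auto
      obtain y s where y: "y \<in> Q" "s \<in> R" "y + a * s \<in> fixed G - q"
        using bspec[OF meet, of a] nin fixedD(1)[OF aA] by blast
      define x where "x = y + a * s"
      have xA: "x \<in> fixed G" "x \<notin> q" using y by (auto simp: x_def)
      have yR: "y \<in> R" using polys.idlD(1)[OF iQ y(1)] .
      have N: "orbit_norm y = (\<Prod>\<tau>\<in>G. x - a * act \<tau> s)"
        unfolding orbit_norm_def
      proof (rule prod.cong[OF refl])
        fix \<tau> assume "\<tau> \<in> G"
        then have "act \<tau> (x - a * s) = x - a * act \<tau> s"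
          using fixedD(2)[OF xA(1)] fixedD(2)[OF aA] by (simp add: subst_diff subst_mult)
        then show "act \<tau> y = x - a * act \<tau> s" by (simp add: x_def)
      qed
      have "\<exists>z\<in>R. (\<Prod>\<tau>\<in>H. x - a * act \<tau> s) = x ^ card H + a * z" if "finite H" "H \<subseteq> G" for H
        using that
      proof (induction H rule: finite_induct)
        case (insert h H)
        then obtain z where z: "z \<in> R" "(\<Prod>\<tau>\<in>H. x - a * act \<tau> s) = x ^ card H + a * z" by auto
        have "(\<Prod>\<tau>\<in>insert h H. x - a * act \<tau> s) =
          x ^ card (insert h H) + a * (x * z - act h s * (x ^ card H + a * z))"
          using insert.hyps z by (simp add: algebra_simps)
        moreover have "x * z - act h s * (x ^ card H + a * z) \<in> R"
          using z fixedD(1)[OF xA(1)] fixedD(1)[OF aA] act_in[of h s] insert.prems y(2) by auto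
        ultimately show ?case by blast
      qed auto
      then obtain z where z: "z \<in> R" "orbit_norm y = x ^ card G + a * z" using N G_finite by auto
      have nA: "orbit_norm y \<in> fixed G" by (rule orbit_norm_fixed[OF yR])
      have "act \<sigma> z = z" if s: "\<sigma> \<in> G" for \<sigma>
      proof -
        have "a * z = orbit_norm y - x ^ card G" using z by simp
        then have "act \<sigma> (a * z) = a * z"
          using fixedD(2)[OF nA s] fixedD(2)[OF xA(1) s] by (simp add: subst_diff subst_power)
        then show ?thesis using fixedD(2)[OF aA s] a0 by (simp add: subst_mult)
      qed
      then have zA: "z \<in> fixed G" using z(1) by (simp add: fixed_def)
      have "orbit_norm y \<in> Q"
        unfolding orbit_norm_def using act_in yR y(1) G_id G_finite
        by (intro polys.idl_prod_mem[OF iQ _ _ G_id]) auto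
      then have "orbit_norm y \<in> q" using Q(2) nA by blast
      then have "x ^ card G \<in> q" using A.idlD(7)[OF iq _ A.idlD(5)[OF iq zA a]] z(2) by fastforce
      then show False using A.prm_power[OF q xA(1)] xA(2) by blast
    qed
  qed
  then show ?thesis using Q by blast
qed

text \<open>Let \<open>Q\<close> lie over \<open>q\<close>. If \<open>a \<notin> q\<close>, no
  conjugate of \<open>Q\<close> contains \<open>P\<close>, so each one misses some element of
  \<open>killers I\<close>, and prime avoidance in \<open>fixed I\<close> gives one such
  \<open>t\<close> outside all conjugates. Its norm is then outside \<open>Q\<close>, yet it belongs
  to \<open>killers G\<close>.\<close>

theorem prime_over_killers:
  assumes q: "A.prm q" and kill: "killers G \<subseteq> q" and a: "a \<in> fixed G" "act r a = 0"
  shows "a \<in> q"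
proof (rule ccontr)
  assume nin: "a \<notin> q"
  obtain Q where Q: "polys.prm n Q" "q \<subseteq> Q" "Q \<inter> fixed G \<subseteq> q" using exists_prime_over[OF q] by blast
  note iQ = polys.prmD(1)[OF Q(1)]
  define conj where "conj \<tau> = {f \<in> R. act \<tau> f \<in> Q}" for \<tau>
  have conj: "polys.prm n (conj \<tau>)" if t: "\<tau> \<in> G" for \<tau>
    unfolding polys.prm_def polys.idl_def
    using polys.idlD[OF iQ] polys.prmD[OF Q(1)] act_in[OF t]
    by (auto simp: conj_def subst_add subst_mult)
  have "\<exists>t\<in>killers I. t \<notin> conj \<tau>" if t: "\<tau> \<in> G" for \<tau>
  proof (rule exists_killer_notin[OF conj[OF t]])
    have "a \<notin> conj \<tau>" using fixedD(2)[OF a(1) t] nin Q(3) a(1) by (auto simp: conj_def)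
    then show "\<not> {f \<in> R. act r f = 0} \<subseteq> conj \<tau>" using a fixedD(1)[OF a(1)] by blast
  qed
  then have avoid: "\<not> killers I \<subseteq> conj \<tau> \<inter> fixed I" if "\<tau> \<in> G" for \<tau> using that by blast
  have conjI: "RI.prm (conj \<tau> \<inter> fixed I)" if t: "\<tau> \<in> G" for \<tau>
    unfolding RI.prm_def RI.idl_def
    using polys.idlD[OF polys.prmD(1)[OF conj[OF t]]] polys.prmD[OF conj[OF t]] fixedD(1) by auto
  have "\<exists>t\<in>killers I. \<forall>q\<in>(\<lambda>\<tau>. conj \<tau> \<inter> fixed I) ` G. t \<notin> q"
    by (rule RI.prime_avoidance[OF idl_killers[OF order_refl]]) (use G_finite conjI avoid in auto)
  then obtain t where t: "t \<in> killers I" "\<And>\<tau>. \<tau> \<in> G \<Longrightarrow> t \<notin> conj \<tau> \<inter> fixed I" by auto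
  have tI: "t \<in> fixed I" using t(1) by (simp add: killers_def)
  have tR: "t \<in> R" by (rule fixedD(1)[OF tI])
  have nQ: "orbit_norm t \<notin> Q"
  proof
    assume "orbit_norm t \<in> Q"
    then obtain \<tau> where "\<tau> \<in> G" "act \<tau> t \<in> Q"
      using polys.prm_prod[OF Q(1) G_finite, of "\<lambda>\<tau>. act \<tau> t"] act_in tR
        by (auto simp: orbit_norm_def)
    then show False using t(2) tI tR by (auto simp: conj_def)
  qed
  \<comment> \<open>The cofactor of \<open>t\<close> in its norm is \<open>I\<close>-invariant,
    because the norm and \<open>t\<close> are and \<open>t \<noteq> 0\<close>; multiplying a
    splitting for \<open>t\<close> by it gives one for the norm.\<close>
  define t' where "t' = (\<Prod>\<tau>\<in>G - {id}. act \<tau> t)"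
  have Nt: "orbit_norm t = t * t'"
    unfolding orbit_norm_def t'_def using prod.remove[OF G_finite G_id, of "\<lambda>\<tau>. act \<tau> t"] by simp
  have t'R: "t' \<in> R" unfolding t'_def using act_in tR by (intro polys.prod_in) auto
  have t0: "t \<noteq> 0" using nQ Nt polys.idlD(2)[OF iQ] by auto
  have t'_inv: "act \<sigma> t' = t'" if s: "\<sigma> \<in> I" for \<sigma>
  proof -
    have "t * act \<sigma> t' = t * t'"
      using fixedD(2)[OF orbit_norm_fixed[OF tR] I_G[OF s]] fixedD(2)[OF tI s]
        by (simp add: Nt subst_mult)
    then show ?thesis using t0 by simp
  qed
  obtain u where u: "u \<in> R" "\<And>\<sigma>. \<sigma> \<in> I \<Longrightarrow> act \<sigma> u - u = t * mconst (\<phi> \<sigma>)" using t(1)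
    by (auto simp: killers_def)
  have "act \<sigma> (u * t') - u * t' = orbit_norm t * mconst (\<phi> \<sigma>)" if s: "\<sigma> \<in> I" for \<sigma>
  proof -
    have "act \<sigma> (u * t') - u * t' = (act \<sigma> u - u) * t'"
      by (simp add: subst_mult t'_inv[OF s] algebra_simps)
    then show ?thesis using u(2)[OF s] by (simp add: Nt algebra_simps)
  qed
  then have "orbit_norm t \<in> killers G"
    using orbit_norm_fixed[OF tR] u(1) t'R by (auto simp: killers_def intro!: bexI[of _ "u * t'"])
  then show False using nQ kill Q(2) by blast
qed

end


section \<open>Descent from the inertia invariants\<close>

lemma push_sum: "push h (sum f X) = (\<Sum>x\<in>X. push h (f x))"
  by (induction X rule: infinite_finite_induct) (simp_all add: push_add)

lemma weight_sum: "weight h (sum f X) = (\<Sum>x\<in>X. weight h (f x))"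
  by (induction X rule: infinite_finite_induct) (simp_all add: weight_add)

context inertia_cocycle
begin

interpretation A: unital_subring "fixed G" by (rule unital_subring_fixed)
interpretation RI: unital_subring "fixed I" by (rule unital_subring_fixed)

text \<open>The exponent of \<open>x_i\<close> is the label \<open>r i\<close>, so that exactly the
  elements of \<open>G\<close> preserving labels fix the monomial.\<close>

definition marker :: "nat \<Rightarrow>\<^sub>0 nat" where
  "marker = (\<Sum>i\<in>{1..n}. monom_at i (r i))"

definition sep :: "'k mpoly" where
  "sep = monom_at marker 1"

lemma weight_marker: "weight h marker = (\<Sum>i\<in>{1..n}. h i * r i)"
  by (simp add: marker_def weight_sum)

lemma keys_marker: "supp marker \<subseteq> {1..n}"
  unfolding marker_def by (rule order_trans[OF keys_sum]) auto

lemma sep_R: "sep \<in> R"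
  using keys_marker by (auto simp: sep_def polys_def)

lemma sep_fixed: "sep \<in> fixed I"
proof -
  have "push \<sigma> marker = marker" if s: "\<sigma> \<in> I" for \<sigma>
  proof -
    have "push \<sigma> marker = (\<Sum>i\<in>{1..n}. monom_at (\<sigma> i) (r (\<sigma> i)))"
      unfolding marker_def push_sum using s by (intro sum.cong) (auto simp: I_def)
    also have "\<dots> = marker"
      unfolding marker_def using sum.permute[OF G_perm[OF I_G[OF s]], of "\<lambda>i. monom_at i (r i)"]
      by (simp add: comp_def)
    finally show ?thesis .
  qed
  then show ?thesis using sep_R by (simp add: fixed_def sep_def subst_single)
qed

text \<open>Equality of the monomials gives \<open>\<Sum> r(\<tau> i) r(i) = \<Sum> r(i)\<^sup>2\<close>, that is
  \<open>\<Sum> (r(\<tau> i) - r(i))\<^sup>2 = 0\<close>.\<close>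

lemma stabilizer_sep_mod:
  assumes t: "\<tau> \<in> G" and eq: "act r (act \<tau> sep) = act r sep"
  shows "\<tau> \<in> I"
proof -
  have "monom_at (push (r \<circ> \<tau>) marker) (1 :: 'k) = monom_at (push r marker) 1"
    using eq by (simp add: sep_def subst_single push_push)
  then have "push (r \<circ> \<tau>) marker = push r marker"
    by (metis keys_single one_neq_zero singleton_inject)
  then have "weight id (push (r \<circ> \<tau>) marker) = weight id (push r marker)" by simp
  then have w: "(\<Sum>i\<in>{1..n}. r (\<tau> i) * r i) = (\<Sum>i\<in>{1..n}. r i * r i)"
    by (simp add: weight_push weight_marker)
  have perm: "(\<Sum>i\<in>{1..n}. r (\<tau> i) * r (\<tau> i)) = (\<Sum>i\<in>{1..n}. r i * r i)"
    using sum.permute[OF G_perm[OF t], of "\<lambda>i. r i * r i"] by (simp add: comp_def)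
  have "(\<Sum>i\<in>{1..n}. (int (r (\<tau> i)) - int (r i)) ^ 2) =
    int (\<Sum>i\<in>{1..n}. r (\<tau> i) * r (\<tau> i)) + int (\<Sum>i\<in>{1..n}. r i * r i) - 2 * int (\<Sum>i\<in>{1..n}. r (\<tau> i) * r i)"
    by (simp add: power2_diff sum.distrib sum_subtractf sum_distrib_left power2_eq_square algebra_simps)
  also have "\<dots> = 0" using w perm by simp
  finally have "\<forall>i\<in>{1..n}. (int (r (\<tau> i)) - int (r i)) ^ 2 = 0"
    by (subst (asm) sum_nonneg_eq_0_iff) auto
  then show ?thesis using t by (auto simp: I_def)
qed

lemma stabilizer_sep: "\<tau> \<in> G \<Longrightarrow> act \<tau> sep = sep \<Longrightarrow> \<tau> \<in> I"
  using stabilizer_sep_mod[of \<tau>] by simp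

lemma act_eq_of_act_sep:
  assumes "\<tau> \<in> G" "\<tau>' \<in> G" "act \<tau> sep = act \<tau>' sep" "y \<in> fixed I"
  shows "act \<tau> y = act \<tau>' y"
proof -
  have inv: "act (inv' \<tau>') (act \<tau>' f) = f" "act \<tau>' (act (inv' \<tau>') f) = f" for f
    unfolding subst_subst G_inv_comp[OF assms(2)] by simp_all
  have "act (inv' \<tau>' \<circ> \<tau>) sep = sep"
    unfolding subst_subst[symmetric] assms(3) by (rule inv)
  then have "inv' \<tau>' \<circ> \<tau> \<in> I" using stabilizer_sep G_comp G_inv assms by blast
  then have "act (inv' \<tau>') (act \<tau> y) = y" unfolding subst_subst using fixedD(2)[OF assms(4)]
    by blast
  then show ?thesis using inv(2)[of "act \<tau> y"] by simp
qed

text \<open>The conjugates of \<open>sep\<close> stand for the cosets of \<open>I\<close> in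
  \<open>G\<close>; on \<open>fixed I\<close> the sum \<open>tr\<close> below is the relative trace
  to \<open>fixed G\<close>.\<close>

definition orb :: "'k mpoly set" where "orb = (\<lambda>\<tau>. act \<tau> sep) ` G"

definition rep :: "'k mpoly \<Rightarrow> nat \<Rightarrow> nat" where "rep z = (SOME \<tau>. \<tau> \<in> G \<and> act \<tau> sep = z)"

lemma rep: "z \<in> orb \<Longrightarrow> rep z \<in> G" "z \<in> orb \<Longrightarrow> act (rep z) sep = z"
  unfolding rep_def using someI_ex[of "\<lambda>\<tau>. \<tau> \<in> G \<and> act \<tau> sep = z"] by (auto simp: orb_def)

lemma finite_orb: "finite orb"
  by (simp add: orb_def G_finite)

lemma sep_orb: "sep \<in> orb"
  unfolding orb_def using G_id by (rule rev_image_eqI) simp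

lemma act_orb: "\<sigma> \<in> G \<Longrightarrow> z \<in> orb \<Longrightarrow> act \<sigma> z \<in> orb"
  using G_comp by (auto simp: orb_def subst_subst)

lemma act_inverse: "\<sigma> \<in> G \<Longrightarrow> act (inv' \<sigma>) (act \<sigma> f) = f" "\<sigma> \<in> G \<Longrightarrow> act \<sigma> (act (inv' \<sigma>) f) = f"
  unfolding subst_subst using G_inv_comp[of \<sigma>] by simp_all

definition tr :: "'k mpoly \<Rightarrow> 'k mpoly" where "tr y = (\<Sum>z\<in>orb. act (rep z) y)"

lemma tr_fixed: assumes y: "y \<in> fixed I" shows "tr y \<in> fixed G"
proof -
  have "act \<sigma> (tr y) = tr y" if s: "\<sigma> \<in> G" for \<sigma>
  proof -
    have "act \<sigma> (tr y) = (\<Sum>z\<in>orb. act (rep (act \<sigma> z)) y)"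
      unfolding tr_def subst_sum
    proof (rule sum.cong[OF refl])
      fix z assume z: "z \<in> orb"
      have "act (\<sigma> \<circ> rep z) sep = act (rep (act \<sigma> z)) sep"
        using rep(2)[OF z] rep(2)[OF act_orb[OF s z]] by (simp add: subst_subst[symmetric])
      then have "act (\<sigma> \<circ> rep z) y = act (rep (act \<sigma> z)) y"
        by (intro act_eq_of_act_sep[OF G_comp[OF s rep(1)[OF z]] rep(1)[OF act_orb[OF s z]] _ y])
      then show "act \<sigma> (act (rep z) y) = act (rep (act \<sigma> z)) y" by (simp add: subst_subst)
    qed
    also have "\<dots> = tr y" unfolding tr_def
      by (rule sum.reindex_bij_witness[where i = "act (inv' \<sigma>)" and j = "act \<sigma>"])
        (use act_inverse[OF s] act_orb s G_inv in auto)
    finally show ?thesis .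
  qed
  moreover have "tr y \<in> R" unfolding tr_def using rep(1) fixedD(1)[OF y]
    by (intro polys.sum_in act_in)
  ultimately show ?thesis by (simp add: fixed_def)
qed

lemma tr_add: "tr (y + y') = tr y + tr y'"
  by (simp add: tr_def subst_add sum.distrib)

lemma tr_mult: "a \<in> fixed G \<Longrightarrow> tr (a * y) = a * tr y"
  unfolding tr_def sum_distrib_left using rep(1) fixedD(2)
    by (intro sum.cong) (auto simp: subst_mult)

text \<open>The minimal polynomial of \<open>sep\<close> over the invariants, without the factor
  belonging to \<open>sep\<close> itself.\<close>

definition sep_poly :: "'k mpoly poly" where "sep_poly = (\<Prod>z\<in>orb - {sep}. [:- z, 1:])"

lemma coeff_sep_poly: "coeff sep_poly j \<in> fixed I"
proof -
  have "map_poly (act \<sigma>) sep_poly = sep_poly" if s: "\<sigma> \<in> I" for \<sigma>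
  proof -
    have "map_poly (act \<sigma>) sep_poly = (\<Prod>z\<in>orb - {sep}. [:- act \<sigma> z, 1:])"
      unfolding sep_poly_def by (rule map_poly_root_product[OF ring_endo_subst])
    also have "\<dots> = sep_poly" unfolding sep_poly_def
    proof (rule prod.reindex_bij_witness[where i = "act (inv' \<sigma>)" and j = "act \<sigma>"])
      note i = act_inverse[OF I_G[OF s]]
      fix z assume z: "z \<in> orb - {sep}"
      show "act (inv' \<sigma>) (act \<sigma> z) = z" "act \<sigma> (act (inv' \<sigma>) z) = z" using i by auto
      show "act \<sigma> z \<in> orb - {sep}"
        using z act_orb[OF I_G[OF s]] i(1)[of z] i(1)[of sep] fixedD(2)[OF sep_fixed s] by auto
      show "act (inv' \<sigma>) z \<in> orb - {sep}"
        using z act_orb[OF I_G[OF I_inv[OF s]]] i(2)[of z] fixedD(2)[OF sep_fixed s] by auto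
    qed simp
    finally show ?thesis .
  qed
  then have "act \<sigma> (coeff sep_poly j) = coeff sep_poly j" if "\<sigma> \<in> I" for \<sigma>
    using arg_cong[of _ _ "\<lambda>p. coeff p j"] that by (metis coeff_map_poly subst_zero)
  moreover have "sep_poly \<in> polys.over R"
    unfolding sep_poly_def
  proof (rule unital_subring.prod_in[OF polys.unital_subring_over])
    fix z assume "z \<in> orb - {sep}"
    then have "z \<in> R" using act_in sep_R by (auto simp: orb_def)
    then show "[:- z, 1:] \<in> polys.over R"
      by (auto simp: polys.over_def coeff_pCons split: nat.split)
  qed
  ultimately show ?thesis by (simp add: fixed_def polys.over_def)
qed

text \<open>The derivative of that minimal polynomial at \<open>sep\<close>; its being nonzero
  modulo \<open>P\<close> expresses that \<open>fixed I\<close> is unramified over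
  \<open>fixed G\<close> at \<open>P\<close>.\<close>

definition sep_val :: "'k mpoly" where "sep_val = poly sep_poly sep"

lemma sep_val_fixed: "sep_val \<in> fixed I"
  unfolding sep_val_def poly_altdef using coeff_sep_poly sep_fixed by (intro RI.sum_in) auto

lemma sep_val_mod: "act r sep_val \<noteq> 0"
proof
  assume "act r sep_val = 0"
  moreover have "sep_val = (\<Prod>z\<in>orb - {sep}. sep - z)" unfolding sep_val_def sep_poly_def
    by (simp add: poly_prod)
  ultimately have "(\<Prod>z\<in>orb - {sep}. act r sep - act r z) = 0" by (simp add: subst_prod subst_diff)
  then obtain z where z: "z \<in> orb" "z \<noteq> sep" "act r sep = act r z" using finite_orb by auto
  then obtain \<tau> where t: "\<tau> \<in> G" "z = act \<tau> sep" by (auto simp: orb_def)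
  then have "\<tau> \<in> I" using stabilizer_sep_mod z by simp
  then show False using fixedD(2)[OF sep_fixed] t z by simp
qed

text \<open>Lagrange interpolation: \<open>sep_poly\<close> vanishes at every conjugate of \<open>sep\<close> except \<open>sep\<close> itself.\<close>

lemma trace_formula:
  assumes y: "y \<in> fixed I"
  shows "(\<Sum>j\<le>degree sep_poly. coeff sep_poly j * tr (sep ^ j * y)) = sep_val * y"
proof -
  have "(\<Sum>j\<le>degree sep_poly. coeff sep_poly j * tr (sep ^ j * y)) =
    (\<Sum>j\<le>degree sep_poly. \<Sum>z\<in>orb. coeff sep_poly j * z ^ j * act (rep z) y)"
    unfolding tr_def sum_distrib_left using rep(2)
    by (intro sum.cong) (auto simp: subst_mult subst_power mult.assoc)
  also have "\<dots> = (\<Sum>z\<in>orb. poly sep_poly z * act (rep z) y)"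
    unfolding poly_altdef sum_distrib_right by (rule sum.swap)
  also have "\<dots> = (\<Sum>z\<in>{sep}. poly sep_poly z * act (rep z) y)"
  proof (rule sum.mono_neutral_right[OF finite_orb])
    show "\<forall>z\<in>orb - {sep}. poly sep_poly z * act (rep z) y = 0"
    proof
      fix z assume z: "z \<in> orb - {sep}"
      have "poly sep_poly z = (\<Prod>w\<in>orb - {sep}. z - w)" unfolding sep_poly_def
        by (simp add: poly_prod)
      also have "\<dots> = 0" using z finite_orb by (intro prod_zero) auto
      finally show "poly sep_poly z * act (rep z) y = 0" by simp
    qed
  qed (use sep_orb in auto)
  also have "\<dots> = sep_val * y"
    using stabilizer_sep[OF rep[OF sep_orb]] fixedD(2)[OF y] by (simp add: sep_val_def)
  finally show ?thesis .
qed

text \<open>The trace of \<open>sep ^ j\<close> times the given relation is a relation over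
  \<open>fixed G\<close>, where \<open>reg\<close> applies. Interpolation recombines the traces into
  \<open>sep_val * v3\<close>; with \<open>W\<close> the product of the finitely many multipliers
  \<open>w j\<close>, the factor obtained is \<open>W * sep_val\<close>, which is nonzero modulo
  \<open>P\<close>.\<close>

lemma descent:
  assumes M: "A.prm M" and M_mod: "\<And>w. w \<in> fixed G - M \<Longrightarrow> act r w \<noteq> 0"
    and a: "a1 \<in> fixed G" "a2 \<in> fixed G" "a3 \<in> fixed G"
    and reg: "\<And>z y1 y2. z \<in> fixed G \<Longrightarrow> y1 \<in> fixed G \<Longrightarrow> y2 \<in> fixed G \<Longrightarrow> a3 * z = a1 * y1 + a2 * y2 \<Longrightarrow>
      \<exists>w\<in>fixed G - M. \<exists>b1\<in>fixed G. \<exists>b2\<in>fixed G. w * z = a1 * b1 + a2 * b2"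
    and v: "v1 \<in> fixed I" "v2 \<in> fixed I" "v3 \<in> fixed I" "a3 * v3 = a1 * v1 + a2 * v2"
  shows "\<exists>w\<in>fixed I. act r w \<noteq> 0 \<and> (\<exists>b1\<in>fixed I. \<exists>b2\<in>fixed I. w * v3 = a1 * b1 + a2 * b2)"
proof -
  have AI: "fixed G \<subseteq> fixed I" using I_G by (intro fixed_mono) blast
  have "\<exists>w b1 b2. w \<in> fixed G - M \<and> b1 \<in> fixed G \<and> b2 \<in> fixed G \<and> w * tr (sep ^ j * v3) =
    a1 * b1 + a2 * b2" for j
  proof -
    have in_I: "sep ^ j * v1 \<in> fixed I" "sep ^ j * v2 \<in> fixed I" "sep ^ j * v3 \<in> fixed I"
      using sep_fixed v by auto
    have "a3 * tr (sep ^ j * v3) = tr (sep ^ j * (a3 * v3))" using tr_mult[OF a(3)]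
      by (simp add: mult.left_commute)
    also have "\<dots> = tr (a1 * (sep ^ j * v1) + a2 * (sep ^ j * v2))" unfolding v(4)
      by (simp add: algebra_simps)
    also have "\<dots> = a1 * tr (sep ^ j * v1) + a2 * tr (sep ^ j * v2)" using tr_mult a
      by (simp add: tr_add)
    finally show ?thesis using reg[OF tr_fixed[OF in_I(3)] tr_fixed[OF in_I(1)] tr_fixed[OF in_I(2)]] by blast
  qed
  then obtain w b1 b2 where w: "\<And>j. w j \<in> fixed G - M" and b: "\<And>j. b1 j \<in> fixed G"
    "\<And>j. b2 j \<in> fixed G"
    and eq: "\<And>j. w j * tr (sep ^ j * v3) = a1 * b1 j + a2 * b2 j" by metis
  define J where "J = {..degree sep_poly}"
  define W where "W = prod w J"
  define W' where "W' j = prod w (J - {j})" for j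
  have W': "W = W' j * w j" if "j \<in> J" for j
    unfolding W_def W'_def using prod.remove[of J j w] that by (simp add: J_def mult.commute)
  have wG: "w j \<in> fixed G" for j using w[of j] by blast
  have WG: "W \<in> fixed G" "W' j \<in> fixed G" for j unfolding W_def W'_def by (intro A.prod_in wG)+
  have "W \<notin> M" using A.prm_prod[OF M, of J w] wG w by (auto simp: W_def J_def)
  then have Wr: "act r W \<noteq> 0" using M_mod WG by blast
  have "(W * sep_val) * v3 = (\<Sum>j\<in>J. coeff sep_poly j * (W * tr (sep ^ j * v3)))"
    unfolding mult.assoc trace_formula[OF v(3), symmetric] sum_distrib_left J_def
    by (simp add: mult.left_commute)
  also have "\<dots> = (\<Sum>j\<in>J. coeff sep_poly j * W' j * (w j * tr (sep ^ j * v3)))"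
    using W' by (intro sum.cong) (auto simp: mult_ac)
  also have "\<dots> = a1 * (\<Sum>j\<in>J. coeff sep_poly j * W' j * b1 j) + a2 * (\<Sum>j\<in>J. coeff sep_poly j * W' j * b2 j)"
    unfolding eq sum_distrib_left sum.distrib[symmetric]
      by (intro sum.cong) (auto simp: algebra_simps)
  finally have e: "(W * sep_val) * v3 =
    a1 * (\<Sum>j\<in>J. coeff sep_poly j * W' j * b1 j) + a2 * (\<Sum>j\<in>J. coeff sep_poly j * W' j * b2 j)" .
  have "act r (W * sep_val) \<noteq> 0" using Wr sep_val_mod by (simp add: subst_mult)
  moreover have "W * sep_val \<in> fixed I" using WG AI sep_val_fixed by blast
  moreover have "(\<Sum>j\<in>J. coeff sep_poly j * W' j * b j) \<in> fixed I" if "\<And>j. b j \<in> fixed G" for b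
    using WG(2) that AI coeff_sep_poly by (intro RI.sum_in RI.mult_in) auto
  ultimately show ?thesis using e b by blast
qed

theorem no_regular_triple:
  assumes M: "A.prm M" and M_mod: "\<And>w. w \<in> fixed G - M \<Longrightarrow> act r w \<noteq> 0"
    and a: "a1 \<in> killers G" "a2 \<in> killers G" "a3 \<in> killers G" and canc: "cancels n a2 a1"
    and reg: "\<And>z y1 y2. z \<in> fixed G \<Longrightarrow> y1 \<in> fixed G \<Longrightarrow> y2 \<in> fixed G \<Longrightarrow> a3 * z = a1 * y1 + a2 * y2 \<Longrightarrow>
      \<exists>w\<in>fixed G - M. \<exists>b1\<in>fixed G. \<exists>b2\<in>fixed G. w * z = a1 * b1 + a2 * b2"
  shows False
proof -
  have aG: "a1 \<in> fixed G" "a2 \<in> fixed G" "a3 \<in> fixed G" using a by (auto simp: killers_def)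
  obtain u1 where u1: "u1 \<in> R" "\<And>\<sigma>. \<sigma> \<in> I \<Longrightarrow> act \<sigma> u1 - u1 = a1 * mconst (\<phi> \<sigma>)" using a(1)
    by (auto simp: killers_def)
  obtain u2 where u2: "u2 \<in> R" "\<And>\<sigma>. \<sigma> \<in> I \<Longrightarrow> act \<sigma> u2 - u2 = a2 * mconst (\<phi> \<sigma>)" using a(2)
    by (auto simp: killers_def)
  obtain u3 where u3: "u3 \<in> R" "\<And>\<sigma>. \<sigma> \<in> I \<Longrightarrow> act \<sigma> u3 - u3 = a3 * mconst (\<phi> \<sigma>)" using a(3)
    by (auto simp: killers_def)
  have inv: "b * v - c * u \<in> fixed I"
    if "b \<in> fixed G" "c \<in> fixed G" "u \<in> R" "v \<in> R" "\<And>\<sigma>. \<sigma> \<in> I \<Longrightarrow> act \<sigma> u - u = b * mconst (\<phi> \<sigma>)"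
      "\<And>\<sigma>. \<sigma> \<in> I \<Longrightarrow> act \<sigma> v - v = c * mconst (\<phi> \<sigma>)" for b c u v
  proof -
    have "act \<sigma> (b * v - c * u) = b * v - c * u" if s: "\<sigma> \<in> I" for \<sigma>
    proof -
      have "act \<sigma> u = u + b * mconst (\<phi> \<sigma>)" "act \<sigma> v = v + c * mconst (\<phi> \<sigma>)"
        using that(1) \<open>\<And>\<sigma>. \<sigma> \<in> I \<Longrightarrow> act \<sigma> u - u = b * mconst (\<phi> \<sigma>)\<close>[OF s]
          \<open>\<And>\<sigma>. \<sigma> \<in> I \<Longrightarrow> act \<sigma> v - v = c * mconst (\<phi> \<sigma>)\<close>[OF s] by (simp_all add: algebra_simps)
      then show ?thesis
        using fixedD(2)[OF \<open>b \<in> fixed G\<close> I_G[OF s]] fixedD(2)[OF \<open>c \<in> fixed G\<close> I_G[OF s]]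
        by (simp add: subst_diff subst_mult algebra_simps)
    qed
    moreover have "b * v - c * u \<in> R"
      by (intro polys.diff_in polys.mult_in fixedD(1)[OF that(1)] fixedD(1)[OF that(2)] that(3,4))
    ultimately show ?thesis by (simp add: fixed_def)
  qed
  have "\<exists>w\<in>fixed I. act r w \<noteq> 0 \<and> (\<exists>b1\<in>fixed I. \<exists>b2\<in>fixed I. w * (a1 * u2 - a2 * u1) =
    a1 * b1 + a2 * b2)"
  proof (rule descent[OF M M_mod aG reg])
    show "a3 * (a1 * u2 - a2 * u1) = a1 * (a3 * u2 - a2 * u3) + a2 * (a1 * u3 - a3 * u1)"
      by (simp add: algebra_simps)
    show "a1 * u2 - a2 * u1 \<in> fixed I" "a3 * u2 - a2 * u3 \<in> fixed I" "a1 * u3 - a3 * u1 \<in> fixed I"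
      using aG u1 u2 u3 by (auto intro!: inv)
  qed
  then obtain w b1 b2 where w: "w \<in> fixed I" "act r w \<noteq> 0" "b1 \<in> fixed I" "b2 \<in> fixed I"
    "w * (a1 * u2 - a2 * u1) = a1 * b1 + a2 * b2" by blast
  \<comment> \<open>Terms with \<open>a1\<close> and terms with \<open>a2\<close> are separated, so
    that coprimality makes \<open>w * u1 + b2\<close> divisible by \<open>a1\<close>.\<close>
  have "a1 * (w * u2 - b1) = a2 * (w * u1 + b2)" using w(5) by (simp add: algebra_simps)
  moreover have "w * u1 + b2 \<in> R" using w u1(1) fixedD(1) by blast
  ultimately obtain c where c: "c \<in> R" "w * u1 + b2 = a1 * c" using canc unfolding cancels_def
    by blast
  have a10: "a1 \<noteq> 0" using canc by (simp add: cancels_def)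
  \<comment> \<open>Here \<open>\<sigma>0\<close> moves only \<open>u1\<close>, by \<open>a1\<close>
    times a constant. After cancelling \<open>a1\<close> the left side vanishes under
    \<open>r\<close>, but the right side is \<open>w\<close> times a nonzero constant.\<close>
  have "a1 * (act \<sigma>0 c - c) = act \<sigma>0 (w * u1 + b2) - (w * u1 + b2)"
    using fixedD(2)[OF aG(1) I_G[OF s0(1)]] c by (simp add: subst_mult right_diff_distrib)
  also have "\<dots> = w * (act \<sigma>0 u1 - u1)"
    using fixedD(2)[OF w(1) s0(1)] fixedD(2)[OF w(4) s0(1)]
      by (simp add: subst_mult subst_add right_diff_distrib)
  also have "\<dots> = a1 * (w * mconst (\<phi> \<sigma>0))" using u1(2)[OF s0(1)] by simp
  finally have "act \<sigma>0 c - c = w * mconst (\<phi> \<sigma>0)" using a10 by simp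
  then have "act r (w * mconst (\<phi> \<sigma>0)) = 0" using r_act[OF s0(1) c(1)]
    by (simp flip: \<open>act \<sigma>0 c - c = _\<close> add: subst_diff)
  then have "act r w * mconst (\<phi> \<sigma>0) = 0" by (simp add: subst_mult)
  then show False using w(2) s0(2) by simp
qed

text \<open>\<open>I\<close> acts trivially modulo \<open>P\<close>, so coboundaries vanish there,
  while \<open>\<phi> \<sigma>0\<close> is a unit.\<close>

lemma killers_mod: assumes "a \<in> killers G" shows "act r a = 0"
proof -
  obtain u where u: "u \<in> R" "\<And>\<sigma>. \<sigma> \<in> I \<Longrightarrow> act \<sigma> u - u = a * mconst (\<phi> \<sigma>)" using assms
    by (auto simp: killers_def)
  have "act r (a * mconst (\<phi> \<sigma>0)) = act r (act \<sigma>0 u - u)" using u(2)[OF s0(1)] by simp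
  also have "\<dots> = 0" using r_act[OF s0(1) u(1)] by (simp add: subst_diff)
  finally show ?thesis using s0(2) by (simp add: subst_mult)
qed

end

section \<open>Failure of Cohen-Macaulayness\<close>

text \<open>Substitutes 0 for the variables in \<open>V\<close>. Dropped terms stay in the sum with
  coefficient 0, which makes additivity a sum over \<open>supp f\<close>.\<close>

definition kill_vars :: "nat set \<Rightarrow> 'k::field mpoly \<Rightarrow> 'k mpoly" where
  "kill_vars V f = (\<Sum>m\<in>supp f. monom_at m (if supp m \<inter> V = {} then coeff_of f m else 0))"

lemma kill_vars_add: "kill_vars V (f + g) = kill_vars V f + kill_vars V g"
  unfolding kill_vars_def by (rule setsum_keys_plus_distrib) (simp_all add: single_add)

lemma kill_vars_single:
  "kill_vars V (monom_at m c) = (if supp m \<inter> V = {} then monom_at m c else 0)"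
  by (simp add: kill_vars_def)

lemma kill_vars_mult: "kill_vars V (f * g) = kill_vars V f * kill_vars V g"
proof (induction f rule: mpoly_induct)
  case (single m c)
  show ?case
    by (induction g rule: mpoly_induct)
      (auto simp: mult_single kill_vars_single keys_add_nat kill_vars_add distrib_left Int_Un_distrib2)
qed (simp add: kill_vars_add distrib_right)

lemma ring_endo_kill_vars: "ring_endo (kill_vars V)"
  using kill_vars_single[of V 0 1] by (simp add: ring_endo_def kill_vars_add kill_vars_mult)

lemma coeff_kill_vars_zero: "coeff_of (kill_vars V f) 0 = coeff_of f 0"
  by (induction f rule: mpoly_induct) (auto simp: kill_vars_single kill_vars_add lookup_add lookup_single when_def)

lemma (in unital_subring) prm_kernel:
  fixes s :: "'a \<Rightarrow> 'b::idom"
  assumes "s 1 = 1" "\<And>a b. s (a + b) = s a + s b" "\<And>a b. s (a * b) = s a * s b"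
  shows "prm {a \<in> S. s a = 0}"
proof -
  have "s 0 + 0 = s 0 + s 0" using assms(2)[of 0 0] by simp
  then have "s 0 = 0" unfolding add_left_cancel by simp
  then show ?thesis using assms by (auto simp: prm_def idl_def)
qed

definition elem_sym :: "nat \<Rightarrow> nat \<Rightarrow> 'k::field mpoly" where
  "elem_sym n k = (\<Sum>B | B \<subseteq> {1..n} \<and> card B = k. monom_at (\<Sum>i\<in>B. monom_at i 1) 1)"

lemma keys_indicator: "finite (B :: nat set) \<Longrightarrow> supp (\<Sum>i\<in>B. monom_at i (1::nat)) = B"
  by (induction B rule: finite_induct) (auto simp: keys_add_nat)

lemmas keys_indicator' = keys_indicator[unfolded One_nat_def]

lemma subst_elem_sym:
  assumes "\<sigma> permutes {1..n}"
  shows "subst \<sigma> (elem_sym n k) = (elem_sym n k :: 'k::field mpoly)"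
proof -
  let ?m = "\<lambda>B. monom_at (\<Sum>i\<in>B. monom_at i (1::nat)) (1::'k)"
  have inj: "inj \<sigma>" using permutes_inj assms by blast
  have img: "(`) \<sigma> ` {B. B \<subseteq> {1..n} \<and> card B = k} = {B. B \<subseteq> {1..n} \<and> card B = k}"
  proof -
    have sub: "(`) \<tau> ` {B. B \<subseteq> {1..n} \<and> card B = k} \<subseteq> {B. B \<subseteq> {1..n} \<and> card B = k}"
      if t: "\<tau> permutes {1..n}" for \<tau>
    proof (rule image_subsetI)
      fix B assume B: "B \<in> {B. B \<subseteq> {1..n} \<and> card B = k}"
      then have "\<tau> ` B \<subseteq> {1..n}" using permutes_image[OF t] by blast
      then show "\<tau> ` B \<in> {B. B \<subseteq> {1..n} \<and> card B = k}"
        using B card_image[OF permutes_inj_on[OF t]] by blast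
    qed
    have "B \<in> (`) \<sigma> ` {B. B \<subseteq> {1..n} \<and> card B = k}" if "B \<subseteq> {1..n} \<and> card B = k" for B
    proof
      show "B = \<sigma> ` (inv' \<sigma> ` B)" using permutes_surj[OF assms] by (simp add: image_f_inv_f)
      show "inv' \<sigma> ` B \<in> {B. B \<subseteq> {1..n} \<and> card B = k}" using sub[OF permutes_inv[OF assms]] that
        by blast
    qed
    then show ?thesis using sub[OF assms] by blast
  qed
  have "subst \<sigma> (elem_sym n k) = (\<Sum>B | B \<subseteq> {1..n} \<and> card B = k. ?m (\<sigma> ` B))"
    unfolding elem_sym_def subst_sum
  proof (rule sum.cong[OF refl])
    fix B assume "B \<in> {B. B \<subseteq> {1..n} \<and> card B = k}"
    have "push \<sigma> (\<Sum>i\<in>B. monom_at i (1::nat)) = (\<Sum>i\<in>\<sigma> ` B. monom_at i 1)"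
      unfolding push_sum using inj by (subst sum.reindex) (auto intro: inj_on_subset)
    then show "subst \<sigma> (?m B) = ?m (\<sigma> ` B)" by (simp only: subst_single)
  qed
  also have "\<dots> = (\<Sum>B\<in>(`) \<sigma> ` {B. B \<subseteq> {1..n} \<and> card B = k}. ?m B)"
    by (subst sum.reindex) (auto simp: inj_on_def inj_image_eq_iff[OF inj])
  finally show ?thesis unfolding img elem_sym_def .
qed

lemma elem_sym_in_polys: "elem_sym n k \<in> polys n"
  unfolding elem_sym_def
proof (rule polys.sum_in)
  fix B assume "B \<in> {B. B \<subseteq> {1..n} \<and> card B = k}"
  then have "finite B" "B \<subseteq> {1..n}" using finite_subset by auto
  then show "monom_at (\<Sum>i\<in>B. monom_at i 1) 1 \<in> polys n"
    by (auto simp: polys_def keys_indicator')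
qed

text \<open>A set of \<open>n - i\<close> indices missing \<open>1..i\<close> must be
  \<open>{Suc i..n}\<close>, and none misses \<open>1..Suc i\<close>. So this polynomial, invariant
  under all permutations, shows that the primes of invariants vanishing when initial variables are
  set to 0 increase strictly.\<close>

lemma kill_vars_elem_sym:
  assumes "i < n"
  shows "kill_vars {1..Suc i} (elem_sym n (n - i) :: 'k::field mpoly) = 0"
    and "kill_vars {1..i} (elem_sym n (n - i) :: 'k::field mpoly) \<noteq> 0"
proof -
  let ?m = "\<lambda>B. monom_at (\<Sum>i\<in>B. monom_at i (1::nat)) (1::'k)"
  let ?X = "{B. B \<subseteq> {1..n} \<and> card B = n - i}"
  have kill: "kill_vars V (elem_sym n (n - i) :: 'k mpoly) = (\<Sum>B\<in>?X. if B \<inter> V =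
    {} then ?m B else 0)" for V
    unfolding elem_sym_def ring_endo_sum[OF ring_endo_kill_vars]
  proof (rule sum.cong[OF refl])
    fix B assume "B \<in> ?X"
    then have "finite B" using finite_subset by auto
    then show "kill_vars V (?m B) = (if B \<inter> V = {} then ?m B else 0)"
      by (simp add: kill_vars_single keys_indicator')
  qed
  have disj: "B \<subseteq> {Suc j..n}" if "B \<subseteq> {1..n}" "B \<inter> {1..j} = {}" for B j
  proof
    fix b assume "b \<in> B"
    then have "b \<in> {1..n}" "b \<notin> {1..j}" using that by blast+
    then show "b \<in> {Suc j..n}" by auto
  qed
  show "kill_vars {1..Suc i} (elem_sym n (n - i) :: 'k mpoly) = 0"
    unfolding kill
  proof (rule sum.neutral, rule ballI)
    fix B assume B: "B \<in> ?X"
    have "B \<inter> {1..Suc i} \<noteq> {}"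
    proof
      assume "B \<inter> {1..Suc i} = {}"
      then have "card B \<le> card {Suc (Suc i)..n}" using disj[of B "Suc i"] B
        by (intro card_mono) auto
      then show False using B assms by simp
    qed
    then show "(if B \<inter> {1..Suc i} = {} then ?m B else 0) = 0" by simp
  qed
  have iff: "B \<inter> {1..i} = {} \<longleftrightarrow> B = {Suc i..n}" if B: "B \<in> ?X" for B
  proof
    assume "B \<inter> {1..i} = {}"
    then show "B = {Suc i..n}" using disj[of B i] B assms by (intro card_subset_eq) auto
  qed auto
  have "kill_vars {1..i} (elem_sym n (n - i) :: 'k mpoly) = (\<Sum>B\<in>?X. if B =
    {Suc i..n} then ?m B else 0)"
    unfolding kill by (intro sum.cong refl) (simp only: iff)
  also have "\<dots> = ?m {Suc i..n}" using assms by simp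
  also have "\<dots> \<noteq> 0" by (metis lookup_single_eq lookup_zero one_neq_zero)
  finally show "kill_vars {1..i} (elem_sym n (n - i) :: 'k mpoly) \<noteq> 0" .
qed

lemma coeff_quadratic: "coeff_of (mvar b * mvar c :: 'k::field mpoly) (monom_at a 1) = 0"
proof -
  have "monom_at b (1::nat) + monom_at c 1 \<noteq> monom_at a 1"
  proof
    assume "monom_at b (1::nat) + monom_at c 1 = monom_at a 1"
    from arg_cong[OF this, of "weight (\<lambda>_. 1)"] show False by (simp add: weight_add)
  qed
  then show ?thesis by (simp add: mvar_def mult_single lookup_single)
qed

text \<open>The two summands have degrees 1 and 2 and cannot cancel; the coefficient of
  \<open>x_a\<close> detects the linear one.\<close>

lemma linear_plus_square_nonzero:
  assumes "(mvar a - mvar a') + (mvar b - mvar b') ^ 2 = (0 :: 'k::field mpoly)"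
  shows "a = a' \<and> b = b'"
proof -
  have "(mvar b - mvar b') ^ 2 =
    mvar b * mvar b - mvar b * mvar b' - mvar b' * mvar b + mvar b' * (mvar b' :: 'k mpoly)"
    by (simp add: power2_eq_square algebra_simps)
  then have "coeff_of ((mvar b - mvar b' :: 'k mpoly) ^ 2) (monom_at a 1) = 0"
    by (simp only: lookup_add lookup_minus coeff_quadratic) simp
  then have "coeff_of (mvar a - mvar a' :: 'k mpoly) (monom_at a 1) = 0"
    using arg_cong[OF assms, of "\<lambda>f. coeff_of f (monom_at a 1)"] by (simp add: lookup_add)
  then have "monom_at a' (1::nat) = monom_at a 1"
    by (auto simp: mvar_def lookup_minus lookup_single when_def split: if_splits)
  then have aa: "a = a'" by (metis keys_single one_neq_zero singleton_inject)
  then have "mvar b = (mvar b' :: 'k mpoly)" using assms by simp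
  then show ?thesis using aa mvar_inj by blast
qed

context inertia_cocycle
begin

interpretation A: unital_subring "fixed G" by (rule unital_subring_fixed)

lemma invariant_ring_eq: "invariant_ring n G = set_ring (fixed G)"
proof -
  have "perm_poly \<sigma> f = act \<sigma> f" if "\<sigma> \<in> G" for \<sigma> f
    using perm_poly_eq_subst permutes_bij[OF G_perm[OF that]] by blast
  then show ?thesis by (auto simp: invariant_ring_def poly_ring_def set_ring_def fixed_def polys_def)
qed

definition M0 :: "'k mpoly set" where "M0 = {a \<in> fixed G. coeff_of a 0 = 0}"

lemma coeff_one_zero: "coeff_of (1 :: 'k mpoly) 0 = 1"
  by (simp add: lookup_one)

lemma prm_M0: "A.prm M0"
  unfolding M0_def by (rule A.prm_kernel) (simp_all add: coeff_one_zero lookup_add coeff_mult_zero)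

text \<open>An invariant outside \<open>M0\<close> differs from a nonzero constant by an element of
  \<open>M0\<close>, so together they generate the unit ideal.\<close>

lemma maximalideal_M0: "maximalideal M0 (set_ring (fixed G))"
proof (rule maximalidealI)
  show "ideal M0 (set_ring (fixed G))" using A.ideal_set_ring_iff A.prmD(1)[OF prm_M0] by simp
  show "carrier (set_ring (fixed G)) \<noteq> M0" using A.prmD(2)[OF prm_M0] A.one_in
    by (auto simp: set_ring_def)
  fix J assume "ideal J (set_ring (fixed G))" and MJ: "M0 \<subseteq> J" "J \<subseteq> carrier (set_ring (fixed G))"
  then have J: "A.idl J" using A.ideal_set_ring_iff by blast
  show "J = M0 \<or> J = carrier (set_ring (fixed G))"
  proof (rule disjCI)
    assume "J \<noteq> carrier (set_ring (fixed G))"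
    then have ne: "J \<noteq> fixed G" by (simp add: set_ring_def)
    have "a \<in> M0" if a: "a \<in> J" for a
    proof (rule ccontr)
      assume nin: "a \<notin> M0"
      have aA: "a \<in> fixed G" using A.idlD(1)[OF J a] .
      define c where "c = coeff_of a 0"
      have c: "c \<noteq> 0" using nin aA by (simp add: M0_def c_def)
      have "a - mconst c \<in> M0" using aA mconst_fixed by (auto simp: M0_def c_def lookup_minus)
      then have "mconst c \<in> J" using A.idlD(7)[OF J a, of "a - mconst c"] MJ by auto
      then have "mconst (inverse c) * mconst c \<in> J" using A.idlD(4)[OF J mconst_fixed] by blast
      then have "1 \<in> J" using c by (simp flip: mconst_mult)
      then have "fixed G \<subseteq> J" using A.idlD(5)[OF J, of _ 1] by auto
      then show False using ne A.idlD(1)[OF J] by blast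
    qed
    then show "J = M0" using MJ by blast
  qed
qed

text \<open>The product runs over ordered pairs, which makes it invariant under all permutations and
  not only up to sign.\<close>

definition discriminant :: "'k mpoly" where
  "discriminant = (\<Prod>(i, j)\<in>{(i, j). i \<in> {1..n} \<and> j \<in> {1..n} \<and> i \<noteq> j}. mvar i - mvar j)"

lemma finite_pairs: "finite {(i, j). i \<in> {1..n} \<and> j \<in> {1..n} \<and> i \<noteq> j}"
  by (rule finite_subset[of _ "{1..n} \<times> {1..n}"]) auto

lemma discriminant_fixed: "discriminant \<in> fixed G"
proof -
  let ?X = "{(i, j). i \<in> {1..n} \<and> j \<in> {1..n} \<and> i \<noteq> j}"
  have "act \<sigma> discriminant = discriminant" if s: "\<sigma> \<in> G" for \<sigma>
  proof -
    have inj: "\<sigma> i = \<sigma> j \<longleftrightarrow> i = j" for i j using permutes_inj[OF G_perm[OF s]]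
      by (auto simp: inj_def)
    have inv: "inv' \<sigma> (\<sigma> i) = i" "\<sigma> (inv' \<sigma> i) = i" for i
      using permutes_inverses[OF G_perm[OF s]] by auto
    have "act \<sigma> discriminant = (\<Prod>(i, j)\<in>?X. mvar (\<sigma> i) - mvar (\<sigma> j))"
      unfolding discriminant_def by (simp add: subst_prod subst_diff case_prod_beta)
    also have "\<dots> = discriminant" unfolding discriminant_def
      by (rule prod.reindex_bij_witness[where i = "\<lambda>(i, j). (inv' \<sigma> i, inv' \<sigma> j)" and j =
        "\<lambda>(i, j). (\<sigma> i, \<sigma> j)"])
        (use G_in[OF s] G_in[OF G_inv[OF s]] inj inv in \<open>auto simp: inv, metis inv\<close>)
    finally show ?thesis .
  qed
  moreover have "discriminant \<in> R" unfolding discriminant_def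
    by (intro polys.prod_in) (auto intro!: polys.diff_in)
  ultimately show ?thesis by (simp add: fixed_def)
qed

theorem not_cohen_macaulay:
  assumes idem: "\<And>i. i \<in> {1..n} \<Longrightarrow> r (r i) = r i" and codim: "card (r ` {1..n}) + 3 \<le> n"
  shows "\<not> cohen_macaulay (invariant_ring n G :: 'k mpoly ring)"
proof
  assume "cohen_macaulay (invariant_ring n G :: 'k mpoly ring)"
  then have cm: "cohen_macaulay (set_ring (fixed G))" by (simp add: invariant_ring_eq)
  interpret L: localized_subring "fixed G" M0
    using prm_M0 by unfold_locales
  \<comment> \<open>With \<open>k = n - 2\<close>, a regular sequence of length \<open>n\<close> has
    \<open>k + 2\<close> terms, and \<open>codim\<close> makes \<open>k\<close> exceed the number of
    orbits.\<close>
  have "2 \<le> n" using codim by simp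
  then obtain k where k: "n = Suc (Suc k)" using le_Suc_ex[of 2 n] by auto
  have noeth: "noetherian_ring (set_ring (fixed G))" using cm by (simp add: cohen_macaulay_def)
  interpret N: noetherian_local L.SM "L.ext M0" by (rule L.noetherian_local_SM[OF noeth])
  have below_M0: "{a \<in> fixed G. act h a = 0} \<subseteq> M0" for h
  proof
    fix a assume a: "a \<in> {a \<in> fixed G. act h a = 0}"
    have "coeff_of a 0 = coeff_of (act h a) 0" by (simp add: coeff_subst_zero)
    then show "a \<in> M0" using a by (simp add: M0_def)
  qed
  \<comment> \<open>Contractions of the primes \<open>(x_1, ..., x_i)\<close>; they form a chain of
    length \<open>n\<close> below \<open>M0\<close>.\<close>
  define q where "q i = {a \<in> fixed G. kill_vars {1..i} a = 0}" for i
  have q: "A.prm (q i)" "q i \<subseteq> M0" for i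
  proof -
    note e = ring_endoD[OF ring_endo_kill_vars]
    show "A.prm (q i)" unfolding q_def by (rule A.prm_kernel) (rule e)+
    show "q i \<subseteq> M0"
    proof
      fix a assume a: "a \<in> q i"
      have "coeff_of a 0 = coeff_of (kill_vars {1..i} a) 0" by (simp add: coeff_kill_vars_zero)
      then show "a \<in> M0" using a by (simp add: q_def M0_def)
    qed
  qed
  have q_mono: "q i \<subset> q (Suc i)" if i: "i < n" for i
  proof -
    have "kill_vars {1..Suc i} a = kill_vars {1..Suc i} (kill_vars {1..i} a)" for a :: "'k mpoly"
      by (induction a rule: mpoly_induct) (auto simp: kill_vars_single kill_vars_add ring_endoD(1)[OF ring_endo_kill_vars])
    then have "q i \<subseteq> q (Suc i)" using ring_endoD(1)[OF ring_endo_kill_vars] unfolding q_def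
      by (metis (mono_tags, lifting) Collect_mono)
    moreover have "elem_sym n (n - i) \<in> q (Suc i)" "elem_sym n (n - i) \<notin> q i"
      using kill_vars_elem_sym[OF i, where 'k = 'k] elem_sym_in_polys subst_elem_sym[OF G_perm]
      by (auto simp: q_def fixed_def)
    ultimately show ?thesis by blast
  qed
  obtain ys where ys: "length ys = Suc (Suc k)" "N.rs {0} ys"
    using L.cohen_macaulay_regular_sequence[OF cm maximalideal_M0, of "Suc k" q] q q_mono k by auto
  have idl_kill: "A.idl (killers G)" by (rule idl_killers) (use I_G in auto)
  have kill_sub: "killers G \<subseteq> M0" using killers_mod below_M0[of r] by (auto simp: killers_def)
  let ?I = "L.ext (killers G)"
  have IS: "L.S.idl ?I" by (rule L.idl_ext[OF idl_kill])
  have IM: "?I \<subseteq> L.ext M0" using kill_sub by (auto simp: L.ext_def)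
  have FI: "Fract a 1 \<in> ?I" if "a \<in> killers G" for a
    using that L.compl_one by (auto simp: L.ext_def)
  \<comment> \<open>Contracted to \<open>fixed G\<close>, such a chain lies above the killers, hence
    above \<open>P \<inter> fixed G\<close>, and its length is at most the number of orbits.\<close>
  have no_chain: "\<not> N.prime_chain ?I k"
  proof
    assume "N.prime_chain ?I k"
    then obtain P where P: "\<And>i. i \<le> k \<Longrightarrow> L.S.prm (P i)" "\<And>i. i < k \<Longrightarrow> P i \<subset> P (Suc i)" "?I \<subseteq> P 0"
      by (auto simp: N.prime_chain_def)
    have "k \<le> card (r ` {1..n})"
    proof (rule prime_chain_length_le[OF unital_subring_fixed mconst_fixed _ r, where q =
      "\<lambda>i. L.cont (P i)"])
      show "fixed G \<subseteq> polys n" using fixedD(1) by blast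
      show "A.prm (L.cont (P i))" if "i \<le> k" for i using L.prm_cont P(1)[OF that] by blast
      show "L.cont (P i) \<subset> L.cont (P (Suc i))" if "i < k" for i
      proof -
        have "L.S.idl (P i)" "L.S.idl (P (Suc i))"
          using P(1)[of i] P(1)[of "Suc i"] that L.S.prmD(1) by auto
        note L.cont_mono_iff[OF this] L.cont_mono_iff[OF this(2,1)]
        then show ?thesis using P(2)[OF that] by (simp add: less_le_not_le)
      qed
      show "a \<in> L.cont (P 0)" if "a \<in> fixed G" "act r a = 0" for a
      proof (rule prime_over_killers[OF L.prm_cont[OF P(1)] _ that])
        show "killers G \<subseteq> L.cont (P 0)"
          using FI P(3) by (auto simp: L.cont_def killers_def)
      qed simp
    qed
    then show False using codim k by simp
  qed
  have fix_r: "{i \<in> {1..n}. r i = i} = r ` {1..n}" using idem r by (force simp: image_iff)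
  have nonreps: "card ({1..n} - r ` {1..n}) \<ge> 3"
    using codim r by (subst card_Diff_subset) auto
  then have "2 \<le> card ({1..n} - r ` {1..n})" by simp
  then obtain B where B: "B \<subseteq> {1..n} - r ` {1..n}" "card B = 2" by (rule obtain_subset_with_card_n)
  then obtain a b where "B = {a, b}" "a \<noteq> b" by (auto simp: card_2_iff)
  then have ab: "a \<in> {1..n}" "b \<in> {1..n}" "r a \<noteq> a" "r b \<noteq> b" "a \<noteq> b" using B(1) fix_r by auto
  \<comment> \<open>An element of \<open>P\<close> none of whose conjugates dies when two variables
    are identified: the pairs \<open>{a, r a}\<close> and \<open>{b, r b}\<close> would both have to
    be mapped onto the identified pair. The square keeps the two differences from
    cancelling.\<close>
  define f :: "'k mpoly" where "f = (mvar a - mvar (r a)) + (mvar b - mvar (r b)) ^ 2"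
  have fR: "f \<in> R" unfolding f_def using ab r
    by (intro polys.add_in polys.diff_in polys.power_in) auto
  have fr: "act r f = 0" by (simp add: f_def subst_add subst_diff subst_power idem[OF ab(1)] idem[OF ab(2)])
  have nr: "act r (orbit_norm f) = 0"
    unfolding orbit_norm_def subst_prod using G_finite G_id fr
      by (intro prod_zero) (auto intro!: bexI[of _ id])
  \<comment> \<open>The primes \<open>(x_i - x_j) \<inter> fixed G\<close>; keeping
    \<open>a2\<close> outside them makes it coprime to the discriminant.\<close>
  define Qij where "Qij i j = {c \<in> fixed G. act (id(j := i)) c = 0}" for i j :: nat
  have Qij: "A.prm (Qij i j)" "Qij i j \<subseteq> M0" for i j
    unfolding Qij_def using below_M0 by (auto intro!: A.prm_kernel simp: subst_add subst_mult)
  have kill_Qij: "\<not> killers G \<subseteq> Qij i j" for i j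
  proof
    assume "killers G \<subseteq> Qij i j"
    then have "orbit_norm f \<in> Qij i j"
      using prime_over_killers[OF Qij(1)] orbit_norm_fixed[OF fR] nr by blast
    then have "(\<Prod>\<tau>\<in>G. act (id(j := i)) (act \<tau> f)) = 0"
      by (simp only: Qij_def orbit_norm_def subst_prod mem_Collect_eq)
    then obtain \<tau> where t: "\<tau> \<in> G" "act (id(j := i)) (act \<tau> f) = 0" using G_finite by auto
    let ?h = "\<lambda>y. (id(j := i)) (\<tau> y)"
    have "(mvar (?h a) - mvar (?h (r a))) + (mvar (?h b) - mvar (?h (r b))) ^ 2 = (0 :: 'k mpoly)"
      using t(2) by (simp add: f_def subst_add subst_diff subst_power)
    then have "?h a = ?h (r a)" "?h b = ?h (r b)" using linear_plus_square_nonzero by blast+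
    moreover have "\<tau> y = \<tau> z \<longleftrightarrow> y = z" for y z using permutes_inj[OF G_perm[OF t(1)]]
      by (auto simp: inj_def)
    ultimately have "{\<tau> a, \<tau> (r a)} = {i, j}" "{\<tau> b, \<tau> (r b)} = {i, j}" using ab
      by (auto split: if_splits)
    then have "\<tau> a = \<tau> (r b)" using \<open>\<And>y z. \<tau> y = \<tau> z \<longleftrightarrow> y = z\<close> ab(5) by (metis doubleton_eq_iff)
    then have "a = r b" using \<open>\<And>y z. \<tau> y = \<tau> z \<longleftrightarrow> y = z\<close> by blast
    then show False using ab idem by auto
  qed
  \<comment> \<open>The factor \<open>x_a - x_(r a)\<close> puts the discriminant in
    \<open>P\<close>, and every prime above the killers contains
    \<open>P \<inter> fixed G\<close>.\<close>
  have "\<exists>m. discriminant ^ m \<in> killers G"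
  proof (rule ccontr)
    assume none: "\<nexists>m. discriminant ^ m \<in> killers G"
    let ?D = "range (\<lambda>m. discriminant ^ m)"
    have "\<exists>Q. A.prm Q \<and> killers G \<subseteq> Q \<and> Q \<inter> ?D = {} \<and>
      (\<forall>a\<in>fixed G - Q. \<exists>y\<in>Q. \<exists>t\<in>fixed G. y + a * t \<in> range (\<lambda>m. discriminant ^ m))"
    proof (rule A.exists_prm_disjoint[OF idl_kill])
      show "1 \<in> ?D" by (rule range_eqI[of _ _ 0]) simp
      show "u * v \<in> ?D" if "u \<in> ?D" "v \<in> ?D" for u v
        using that by (auto simp flip: power_add)
      show "killers G \<inter> ?D = {}" using none by blast
    qed
    then obtain Q where Q: "A.prm Q" "killers G \<subseteq> Q" "Q \<inter> range (\<lambda>m. discriminant ^ m) = {}"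
      by (elim exE conjE) (rule that)
    have "act r discriminant = 0" unfolding discriminant_def subst_prod
    proof (rule prod_zero[OF finite_pairs], rule bexI)
      show "act r (case (a, r a) of (i, j) \<Rightarrow> mvar i - mvar j) = 0"
        by (simp add: subst_diff idem[OF ab(1)])
      show "(a, r a) \<in> {(i, j). i \<in> {1..n} \<and> j \<in> {1..n} \<and> i \<noteq> j}" using ab(1,3) r[OF ab(1)] by simp
    qed
    then have "discriminant \<in> Q" using prime_over_killers[OF Q(1,2) discriminant_fixed] by blast
    moreover have "discriminant ^ 1 \<in> range (\<lambda>m. discriminant ^ m)" by blast
    ultimately show False using Q(3) by auto
  qed
  then obtain m where m: "discriminant ^ m \<in> killers G" by blast
  define a1 where "a1 = discriminant ^ m"
  have "mvar i - mvar j \<noteq> (0 :: 'k mpoly)" if "i \<noteq> j" for i j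
    using mvar_inj[of i j, where 'k = 'k] that by simp
  then have "discriminant \<noteq> 0" unfolding discriminant_def using finite_pairs by auto
  then have a10: "a1 \<noteq> 0" by (simp add: a1_def)
  have a1k: "a1 \<in> killers G" using m by (simp add: a1_def)
  let ?A1 = "Fract a1 1"
  let ?Qs = "(\<lambda>(i, j). L.ext (Qij i j)) ` {(i, j). i \<in> {1..n} \<and> j \<in> {1..n} \<and> i \<noteq> j}"
  have "?A1 \<noteq> 0" using a10 by (simp add: Zero_fract_def eq_fract)
  then have reg1: "L.S.reg {0} ?A1" by (simp add: L.S.reg_def)
  have "\<exists>A2\<in>?I. (\<forall>Q\<in>?Qs. A2 \<notin> Q) \<and> (\<exists>A3\<in>?I. L.S.reg (L.S.adj (L.S.adj {0} ?A1) A2) A3)"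
  proof (rule N.exists_regular_triple[OF ys(2,1) IS IM no_chain FI[OF a1k] reg1])
    show "finite ?Qs" using finite_pairs by simp
    show "L.S.prm Q" if "Q \<in> ?Qs" for Q using that L.prm_ext[OF Qij] by auto
    show "\<not> ?I \<subseteq> Q" if Q: "Q \<in> ?Qs" for Q
    proof
      assume "?I \<subseteq> Q"
      obtain i j where "Q = L.ext (Qij i j)" using Q by auto
      then have "killers G \<subseteq> Qij i j"
        using \<open>?I \<subseteq> Q\<close> FI L.Fract_in_ext[OF Qij _ L.compl_one] by (fastforce simp: killers_def)
      then show False using kill_Qij by blast
    qed
  qed
  then obtain A2 A3 where A2: "A2 \<in> ?I" "\<forall>Q\<in>?Qs. A2 \<notin> Q" and A3: "A3 \<in> ?I"
    and reg3: "L.S.reg (L.S.adj (L.S.adj {0} ?A1) A2) A3" by (elim bexE conjE) (rule that)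
  obtain a2 s2 where a2: "a2 \<in> killers G" "s2 \<in> fixed G - M0" "A2 = Fract a2 s2" using A2(1)
    by (auto simp: L.ext_def)
  obtain a3 s3 where a3: "a3 \<in> killers G" "s3 \<in> fixed G - M0" "A3 = Fract a3 s3" using A3(1)
    by (auto simp: L.ext_def)
  have s23: "s2 \<noteq> 0" "s3 \<noteq> 0" using L.compl(2) a2(2) a3(2) by blast+
  have in_G: "a1 \<in> fixed G" "a2 \<in> fixed G" "a3 \<in> fixed G" using a1k a2(1) a3(1)
    by (auto simp: killers_def)
  have a2_mod: "act (id(j := i)) a2 \<noteq> 0" if ij: "i \<in> {1..n}" "j \<in> {1..n}" "i \<noteq> j" for i j
  proof
    assume "act (id(j := i)) a2 = 0"
    then have "a2 \<in> Qij i j" using in_G by (simp add: Qij_def)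
    then have mem: "A2 \<in> L.ext (Qij i j)" using a2 by (auto simp: L.ext_def)
    have "L.ext (Qij i j) \<in> ?Qs" using ij by (intro rev_image_eqI[of "(i, j)"]) auto
    from bspec[OF A2(2) this] mem show False by (rule notE)
  qed
  have canc: "cancels n a2 a1" unfolding a1_def discriminant_def
  proof (intro cancels_power cancels_prod)
    fix ij assume "ij \<in> {(i, j). i \<in> {1..n} \<and> j \<in> {1..n} \<and> i \<noteq> j}"
    then obtain i j where ij: "ij = (i, j)" "i \<in> {1..n}" "j \<in> {1..n}" "i \<noteq> j" by blast
    then show "cancels n a2 (case ij of (i, j) \<Rightarrow> mvar i - mvar j)"
      using cancels_linear_form[OF ij(2-4) a2_mod[OF ij(2-4)]] by simp
  qed
  show False
  proof (rule no_regular_triple[OF prm_M0 _ a1k a2(1) a3(1) canc])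
    show "act r w \<noteq> 0" if "w \<in> fixed G - M0" for w using that below_M0[of r] by blast
    fix z y1 y2 assume z: "z \<in> fixed G" "y1 \<in> fixed G" "y2 \<in> fixed G" "a3 * z = a1 * y1 + a2 * y2"
    \<comment> \<open>\<open>s2 * y2\<close> offsets the denominator of \<open>A2\<close>; divided
      by \<open>s3\<close>, the hypothesis becomes a relation for \<open>A3\<close> in the
      localization. Clearing denominators afterwards yields the multiplier outside
      \<open>M0\<close>.\<close>
    have zin: "Fract y1 s3 \<in> L.SM" "Fract (s2 * y2) s3 \<in> L.SM" "Fract z 1 \<in> L.SM"
      using z a2(2) a3(2) L.compl_one by (auto intro!: L.Fract_in_SM)
    have "A3 * Fract z 1 = (0 + ?A1 * Fract y1 s3) + A2 * Fract (s2 * y2) s3"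
      using s23 z(4) by (simp add: a2(3) a3(3) eq_fract algebra_simps Zero_fract_def)
    also have "(0 + ?A1 * Fract y1 s3) + A2 * Fract (s2 * y2) s3 \<in> L.S.adj (L.S.adj {0} ?A1) A2"
      by (intro L.S.adjI singletonI zin)
    finally have "Fract z 1 \<in> L.S.adj (L.S.adj {0} ?A1) A2"
      using reg3 zin(3) unfolding L.S.reg_def by blast
    then obtain y1' y2' where y': "y1' \<in> L.SM" "y2' \<in> L.SM" "Fract z 1 = ?A1 * y1' + A2 * y2'"
      by (auto simp: L.S.adj_def)
    obtain c1 t1 where c1: "c1 \<in> fixed G" "t1 \<in> fixed G - M0" "y1' = Fract c1 t1" using y'(1)
      by (auto simp: L.SM_def)
    obtain c2 t2 where c2: "c2 \<in> fixed G" "t2 \<in> fixed G - M0" "y2' = Fract c2 t2" using y'(2)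
      by (auto simp: L.SM_def)
    have t0: "t1 \<noteq> 0" "t2 \<noteq> 0" using L.compl(2) c1 c2 by blast+
    have "(t1 * (s2 * t2)) * z = a1 * (c1 * (s2 * t2)) + a2 * (c2 * t1)"
      using y'(3) s23 t0 by (simp add: a2(3) c1(3) c2(3) eq_fract algebra_simps)
    moreover have "t1 * (s2 * t2) \<in> fixed G - M0" using L.compl_mult c1 c2 a2 by blast
    moreover have "c1 * (s2 * t2) \<in> fixed G" "c2 * t1 \<in> fixed G" using c1 c2 a2 by auto
    ultimately show "\<exists>w\<in>fixed G - M0. \<exists>b1\<in>fixed G. \<exists>b2\<in>fixed G. w * z = a1 * b1 + a2 * b2" by blast
  qed
qed

end


section \<open>Homomorphisms from p-groups to the integers modulo p\<close>

lemma (in group) group_actionI: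
  assumes cl: "\<And>g x. g \<in> carrier G \<Longrightarrow> x \<in> E \<Longrightarrow> f g x \<in> E" and one: "\<And>x. x \<in> E \<Longrightarrow> f \<one> x = x"
    and mult: "\<And>g h x. g \<in> carrier G \<Longrightarrow> h \<in> carrier G \<Longrightarrow> x \<in> E \<Longrightarrow> f (g \<otimes> h) x = f g (f h x)"
  shows "group_action G E (\<lambda>g. \<lambda>x\<in>E. f g x)"
proof -
  have bij: "(\<lambda>x\<in>E. f g x) \<in> Bij E" if g: "g \<in> carrier G" for g
  proof -
    have "bij_betw (f g) E E"
    proof (rule bij_betwI[where g = "f (inv g)"])
      show "f g \<in> E \<rightarrow> E" "f (inv g) \<in> E \<rightarrow> E" using cl g by auto
      show "f (inv g) (f g x) = x" "f g (f (inv g) x) = x" if "x \<in> E" for x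
        using mult[of "inv g" g x] mult[of g "inv g" x] g one that by (simp_all add: l_inv r_inv)
    qed
    then have "bij_betw (\<lambda>x\<in>E. f g x) E E" using bij_betw_cong[of E "\<lambda>x\<in>E. f g x" "f g" E] by simp
    then show ?thesis by (simp add: Bij_def)
  qed
  show ?thesis unfolding group_action_def group_hom_def group_hom_axioms_def
  proof (intro conjI homI)
    show "Group.group G" "Group.group (BijGroup E)" by (rule group_axioms, rule group_BijGroup)
    show "(\<lambda>x\<in>E. f g x) \<in> carrier (BijGroup E)" if "g \<in> carrier G" for g
      using bij[OF that] by (simp add: BijGroup_def)
    show "(\<lambda>x\<in>E. f (g \<otimes> h) x) = (\<lambda>x\<in>E. f g x) \<otimes>\<^bsub>BijGroup E\<^esub> (\<lambda>x\<in>E. f h x)"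
      if "g \<in> carrier G" "h \<in> carrier G" for g h
      using bij[OF that(1)] bij[OF that(2)] mult[OF that] cl[OF that(2)]
      by (auto simp: BijGroup_def compose_def fun_eq_iff restrict_def)
  qed
qed

text \<open>Orbits that are not single points have size divisible by \<open>p\<close>, and so does
  \<open>E\<close>; hence the number of fixed points is divisible by \<open>p\<close> and cannot be
  1.\<close>

lemma (in group_action) p_group_second_fixed_point:
  assumes p: "prime p" "Coset.order G = p ^ t" and E: "finite E" "p dvd card E"
    and x: "x \<in> E" "\<And>g. g \<in> carrier G \<Longrightarrow> \<phi> g x = x"
  shows "\<exists>y\<in>E. y \<noteq> x \<and> (\<forall>g\<in>carrier G. \<phi> g y = y)"
proof (rule ccontr)
  assume none: "\<not> ?thesis"
  interpret gr: group_hom G "BijGroup E" \<phi> by (rule group_hom)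
  define O' where "O' = orbits G E \<phi>"
  have "x \<in> orbit G \<phi> x" by (rule orbit_refl[OF x(1)])
  then have orb_x: "orbit G \<phi> x = {x}" using x(2) by (auto simp: orbit_def)
  have sub: "orbit G \<phi> y \<subseteq> E" if "y \<in> E" for y
    using element_image that by (auto simp: orbit_def)
  have refl: "y \<in> orbit G \<phi> y" if "y \<in> E" for y using orbit_refl[OF that] .
  have orb_sub: "orbit G \<phi> y \<subseteq> orbit G \<phi> z"
    if yz: "y \<in> E" "z \<in> E" "w \<in> orbit G \<phi> y" "w \<in> orbit G \<phi> z" for y z w
  proof
    fix v assume v: "v \<in> orbit G \<phi> y"
    have E: "w \<in> E" "v \<in> E" using sub[OF yz(1)] yz(3) v by auto
    have "y \<in> orbit G \<phi> w" by (rule orbit_sym[OF yz(1) E(1) yz(3)])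
    then have "y \<in> orbit G \<phi> z" by (rule orbit_trans[OF yz(2) E(1) yz(1) yz(4)])
    then show "v \<in> orbit G \<phi> z" using v by (rule orbit_trans[OF yz(2) yz(1) E(2)])
  qed
  have same: "orbit G \<phi> y = orbit G \<phi> z" if "y \<in> E" "z \<in> E" "w \<in> orbit G \<phi> y"
    "w \<in> orbit G \<phi> z" for y z w
    using orb_sub[OF that] orb_sub[OF that(2,1,4,3)] by (rule subset_antisym)
  have U: "\<Union>O' = E" unfolding O'_def orbits_def using sub refl by blast
  have disj: "disjnt A B" if "A \<in> O'" "B \<in> O'" "A \<noteq> B" for A B
    using that same unfolding O'_def orbits_def disjnt_def by blast
  have finO: "finite O'" and finA: "\<And>A. A \<in> O' \<Longrightarrow> finite A"
    using E(1) U by (auto intro: finite_UnionD finite_subset)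
  have card: "card E = (\<Sum>A\<in>O'. card A)"
    using card_Union_disjoint[of O'] disj finA U by (auto simp: pairwise_def)
  have xO: "{x} \<in> O'" unfolding O'_def orbits_def using orb_x x(1) by blast
  have dvd: "p dvd card A" if A: "A \<in> O' - {{x}}" for A
  proof -
    obtain y where y: "y \<in> E" "A = orbit G \<phi> y" using A by (auto simp: O'_def orbits_def)
    have "y \<noteq> x" using A y orb_x by auto
    have "card A dvd p ^ t" using orbit_stabilizer_theorem[OF y(1)] p(2) y(2)
      by (metis dvd_triv_left)
    then obtain i where i: "card A = p ^ i" using p(1) by (auto simp: divides_primepow_nat)
    have "i \<noteq> 0"
    proof
      assume "i = 0"
      then have "card A = 1" using i by simp
      then have "A = {y}" using refl[OF y(1)] y(2) by (metis card_1_singletonE singletonD)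
      then have "\<forall>g\<in>carrier G. \<phi> g y = y" using y(2) by (auto simp: orbit_def)
      then show False using none y(1) \<open>y \<noteq> x\<close> by blast
    qed
    then show ?thesis using i by (simp add: dvd_power)
  qed
  have "card E = 1 + (\<Sum>A\<in>O' - {{x}}. card A)" unfolding card using sum.remove[OF finO xO, of card]
    by simp
  moreover have "p dvd (\<Sum>A\<in>O' - {{x}}. card A)" using dvd by (rule dvd_sum)
  ultimately have "p dvd 1" using E(2) by (metis dvd_add_left_iff)
  then show False using p(1) by (simp add: prime_nat_iff)
qed

text \<open>The group acts on the functions \<open>F\<close> with \<open>F(1) = 0\<close> and values modulo \<open>p\<close>
  by \<open>(a F)(c) = F(a\<inverse> c) - F(a\<inverse>)\<close>; the fixed points are exactly the homomorphisms.\<close>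

lemma (in group) p_group_hom_exists:
  assumes p: "prime (p :: nat)" "Coset.order G = p ^ t" "t > 0"
  shows "\<exists>F :: 'a \<Rightarrow> nat. (\<forall>a\<in>carrier G. \<forall>b\<in>carrier G. F (a \<otimes> b) mod p = (F a + F b) mod p) \<and>
    (\<exists>a\<in>carrier G. F a mod p \<noteq> 0)"
proof -
  have p0: "p > 0" using p(1) by (simp add: prime_gt_0_nat)
  have fin: "finite (carrier G)" 
  proof -
    have "0 < Coset.order G" using p(2) p0 by simp
    then show ?thesis by (simp add: Coset.order_def card_gt_0_iff)
  qed
  \<comment> \<open>Normalizing the value at \<open>\<one>\<close> leaves
    \<open>p ^ (order G - 1)\<close> functions, still a multiple of \<open>p\<close> for a
    nontrivial group.\<close>
  define E :: "('a \<Rightarrow> nat) set" where "E = (\<Pi>\<^sub>E c\<in>carrier G. if c = \<one> then {0} else {..<p})"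
  have EI: "F \<in> E \<longleftrightarrow> F \<in> extensional (carrier G) \<and> F \<one> = 0 \<and> (\<forall>c\<in>carrier G. F c < p)" for F
  proof
    assume F: "F \<in> E"
    then have val: "F c \<in> (if c = \<one> then {0} else {..<p})" if "c \<in> carrier G" for c
      using that by (auto simp: E_def PiE_iff)
    have "F c < p" if "c \<in> carrier G" for c using val[OF that] p0 by (cases "c = \<one>") simp_all
    then show "F \<in> extensional (carrier G) \<and> F \<one> = 0 \<and> (\<forall>c\<in>carrier G. F c < p)"
      using F val[OF one_closed] by (simp add: E_def PiE_iff)
  qed (simp add: E_def PiE_iff)
  \<comment> \<open>Adding \<open>p - F (inv a)\<close> is subtraction modulo \<open>p\<close>
    within the natural numbers.\<close>
  define f where "f a F = (\<lambda>c\<in>carrier G. (F (inv a \<otimes> c) + (p - F (inv a))) mod p)" for a and F :: "'a \<Rightarrow> nat"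
  have f_cong: "(f a F c + F (inv a)) mod p = F (inv a \<otimes> c) mod p" if "a \<in> carrier G"
    "c \<in> carrier G" "F \<in> E" for a c F
  proof -
    have "F (inv a) \<le> p" using that EI by (simp add: less_imp_le)
    then have "F (inv a \<otimes> c) + (p - F (inv a)) + F (inv a) = F (inv a \<otimes> c) + p" by simp
    then show ?thesis using that by (simp add: f_def mod_add_left_eq)
  qed
  have cl: "f a F \<in> E" if "a \<in> carrier G" "F \<in> E" for a F
    using that p0 EI[of F] by (auto simp: EI f_def less_imp_le)
  have ext: "F = F'" if "F \<in> E" "F' \<in> E" "\<And>c. c \<in> carrier G \<Longrightarrow> F c mod p = F' c mod p" for F F'
  proof (rule extensionalityI[of F "carrier G" F'])
    show "F \<in> extensional (carrier G)" "F' \<in> extensional (carrier G)" using that EI by auto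
    show "F c = F' c" if "c \<in> carrier G" for c using that \<open>F \<in> E\<close> \<open>F' \<in> E\<close> EI that(1)
      \<open>\<And>c. c \<in> carrier G \<Longrightarrow> F c mod p = F' c mod p\<close>[OF that] by auto
  qed
  have cancel: "a mod p = b mod p" if "(a + c) mod p = (b + c) mod p" for a b c :: nat
    using that by (simp add: nat_mod_eq_iff)
  interpret act: group_action G E "\<lambda>a. \<lambda>F\<in>E. f a F"
  proof (rule group_actionI[OF cl])
    show "f \<one> F = F" if F: "F \<in> E" for F
    proof (rule ext[OF cl[OF one_closed F] F])
      fix c assume c: "c \<in> carrier G"
      show "f \<one> F c mod p = F c mod p" using f_cong[OF one_closed c F] c F EI by simp
    qed
    show "f (a \<otimes> b) F = f a (f b F)" if ab: "a \<in> carrier G" "b \<in> carrier G" and F: "F \<in> E" for a b F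
    proof (rule ext[OF cl[OF m_closed[OF ab] F] cl[OF ab(1) cl[OF ab(2) F]]])
      fix c assume c: "c \<in> carrier G"
      let ?u = "F (inv b)" and ?v = "f b F (inv a)"
      have i: "inv (a \<otimes> b) = inv b \<otimes> inv a" using ab by (simp add: inv_mult_group)
      have 1: "(f (a \<otimes> b) F c + F (inv b \<otimes> inv a)) mod p = F (inv b \<otimes> (inv a \<otimes> c)) mod p"
        using f_cong[OF m_closed[OF ab] c F] ab c by (simp add: i m_assoc)
      have 2: "(?v + ?u) mod p = F (inv b \<otimes> inv a) mod p"
        using f_cong[OF ab(2) inv_closed[OF ab(1)] F] .
      have 3: "(f a (f b F) c + ?v) mod p = f b F (inv a \<otimes> c) mod p"
        using f_cong[OF ab(1) c cl[OF ab(2) F]] .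
      have 4: "(f b F (inv a \<otimes> c) + ?u) mod p = F (inv b \<otimes> (inv a \<otimes> c)) mod p"
        using f_cong[OF ab(2) m_closed[OF inv_closed[OF ab(1)] c] F] .
      have "(f a (f b F) c + F (inv b \<otimes> inv a)) mod p = (f a (f b F) c + (?v + ?u)) mod p"
        using 2 by (metis mod_add_right_eq)
      also have "\<dots> = ((f a (f b F) c + ?v) + ?u) mod p" by (simp add: add.assoc)
      also have "\<dots> = F (inv b \<otimes> (inv a \<otimes> c)) mod p" using 3 4 by (metis mod_add_left_eq)
      finally have 5: "(f a (f b F) c + F (inv b \<otimes> inv a)) mod p = F (inv b \<otimes> (inv a \<otimes> c)) mod p" .
      show "f (a \<otimes> b) F c mod p = f a (f b F) c mod p" by (rule cancel[OF trans[OF 1 5[symmetric]]])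
    qed
  qed
  let ?Z = "\<lambda>c\<in>carrier G. 0 :: nat"
  have Z: "?Z \<in> E" using p0 by (simp add: EI)
  have "\<exists>y\<in>E. y \<noteq> ?Z \<and> (\<forall>g\<in>carrier G. (\<lambda>F\<in>E. f g F) y = y)"
  proof (rule act.p_group_second_fixed_point[OF p(1,2) _ _ Z])
    show "finite E" unfolding E_def using fin by (intro finite_PiE) auto
    have "card E = (\<Prod>c\<in>carrier G. if c = \<one> then 1 else p)"
      unfolding E_def card_PiE[OF fin] by (intro prod.cong) auto
    moreover have "Coset.order G \<noteq> 1" using p prime_gt_1_nat[OF p(1)] one_less_power[of p t] by simp
    then have "carrier G \<noteq> {\<one>}" by (auto simp: Coset.order_def)
    then obtain c where "c \<in> carrier G" "c \<noteq> \<one>" using one_closed by blast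
    ultimately show "p dvd card E" using dvd_prodI[OF fin, of c "\<lambda>c. if c = \<one> then 1 else p"]
      by simp
    show "(\<lambda>F\<in>E. f g F) ?Z = ?Z" if "g \<in> carrier G" for g
    proof -
      have "f g ?Z = ?Z" by (rule ext[OF cl[OF that Z] Z]) (use f_cong[OF that _ Z] that in simp)
      then show ?thesis using Z by simp
    qed
  qed
  then obtain F where F: "F \<in> E" "F \<noteq> ?Z" "\<And>g. g \<in> carrier G \<Longrightarrow> f g F = F" by auto
  have "F (a \<otimes> b) mod p = (F a + F b) mod p" if "a \<in> carrier G" "b \<in> carrier G" for a b
    using f_cong[OF inv_closed[OF that(1)] that(2) F(1)] F(3)[OF inv_closed[OF that(1)]] that
    by (simp add: add.commute)
  moreover have "\<exists>a\<in>carrier G. F a mod p \<noteq> 0"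
  proof (rule ccontr)
    assume "\<not> ?thesis"
    then have "F = ?Z" by (intro ext[OF F(1) Z]) auto
    then show False using F(2) by blast
  qed
  ultimately show ?thesis by blast
qed

section \<open>Orbits of permutations\<close>

definition cyc :: "(nat \<Rightarrow> nat) \<Rightarrow> nat \<Rightarrow> nat set" where
  "cyc h x = range (\<lambda>j. (h ^^ j) x)"

lemma sym_group_pow: "x [^]\<^bsub>sym_group n\<^esub> (k::nat) = x ^^ k"
  by (induction k) (simp_all add: sym_group_one sym_group_mult funpow_Suc_right[symmetric] funpow_swap1 del: funpow.simps(2) flip: funpow_Suc_right)

lemma finite_sym_group: "finite (carrier (sym_group n))"
  by (rule finite_subset[OF _ finite_permutations[of "{1..n}"]]) (auto simp: sym_group_carrier)

lemma permutes_permutation: "h permutes {1..n::nat} \<Longrightarrow> permutation h"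
  using sym_group_carrier' by (simp add: sym_group_carrier)

lemma generate_singleton:
  assumes "h permutes {1..n}"
  shows "generate (sym_group n) {h} = range (\<lambda>j. h ^^ j)"
  using group.generate_pow_on_finite_carrier[OF sym_group_is_group finite_sym_group, of h n] assms
  by (auto simp: sym_group_carrier sym_group_pow)

lemma orbit_partition_eq:
  assumes "h permutes {1..n}" shows "orbit_partition n h = cyc h ` {1..n}"
proof -
  have "{f x | f. f \<in> generate (sym_group n) {h}} = cyc h x" for x
    by (auto simp: generate_singleton[OF assms] cyc_def)
  then show ?thesis by (auto simp: orbit_partition_def orbits_def orbit_def)
qed

lemma cyc_self: "x \<in> cyc h x"
  unfolding cyc_def by (rule range_eqI[of _ _ 0]) simp

lemma cyc_in: "h permutes S \<Longrightarrow> x \<in> S \<Longrightarrow> cyc h x \<subseteq> S"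
  by (auto simp: cyc_def permutes_in_image[OF permutes_funpow])

lemma cyc_closed: "y \<in> cyc h x \<Longrightarrow> h y \<in> cyc h x"
proof -
  assume "y \<in> cyc h x"
  then obtain j where "y = (h ^^ j) x" by (auto simp: cyc_def)
  then have "h y = (h ^^ Suc j) x" by simp
  then show "h y \<in> cyc h x" unfolding cyc_def by (rule range_eqI)
qed

text \<open>If \<open>y\<close> is \<open>j\<close> steps from \<open>x\<close> and the cycle of
  \<open>x\<close> has length \<open>e\<close>, then \<open>e * j - j\<close> further steps lead
  back to \<open>x\<close>.\<close>

lemma cyc_eq:
  assumes h: "h permutes {1..n}" and y: "y \<in> cyc h x"
  shows "cyc h y = cyc h x"
proof -
  obtain j where j: "y = (h ^^ j) x" using y by (auto simp: cyc_def)
  note perm = permutes_permutation[OF h]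
  let ?e = "least_power h x"
  have m: "j \<le> ?e * j" using least_power_of_permutation(2)[OF perm, of x] by simp
  have "(h ^^ (?e * j - j)) y = (h ^^ ((?e * j - j) + j)) x" unfolding j
    by (simp only: funpow_add comp_apply)
  also have "\<dots> = (h ^^ (?e * j)) x" using m by simp
  also have "\<dots> = x" using least_power_dvd[OF perm, of x "?e * j"] by simp
  finally have eq: "(h ^^ (?e * j - j)) y = x" .
  have "(h ^^ (?e * j - j)) y \<in> cyc h y" unfolding cyc_def by (rule rangeI)
  then have x: "x \<in> cyc h y" unfolding eq .
  have sub: "cyc h b \<subseteq> cyc h a" if "b \<in> cyc h a" for a b
  proof
    fix z assume "z \<in> cyc h b"
    then obtain i where "z = (h ^^ i) b" by (auto simp: cyc_def)
    moreover have "(h ^^ i) b \<in> cyc h a" for i using that cyc_closed by (induction i) auto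
    ultimately show "z \<in> cyc h a" by simp
  qed
  show ?thesis using sub[OF y] sub[OF x] by blast
qed

lemma card_cyc:
  assumes h: "h permutes {1..n::nat}" shows "card (cyc h x) = least_power h x"
proof -
  note perm = permutes_permutation[OF h]
  have "cyc h x = set (support h x)" unfolding cyc_def using support_set[OF perm] by simp
  moreover have "card (set (support h x)) = length (support h x)"
    by (rule distinct_card[OF cycle_of_permutation[OF perm]])
  ultimately show ?thesis by (simp only: length_map length_upt diff_zero)
qed

lemma permutes_eq_idI: "h permutes S \<Longrightarrow> (\<And>x. x \<in> S \<Longrightarrow> h x = x) \<Longrightarrow> h = id"
  by (rule ext) (auto simp: permutes_def)


section \<open>The minimal element\<close>

lemma unique_prime_divisor_imp_power:
  assumes "(m :: nat) \<noteq> 0" "prime p" "\<And>q. prime q \<Longrightarrow> q dvd m \<Longrightarrow> q = p"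
  shows "\<exists>k. m = p ^ k"
proof -
  have "\<not> is_unit p" using assms(2) by (simp add: prime_nat_iff)
  then obtain y where y: "m = p ^ multiplicity p m * y" "\<not> p dvd y"
    using multiplicity_decompose'[OF assms(1)] by blast
  have "y = 1"
  proof (rule ccontr)
    assume "y \<noteq> 1"
    then obtain q where q: "prime q" "q dvd y" using prime_factor_nat by blast
    then have "q dvd m" using y(1) by (metis dvd_mult)
    then show False using assms(3) q y(2) by blast
  qed
  then show ?thesis using y(1) by (metis mult.right_neutral)
qed

lemma cyc_least: "x \<in> A \<Longrightarrow> (\<And>y. y \<in> A \<Longrightarrow> h y \<in> A) \<Longrightarrow> cyc h x \<subseteq> A"
proof -
  assume A: "x \<in> A" "\<And>y. y \<in> A \<Longrightarrow> h y \<in> A"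
  have "(h ^^ j) x \<in> A" for j by (induction j) (use A in auto)
  then show ?thesis by (auto simp: cyc_def)
qed

locale finest_element =
  fixes n :: nat and G N :: "(nat \<Rightarrow> nat) set" and g :: "nat \<Rightarrow> nat"
  assumes G: "subgroup G (sym_group n)"
    and N: "N = small_subgroup n G"
    and g: "g \<in> G - N"
    and finest: "\<forall>h \<in> G - N. h \<noteq> g \<longrightarrow>
       \<not> properly_refines {1..n} (orbit_partition n h) (orbit_partition n g)"
begin

sublocale S: group "sym_group n" by (rule sym_group_is_group)

lemma G_perm: "\<sigma> \<in> G \<Longrightarrow> \<sigma> permutes {1..n}"
  using subgroup.mem_carrier[OF G] by (simp add: sym_group_carrier)

lemma sub_id: "subgroup K (sym_group n) \<Longrightarrow> id \<in> K"
  using subgroup.one_closed[of K "sym_group n"] by (simp add: sym_group_one)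

lemma sub_comp: "subgroup K (sym_group n) \<Longrightarrow> \<sigma> \<in> K \<Longrightarrow> \<tau> \<in> K \<Longrightarrow> \<sigma> \<circ> \<tau> \<in> K"
  using subgroup.m_closed[of K "sym_group n"] by (simp add: sym_group_mult)

lemma sub_inv: "subgroup K (sym_group n) \<Longrightarrow> \<sigma> \<in> K \<Longrightarrow> inv' \<sigma> \<in> K"
  using subgroup.m_inv_closed[of K "sym_group n" \<sigma>] subgroup.mem_carrier[of K "sym_group n" \<sigma>]
    by simp

lemma sub_pow: "subgroup K (sym_group n) \<Longrightarrow> \<sigma> \<in> K \<Longrightarrow> \<sigma> ^^ j \<in> K"
proof (induction j)
  case 0
  then show ?case using sub_id by (simp add: id_def)
next
  case (Suc j)
  then show ?case using sub_comp[of K \<sigma> "\<sigma> ^^ j"] by (simp add: comp_def)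
qed

lemma small_in_N: "h \<in> G \<Longrightarrow> h \<in> transpositions n \<union> double_transpositions n \<union> three_cycles n \<Longrightarrow> h \<in> N"
  unfolding N small_subgroup_def by (rule generate.incl) blast

lemma N_sub: "subgroup N (sym_group n)"
  unfolding N small_subgroup_def
  by (rule S.generate_is_subgroup) (use subgroup.subset[OF G] in blast)

lemma gG: "g \<in> G" "g \<notin> N" and g_perm: "g permutes {1..n}"
  using g G_perm by auto

text \<open>The minimality of \<open>g\<close> read off single orbits, the form used both for powers
  of \<open>g\<close> and for elements of \<open>I\<close>.\<close>

lemma finest_cyc:
  assumes h: "h \<in> G" "h \<notin> N" and sub: "\<And>x. x \<in> {1..n} \<Longrightarrow> cyc h x \<subseteq> cyc g x" and x: "x \<in> {1..n}"
  shows "cyc h x = cyc g x"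
proof -
  have hp: "h permutes {1..n}" using G_perm h(1) .
  have eqs: "orbit_partition n h = cyc h ` {1..n}" "orbit_partition n g = cyc g ` {1..n}"
    using orbit_partition_eq hp g_perm by auto
  have "\<forall>X\<in>orbit_partition n h. \<exists>Y\<in>orbit_partition n g. X \<subseteq> Y" unfolding eqs using sub by blast
  then have "refines {1..n} (orbit_partition n h) (orbit_partition n g)"
    using partition_on_orbit_partition[OF hp] partition_on_orbit_partition[OF g_perm]
      by (simp add: refines_def)
  then have "orbit_partition n h = orbit_partition n g"
    using finest h by (cases "h = g") (auto simp: properly_refines_def)
  then have "cyc h x \<in> cyc g ` {1..n}" using x unfolding eqs by blast
  then obtain y where y: "cyc h x = cyc g y" by blast
  then have "x \<in> cyc g y" using cyc_self[of x h] by simp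
  then show ?thesis using y cyc_eq[OF g_perm] by simp
qed

subsection \<open>The order is a prime power\<close>

abbreviation "d \<equiv> S.ord g"

lemma pow_id_iff: "h permutes {1..n} \<Longrightarrow> h ^^ k = id \<longleftrightarrow> S.ord h dvd k"
  using S.pow_eq_id[of h k] by (simp add: sym_group_carrier sym_group_pow sym_group_one)

lemma d_pos: "d > 0"
  using S.ord_ge_1[OF finite_sym_group, of g] g_perm by (simp add: sym_group_carrier)

lemma least_power_dvd_d: "least_power g x dvd d"
  using pow_id_iff[OF g_perm, of d] least_power_dvd[OF permutes_permutation[OF g_perm], of x d]
    by simp

text \<open>Otherwise \<open>g ^^ q\<close> has the same orbits as \<open>g\<close>, so every cycle
  length of \<open>g\<close> is prime to \<open>q\<close>. As the cycle lengths divide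
  \<open>d\<close>, they divide \<open>d / q\<close>, and the order of \<open>g\<close> would be too
  small.\<close>

lemma prime_power_in_N:
  assumes q: "prime q" "q dvd d" shows "g ^^ q \<in> N"
proof (rule ccontr)
  assume nin: "g ^^ q \<notin> N"
  note perm = permutes_permutation[OF g_perm]
  obtain m where m: "d = q * m" using q(2) by blast
  have m0: "0 < m" "m < d" using m d_pos prime_gt_1_nat[OF q(1)] by auto
  have "(g ^^ m) x = x" if x: "x \<in> {1..n}" for x
  proof -
    let ?e = "least_power g x"
    have "cyc (g ^^ q) x = cyc g x" if "x \<in> {1..n}" for x
      using sub_pow[OF G gG(1)] nin _ that
      by (rule finest_cyc) (auto simp: cyc_def funpow_mult)
    then have "g x \<in> cyc (g ^^ q) x" using x cyc_closed[OF cyc_self] by blast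
    then obtain k where k: "g x = (g ^^ (q * k)) x" by (auto simp: cyc_def funpow_mult)
    \<comment> \<open>Since \<open>g x = (g ^^ (q * k)) x\<close>, the exponent
      \<open>q * k + d - 1\<close> fixes \<open>x\<close>; it is -1 modulo \<open>q\<close>, so
      \<open>q\<close> cannot divide the cycle length. The summand \<open>d\<close> keeps it a
      natural number.\<close>
    have "g ((g ^^ (q * k + d - 1)) x) = (g ^^ Suc (q * k + d - 1)) x" by simp
    also have "Suc (q * k + d - 1) = q * k + d" using d_pos by simp
    also have "(g ^^ (q * k + d)) x = (g ^^ (q * k)) ((g ^^ d) x)" by (simp add: funpow_add)
    also have "(g ^^ d) x = x" using pow_id_iff[OF g_perm, of d] by simp
    also have "(g ^^ (q * k)) x = g x" using k by simp
    finally have "(g ^^ (q * k + d - 1)) x = x" using permutes_inj[OF g_perm] by (simp add: inj_def)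
    then have e: "?e dvd q * k + d - 1" using least_power_dvd[OF perm] by blast
    have "\<not> q dvd ?e"
    proof
      assume "q dvd ?e"
      then have "q dvd q * k + d - 1" using e dvd_trans by blast
      moreover have "q dvd q * k + d" using q(2) by simp
      ultimately have "q dvd (q * k + d) - (q * k + d - 1)" by (rule dvd_diff_nat[rotated])
      then show False using d_pos q(1) by (simp add: prime_nat_iff)
    qed
    then have "coprime ?e q" using q(1) by (metis coprime_commute prime_imp_coprime)
    then have "?e dvd m" using least_power_dvd_d[of x] m by (simp add: coprime_dvd_mult_right_iff)
    then show ?thesis using least_power_dvd[OF perm] by blast
  qed
  then have "g ^^ m = id" by (intro permutes_eq_idI[OF permutes_funpow[OF g_perm]])
  then have "d dvd m" using pow_id_iff[OF g_perm] by blast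
  then show False using m0 by (auto dest: dvd_imp_le)
qed

text \<open>For distinct primes \<open>p\<close> and \<open>q\<close> dividing \<open>d\<close>,
  both \<open>g ^^ p\<close> and \<open>g ^^ q\<close> lie in \<open>N\<close>, and by Bezout they
  generate \<open>g\<close>.\<close>

theorem order_prime_power: "\<exists>p l. prime p \<and> l > 0 \<and> d = p ^ l"
proof -
  have "d \<noteq> 1"
  proof
    assume "d = 1"
    then have "g = id" using pow_id_iff[OF g_perm, of 1] by simp
    then show False using sub_id[OF N_sub] gG(2) by simp
  qed
  then obtain p where p: "prime p" "p dvd d" using prime_factor_nat by blast
  have "q = p" if q: "prime q" "q dvd d" for q
  proof (rule ccontr)
    assume "q \<noteq> p"
    then have "coprime p q" using p(1) q(1) by (simp add: primes_coprime)
    then obtain u v where uv: "p * u = q * v + 1"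
      using bezout_nat[of p q] p(1) by (metis coprime_imp_gcd_eq_1 not_prime_0)
    have a: "(g ^^ p) ^^ u \<in> N" "(g ^^ q) ^^ v \<in> N"
      using prime_power_in_N p q sub_pow[OF N_sub] by blast+
    have "(g ^^ p) ^^ u = g \<circ> (g ^^ q) ^^ v" by (simp add: funpow_mult uv)
    then have "(g ^^ p) ^^ u \<circ> inv' ((g ^^ q) ^^ v) = g \<circ> ((g ^^ q) ^^ v \<circ> inv' ((g ^^ q) ^^ v))"
      by (simp add: comp_assoc)
    also have "\<dots> = g"
      using permutes_inv_o(1)[OF permutes_funpow[OF permutes_funpow[OF g_perm]]] by simp
    finally show False using sub_comp[OF N_sub a(1) sub_inv[OF N_sub a(2)]] gG(2) by simp
  qed
  then obtain l where "d = p ^ l" using unique_prime_divisor_imp_power[of d p] d_pos p(1) by auto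
  moreover have "l \<noteq> 0" using \<open>d \<noteq> 1\<close> calculation by (metis power_0)
  ultimately show ?thesis using p(1) by (intro exI[of _ p] exI[of _ l]) simp
qed

subsection \<open>Orbit representatives\<close>

definition r :: "nat \<Rightarrow> nat" where "r x = Min (cyc g x)"

lemma finite_cyc: "x \<in> {1..n} \<Longrightarrow> finite (cyc g x)"
  using cyc_in[OF g_perm] finite_subset by blast

lemma r_cyc: "x \<in> {1..n} \<Longrightarrow> r x \<in> cyc g x"
  unfolding r_def using finite_cyc cyc_self by (intro Min_in) auto

lemma r_in: "x \<in> {1..n} \<Longrightarrow> r x \<in> {1..n}"
  using r_cyc cyc_in[OF g_perm] by blast

lemma r_eq_iff:
  assumes "x \<in> {1..n}" "y \<in> {1..n}" shows "r x = r y \<longleftrightarrow> cyc g x = cyc g y"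
proof
  assume "r x = r y"
  then show "cyc g x = cyc g y"
    using cyc_eq[OF g_perm r_cyc[OF assms(1)]] cyc_eq[OF g_perm r_cyc[OF assms(2)]] by simp
qed (simp add: r_def)

lemma r_idem: "x \<in> {1..n} \<Longrightarrow> r (r x) = r x"
  unfolding r_def[of "r x"] cyc_eq[OF g_perm r_cyc] by (simp add: r_def)

lemma g_in: "x \<in> {1..n} \<Longrightarrow> g x \<in> {1..n}"
  using permutes_in_image[OF g_perm] by blast

lemma r_g: "x \<in> {1..n} \<Longrightarrow> r (g x) = r x"
  using r_eq_iff[OF g_in] cyc_eq[OF g_perm cyc_closed[OF cyc_self]] by blast

lemma fixed_iff: assumes "x \<in> {1..n}" "g x = x" shows "r x = x" and "y \<in> {1..n} \<Longrightarrow> r y = r x \<Longrightarrow> y = x"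
proof -
  have c: "cyc g x = {x}" using cyc_least[of x "{x}" g] cyc_self[of x g] assms(2) by auto
  then show "r x = x" by (simp add: r_def)
  assume y: "y \<in> {1..n}" "r y = r x"
  then have "cyc g y = {x}" using r_eq_iff[OF y(1) assms(1)] c by simp
  then show "y = x" using cyc_self[of y g] by simp
qed

text \<open>If at most two points are not orbit representatives, then \<open>g\<close> is the identity, a
  transposition, a double transposition or a 3-cycle.\<close>

lemma codim: "card (r ` {1..n}) + 3 \<le> n"
proof (rule ccontr)
  assume small: "\<not> card (r ` {1..n}) + 3 \<le> n"
  define D where "D = {1..n} - r ` {1..n}"
  have D: "x \<in> D \<longleftrightarrow> x \<in> {1..n} \<and> r x \<noteq> x" for x
  proof
    assume x: "x \<in> D"
    then have "x \<in> {1..n}" "x \<notin> r ` {1..n}" by (simp_all add: D_def)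
    then show "x \<in> {1..n} \<and> r x \<noteq> x" using rev_image_eqI[of x "{1..n}" x r] by auto
  next
    assume x: "x \<in> {1..n} \<and> r x \<noteq> x"
    then have "x \<notin> r ` {1..n}" using r_idem by auto
    then show "x \<in> D" using x by (simp add: D_def)
  qed
  have "r ` {1..n} \<subseteq> {1..n}" using r_in by blast
  then have "card D = n - card (r ` {1..n})" unfolding D_def
    by (subst card_Diff_subset) (auto intro: finite_subset)
  then have "card D \<le> 2" using small by simp
  have finD: "finite D" by (simp add: D_def)
  \<comment> \<open>\<open>D\<close> is the set of points that are not representatives. Every point
    goes to its representative or into \<open>D\<close> within its orbit, which leaves few cases
    when \<open>D\<close> has at most two points.\<close>
  have cls: "g x = r x \<or> g x \<in> D \<and> r (g x) = r x" if "x \<in> {1..n}" for x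
    using that D[of "g x"] g_in[OF that] r_g[OF that] by auto
  have moved: "g a \<noteq> a" "g (r a) \<noteq> r a" if a: "a \<in> D" for a
  proof -
    have a': "a \<in> {1..n}" "r a \<noteq> a" using D a by auto
    show "g a \<noteq> a" using fixed_iff(1)[OF a'(1)] a'(2) by blast
    show "g (r a) \<noteq> r a" using fixed_iff(2)[OF r_in[OF a'(1)], of a] r_idem[OF a'(1)] a' by auto
  qed
  have fixed: "g x = x" if x: "x \<notin> D \<union> r ` D" for x
  proof (cases "x \<in> {1..n}")
    case True
    then have "r x = x" using D x by auto
    moreover have "\<not> (g x \<in> D \<and> r (g x) = r x)" using x calculation by (metis UnI2 image_eqI)
    ultimately show ?thesis using cls[OF True] by auto
  qed (use g_perm in \<open>auto simp: permutes_def\<close>)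
  have inj: "g x = g y \<longleftrightarrow> x = y" for x y using permutes_inj[OF g_perm] by (auto simp: inj_def)
  have rD: "r a \<in> {1..n}" "r (r a) = r a" "r a \<notin> D" if "a \<in> D" for a
    using that D r_in r_idem by auto
  consider "card D = 0" | "card D = 1" | "card D = 2" using \<open>card D \<le> 2\<close> by linarith
  then have "g \<in> N"
  proof cases
    case 1
    then have "D = {}" using finD by simp
    then have "g = id" using fixed by (auto simp: fun_eq_iff)
    then show ?thesis using sub_id[OF N_sub] by simp
  next
    case 2
    then obtain a where Da: "D = {a}" by (auto simp: card_1_singleton_iff)
    define b where "b = r a"
    have a: "a \<in> {1..n}" "b \<noteq> a" "b \<in> {1..n}" "r b = b" using D[of a] rD[of a] Da
      by (auto simp: b_def)
    have "g a = b" using cls[OF a(1)] moved(1)[of a] Da by (auto simp: b_def)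
    moreover have "g b = a" using cls[OF a(3)] moved(2)[of a] Da a by (auto simp: b_def)
    ultimately have "g x = transpose a b x" for x
      using fixed[of x] Da by (auto simp: transpose_def b_def)
    then have "g = transpose a b" by blast
    then have "g \<in> transpositions n" unfolding transpositions_def using a by auto
    then show ?thesis using small_in_N gG(1) by blast
  next
    case 3
    then obtain a c where Dac: "D = {a, c}" "a \<noteq> c" by (auto simp: card_2_iff)
    define b where "b = r a"
    define e where "e = r c"
    have a: "a \<in> {1..n}" "b \<noteq> a" "b \<in> {1..n}" "r b = b" "b \<noteq> c" using D[of a] rD[of a] Dac
      by (auto simp: b_def)
    have c: "c \<in> {1..n}" "e \<noteq> c" "e \<in> {1..n}" "r e = e" "e \<noteq> a" using D[of c] rD[of c] Dac
      by (auto simp: e_def)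
    have ma: "g a \<noteq> a" "g b \<noteq> b" "g c \<noteq> c" "g e \<noteq> e" using moved[of a] moved[of c] Dac
      by (auto simp: b_def e_def)
    have out: "g x = x" if "x \<noteq> a" "x \<noteq> b" "x \<noteq> c" "x \<noteq> e" for x using fixed[of x] that Dac
      by (auto simp: b_def e_def)
    show ?thesis
    proof (cases "b = e")
      case True
      have ga: "g a = b \<or> g a = c" using cls[OF a(1)] ma Dac by (auto simp: b_def)
      have gb: "g b = a \<or> g b = c" using cls[OF a(3)] ma Dac a(4) by auto
      have gc: "g c = a \<or> g c = b" using cls[OF c(1)] ma Dac True by (auto simp: e_def)
      have cyc_a: "b \<in> cyc g a" "c \<in> cyc g a"
        using r_cyc[OF a(1)] r_eq_iff[OF c(1) a(1)] cyc_self[of c g] True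
          by (auto simp: b_def e_def)
      \<comment> \<open>The orbit of \<open>a\<close> contains both \<open>b\<close> and
        \<open>c\<close>, so \<open>g\<close> cannot exchange \<open>a\<close> with just one of
        them.\<close>
      have no: "\<not> (g a = y \<and> g y = a)" if "{b, c} - {y} \<noteq> {}" for y
        using cyc_least[of a "{a, y}" g] cyc_a that a(2) Dac(2) by auto
      have "\<not> (g a = b \<and> g b = a)" "\<not> (g a = c \<and> g c = a)" using no[of b] no[of c] a(5) by auto
      then consider "g a = b" "g b = c" "g c = a" | "g a = c" "g c = b" "g b = a"
        using ga gb gc inj a(2,5) Dac(2) by metis
      then have "g \<in> three_cycles n"
      proof cases
        case 1
        have "g x = cycle_of_list [a, b, c] x" for x
          using out[of x] 1 a Dac(2) True by (auto simp: transpose_def)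
        then have "g = cycle_of_list [a, b, c]" by blast
        then show ?thesis using a c Dac(2) by (intro CollectI exI[of _ "[a, b, c]"]) auto
      next
        case 2
        have "g x = cycle_of_list [a, c, b] x" for x
          using out[of x] 2 a Dac(2) True by (auto simp: transpose_def)
        then have "g = cycle_of_list [a, c, b]" by blast
        then show ?thesis using a c Dac(2) by (intro CollectI exI[of _ "[a, c, b]"]) auto
      qed
      then show ?thesis using small_in_N gG(1) by blast
    next
      case False
      have "g a = b" using cls[OF a(1)] ma Dac False by (auto simp: b_def e_def)
      moreover have "g b = a" using cls[OF a(3)] ma Dac a(4) False by (auto simp: e_def)
      moreover have "g c = e" using cls[OF c(1)] ma Dac False by (auto simp: b_def e_def)
      moreover have "g e = c" using cls[OF c(3)] ma Dac c(4) False by (auto simp: b_def)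
      ultimately have "g x = (transpose a b \<circ> transpose c e) x" for x
        using out[of x] a c Dac(2) False by (auto simp: transpose_def)
      then have "g = transpose a b \<circ> transpose c e" by blast
      moreover have "distinct [a, b, c, e]" using a(2,5) c(2,5) Dac(2) False by simp
      moreover have "{a, b, c, e} \<subseteq> {1..n}" using a(1,3) c(1,3) by blast
      ultimately have "g \<in> double_transpositions n"
        unfolding double_transpositions_def
        by (intro CollectI exI[of _ a] exI[of _ b] exI[of _ c] exI[of _ e]) (intro conjI)
      then show ?thesis using small_in_N gG(1) by blast
    qed
  qed
  then show False using gG(2) by blast
qed

subsection \<open>A homomorphism on the inertia group\<close>

definition I :: "(nat \<Rightarrow> nat) set" where
  "I = {\<sigma> \<in> G. \<forall>i\<in>{1..n}. r (\<sigma> i) = r i}"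

definition full :: "(nat \<Rightarrow> nat) \<Rightarrow> bool" where
  "full h \<longleftrightarrow> (\<forall>x\<in>{1..n}. cyc h x = cyc g x)"

abbreviation "\<Gamma> \<equiv> (sym_group n)\<lparr>carrier := I\<rparr>"

text \<open>By minimality of \<open>g\<close> the generators lie in \<open>N\<close>, so
  \<open>g\<close> survives in the quotient by \<open>H\<close>, while every element of
  \<open>I\<close> outside \<open>H\<close> has the cycle lengths of \<open>g\<close>.\<close>

definition H :: "(nat \<Rightarrow> nat) set" where
  "H = generate \<Gamma> {h \<in> I. \<not> full h}"

lemma G_in: "\<sigma> \<in> G \<Longrightarrow> x \<in> {1..n} \<Longrightarrow> \<sigma> x \<in> {1..n}"
  using permutes_in_image[OF G_perm] by blast

lemma I_sub: "subgroup I (sym_group n)"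
proof (rule S.subgroupI)
  show "I \<subseteq> carrier (sym_group n)" using subgroup.subset[OF G] by (auto simp: I_def)
  show "I \<noteq> {}" using sub_id[OF G] by (auto simp: I_def)
  show "\<sigma> \<otimes>\<^bsub>sym_group n\<^esub> \<tau> \<in> I" if "\<sigma> \<in> I" "\<tau> \<in> I" for \<sigma> \<tau>
    using that sub_comp[OF G, of \<sigma> \<tau>] G_in by (auto simp: I_def sym_group_mult)
  show "inv\<^bsub>sym_group n\<^esub> \<sigma> \<in> I" if s: "\<sigma> \<in> I" for \<sigma>
  proof -
    have sG: "\<sigma> \<in> G" using s by (simp add: I_def)
    have "r (inv' \<sigma> i) = r i" if i: "i \<in> {1..n}" for i
    proof -
      have "r (\<sigma> (inv' \<sigma> i)) = r (inv' \<sigma> i)" using s G_in[OF sub_inv[OF G sG] i]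
        by (simp add: I_def)
      then show ?thesis using permutes_inverses(1)[OF G_perm[OF sG]] by simp
    qed
    then show ?thesis using sub_inv[OF G sG] subgroup.mem_carrier[OF G sG] by (simp add: I_def)
  qed
qed

sublocale \<Gamma>: group \<Gamma> by (rule S.subgroup_imp_group[OF I_sub])

lemma I_G: "\<sigma> \<in> I \<Longrightarrow> \<sigma> \<in> G" and I_perm: "\<sigma> \<in> I \<Longrightarrow> \<sigma> permutes {1..n}"
  using G_perm by (auto simp: I_def)

lemma I_cyc: assumes s: "\<sigma> \<in> I" and x: "x \<in> {1..n}" shows "cyc g (\<sigma> x) = cyc g x"
proof -
  have "r (\<sigma> x) = r x" using s x by (simp add: I_def)
  then show ?thesis using r_eq_iff[OF G_in[OF I_G[OF s] x] x] by simp
qed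

lemma I_cyc_sub: assumes s: "\<sigma> \<in> I" and x: "x \<in> {1..n}" shows "cyc \<sigma> x \<subseteq> cyc g x"
proof (rule cyc_least)
  show "x \<in> cyc g x" by (rule cyc_self)
  fix y assume y: "y \<in> cyc g x"
  then have "y \<in> {1..n}" using cyc_in[OF g_perm x] by blast
  then have "cyc g (\<sigma> y) = cyc g x" using I_cyc[OF s] cyc_eq[OF g_perm y] by simp
  then show "\<sigma> y \<in> cyc g x" using cyc_self by blast
qed

lemma g_I: "g \<in> I"
  using gG(1) r_g by (simp add: I_def)

lemma H_sub_N: "H \<subseteq> N"
proof -
  have "h \<in> N" if "h \<in> I" "\<not> full h" for h
    using finest_cyc[OF I_G[OF that(1)]] I_cyc_sub[OF that(1)] that(2) by (auto simp: full_def)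
  then have "generate (sym_group n) {h \<in> I. \<not> full h} \<subseteq> N"
    by (intro S.generate_subgroup_incl[OF _ N_sub]) auto
  then show ?thesis unfolding H_def using S.generate_consistent[OF _ I_sub, of "{h \<in> I. \<not> full h}"]
    by auto
qed

text \<open>An element of \<open>I\<close> maps each orbit of \<open>g\<close> to itself, so
  conjugation by it respects having the same orbits as \<open>g\<close>. This makes \<open>H\<close>
  normal.\<close>

lemma full_conj:
  assumes s: "\<sigma> \<in> I" and h: "h \<in> I" and f: "full (\<sigma> \<circ> h \<circ> inv' \<sigma>)"
  shows "full h"
  unfolding full_def
proof
  fix x assume x: "x \<in> {1..n}"
  let ?h = "\<sigma> \<circ> h \<circ> inv' \<sigma>"
  have pow: "(?h ^^ j) (\<sigma> y) = \<sigma> ((h ^^ j) y)" for j y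
    by (induction j) (use permutes_inverses(2)[OF I_perm[OF s]] in auto)
  have "cyc g x \<subseteq> cyc h x"
  proof
    fix z assume z: "z \<in> cyc g x"
    then have zn: "z \<in> {1..n}" using cyc_in[OF g_perm x] by blast
    have "\<sigma> z \<in> cyc g (\<sigma> x)"
      using I_cyc[OF s x] I_cyc[OF s zn] cyc_eq[OF g_perm z] cyc_self[of "\<sigma> z" g] by simp
    also have "cyc g (\<sigma> x) = cyc ?h (\<sigma> x)" using f G_in[OF I_G[OF s] x] by (simp add: full_def)
    finally obtain j where "\<sigma> z = \<sigma> ((h ^^ j) x)" unfolding cyc_def pow by blast
    then have "z = (h ^^ j) x" using permutes_inj[OF I_perm[OF s]] by (simp add: inj_def)
    then show "z \<in> cyc h x" by (auto simp: cyc_def)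
  qed
  then show "cyc h x = cyc g x" using I_cyc_sub[OF h x] by blast
qed

sublocale H: normal H \<Gamma>
  unfolding H_def
proof (rule \<Gamma>.normal_generateI)
  fix h \<sigma> assume h: "h \<in> {h \<in> I. \<not> full h}" and s: "\<sigma> \<in> carrier \<Gamma>"
  then have s: "\<sigma> \<in> I" by simp
  have "inv\<^bsub>\<Gamma>\<^esub> \<sigma> = inv' \<sigma>"
    using S.m_inv_consistent[OF I_sub s] I_perm[OF s] by (simp add: sym_group_carrier)
  moreover have "\<sigma> \<circ> h \<circ> inv' \<sigma> \<in> I" using sub_comp[OF I_sub] sub_inv[OF I_sub] s h by blast
  ultimately show "\<sigma> \<otimes>\<^bsub>\<Gamma>\<^esub> h \<otimes>\<^bsub>\<Gamma>\<^esub> inv\<^bsub>\<Gamma>\<^esub> \<sigma> \<in> {h \<in> I. \<not> full h}"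
    using full_conj[OF s] h by (auto simp: sym_group_mult)
qed auto

lemma full_outside_H: "h \<in> I \<Longrightarrow> h \<notin> H \<Longrightarrow> full h"
proof (rule ccontr)
  assume h: "h \<in> I" "h \<notin> H" "\<not> full h"
  then have "h \<in> H" unfolding H_def by (intro generate.incl) simp
  then show False using h(2) by simp
qed

text \<open>\<open>h\<close> has the cycle lengths of \<open>g\<close>, and these divide
  \<open>d\<close>.\<close>

lemma full_pow_d: assumes h: "h \<in> I" "full h" shows "h ^^ d = id"
proof (rule permutes_eq_idI[OF permutes_funpow[OF I_perm[OF h(1)]]])
  fix x assume x: "x \<in> {1..n}"
  have "least_power h x = least_power g x"
    using card_cyc[OF I_perm[OF h(1)], of x] card_cyc[OF g_perm, of x] h(2) x
      by (simp add: full_def)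
  then show "(h ^^ d) x = x"
    using least_power_dvd_d[of x] least_power_dvd[OF permutes_permutation[OF I_perm[OF h(1)]], of x d] by simp
qed

abbreviation "Q \<equiv> \<Gamma> Mod H"

sublocale Q: group Q by (rule H.factorgroup_is_group)

lemma coset_pow: assumes "\<sigma> \<in> I" shows "(H #>\<^bsub>\<Gamma>\<^esub> \<sigma>) [^]\<^bsub>Q\<^esub> (k::nat) = H #>\<^bsub>\<Gamma>\<^esub> (\<sigma> ^^ k)"
proof (induction k)
  case 0
  have "H #>\<^bsub>\<Gamma>\<^esub> id = H" using H.rcos_const[OF \<Gamma>.group_axioms H.one_closed]
    by (simp add: sym_group_one)
  then show ?case by (simp add: id_def)
next
  case (Suc k)
  have "H #>\<^bsub>\<Gamma>\<^esub> (\<sigma> ^^ k) <#>\<^bsub>\<Gamma>\<^esub> (H #>\<^bsub>\<Gamma>\<^esub> \<sigma>) = H #>\<^bsub>\<Gamma>\<^esub> (\<sigma> ^^ k \<circ> \<sigma>)"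
    using H.rcos_sum[of "\<sigma> ^^ k" \<sigma>] assms sub_pow[OF I_sub] by (simp add: sym_group_mult)
  moreover have "\<sigma> ^^ k \<circ> \<sigma> = \<sigma> ^^ Suc k" by (simp only: funpow_Suc_right)
  ultimately show ?case using Suc by (simp add: comp_def)
qed

text \<open>Sylow's theorem with exponent 1 gives a subgroup of order \<open>q\<close>. A
  representative \<open>y\<close> of a nontrivial class in it lies outside \<open>H\<close>, so its
  order divides \<open>p ^ l\<close>, while \<open>y ^^ q \<in> H\<close>; for
  \<open>q \<noteq> p\<close> Bezout puts \<open>y\<close> into \<open>H\<close>.\<close>

lemma prime_dvd_order_Q:
  assumes d: "d = p ^ l" "prime p" and q: "prime q" "q dvd Coset.order Q"
  shows "q = p"
proof (rule ccontr)
  assume "q \<noteq> p"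
  have finI: "finite I" using I_sub subgroup.subset finite_sym_group finite_subset by metis
  then have finQ: "finite (carrier Q)" unfolding carrier_FactGroup by simp
  obtain m where "Coset.order Q = q ^ 1 * m" using q(2) by auto
  then obtain L where L: "subgroup L Q" "card L = q"
    using sylow_thm[OF q(1) Q.group_axioms _ finQ, of 1 m] by auto
  have "L \<noteq> {\<one>\<^bsub>Q\<^esub>}" using L(2) prime_gt_1_nat[OF q(1)] by auto
  then obtain c where c: "c \<in> L" "c \<noteq> \<one>\<^bsub>Q\<^esub>" using subgroup.one_closed[OF L(1)] by blast
  interpret L: group "Q\<lparr>carrier := L\<rparr>" by (rule Q.subgroup_imp_group[OF L(1)])
  have "c [^]\<^bsub>Q\<^esub> q = \<one>\<^bsub>Q\<^esub>"
    using L.pow_order_eq_1[of c] c(1) L(2) Q.nat_pow_consistent[of c q L]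
      by (simp add: Coset.order_def)
  moreover obtain y where y: "y \<in> I" "c = H #>\<^bsub>\<Gamma>\<^esub> y"
    using subgroup.mem_carrier[OF L(1) c(1)] unfolding carrier_FactGroup by auto
  ultimately have "H #>\<^bsub>\<Gamma>\<^esub> (y ^^ q) = H" using coset_pow[OF y(1), of q] by simp
  then have yq: "y ^^ q \<in> H"
    using \<Gamma>.rcos_self[OF _ H.subgroup_axioms, of "y ^^ q"] sub_pow[OF I_sub y(1)] by simp
  have "y \<notin> H" using c(2) y(2) H.rcos_const[OF \<Gamma>.group_axioms] by auto
  then have yd: "y ^^ (p ^ l) = id" using full_pow_d full_outside_H y(1) d(1) by simp
  have "coprime q (p ^ l)" using \<open>q \<noteq> p\<close> q(1) d(2) by (simp add: primes_coprime)
  then obtain u v where uv: "q * u = p ^ l * v + 1"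
    using bezout_nat[of q "p ^ l"] q(1) by (metis coprime_imp_gcd_eq_1 not_prime_0)
  have "(y ^^ q) ^^ u = y \<circ> (y ^^ (p ^ l)) ^^ v" by (simp add: funpow_mult uv)
  also have "\<dots> = y" using yd by (simp add: id_funpow)
  finally have "(y ^^ q) ^^ u = y" .
  moreover have "(y ^^ q) ^^ j \<in> H" for j
  proof (induction j)
    case 0
    then show ?case using H.one_closed by (simp add: sym_group_one id_def)
  next
    case (Suc j)
    then show ?case using H.m_closed[OF yq Suc] by (simp add: sym_group_mult comp_def)
  qed
  ultimately show False using \<open>y \<notin> H\<close> by metis
qed

lemma hom_exists:
  assumes d: "d = p ^ l" "prime p"
  shows "\<exists>f :: (nat \<Rightarrow> nat) \<Rightarrow> nat. (\<forall>\<sigma>\<in>I. \<forall>\<tau>\<in>I. f (\<sigma> \<circ> \<tau>) mod p = (f \<sigma> + f \<tau>) mod p) \<and>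
    (\<exists>\<sigma>\<in>I. f \<sigma> mod p \<noteq> 0) \<and> (\<forall>\<sigma>\<in>H. f \<sigma> mod p = 0)"
proof -
  have finI: "finite I" using I_sub subgroup.subset finite_sym_group finite_subset by metis
  then have finQ: "finite (carrier Q)" unfolding carrier_FactGroup by simp
  have "Coset.order Q \<noteq> 0" using finQ Q.one_closed by (auto simp: Coset.order_def)
  then obtain t where t: "Coset.order Q = p ^ t"
    using unique_prime_divisor_imp_power[OF _ d(2)] prime_dvd_order_Q[OF d] by blast
  \<comment> \<open>The class of \<open>g\<close> is nontrivial because
    \<open>H \<subseteq> N\<close> and \<open>g \<notin> N\<close>.\<close>
  have "t > 0"
  proof (rule ccontr)
    assume "\<not> t > 0"
    then have "card (carrier Q) = 1" using t by (simp add: Coset.order_def)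
    then have "carrier Q = {H}" using Q.one_closed by (auto simp: card_1_singleton_iff)
    moreover have "H #>\<^bsub>\<Gamma>\<^esub> g \<in> carrier Q" using g_I unfolding carrier_FactGroup by auto
    ultimately have "g \<in> H" using \<Gamma>.rcos_self[OF _ H.subgroup_axioms, of g] g_I by auto
    then show False using H_sub_N gG(2) by blast
  qed
  then obtain F :: "(nat \<Rightarrow> nat) set \<Rightarrow> nat" where
    F: "\<And>a b. a \<in> carrier Q \<Longrightarrow> b \<in> carrier Q \<Longrightarrow> F (a \<otimes>\<^bsub>Q\<^esub> b) mod p = (F a + F b) mod p"
      "\<exists>a\<in>carrier Q. F a mod p \<noteq> 0"
    using Q.p_group_hom_exists[OF d(2) t] by blast
  have cos: "H #>\<^bsub>\<Gamma>\<^esub> \<sigma> \<in> carrier Q" if "\<sigma> \<in> I" for \<sigma> using that unfolding carrier_FactGroup by auto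
  have "F (H #>\<^bsub>\<Gamma>\<^esub> (\<sigma> \<circ> \<tau>)) mod p = (F (H #>\<^bsub>\<Gamma>\<^esub> \<sigma>) + F (H #>\<^bsub>\<Gamma>\<^esub> \<tau>)) mod p" if "\<sigma> \<in> I"
    "\<tau> \<in> I" for \<sigma> \<tau>
    using F(1)[OF cos[OF that(1)] cos[OF that(2)]] H.rcos_sum[of \<sigma> \<tau>] that
      by (simp add: sym_group_mult)
  moreover have "\<exists>\<sigma>\<in>I. F (H #>\<^bsub>\<Gamma>\<^esub> \<sigma>) mod p \<noteq> 0" using F(2) unfolding carrier_FactGroup by auto
  moreover have "F (H #>\<^bsub>\<Gamma>\<^esub> \<sigma>) mod p = 0" if "\<sigma> \<in> H" for \<sigma>
  proof -
    have "F H mod p = (F H + F H) mod p"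
      using F(1)[OF Q.one_closed Q.one_closed] Q.l_one[OF Q.one_closed] by simp
    then have "p dvd F H" using mod_eq_dvd_iff_nat[of "F H" "F H + F H" p] by simp
    then show ?thesis using H.rcos_const[OF \<Gamma>.group_axioms that] by simp
  qed
  ultimately show ?thesis by (intro exI[of _ "\<lambda>\<sigma>. F (H #>\<^bsub>\<Gamma>\<^esub> \<sigma>)"]) blast
qed

text \<open>The homomorphism to the integers modulo \<open>p\<close> is followed by the embedding of
  the prime field into \<open>'k\<close>. It vanishes on \<open>H\<close>, so nonzero values occur
  only at elements with the orbits of \<open>g\<close>.\<close>

lemma exists_inertia_cocycle:
  assumes d: "d = p ^ l" "prime p" and char: "CHAR('k::field) = p"
  shows "\<exists>(\<phi> :: (nat \<Rightarrow> nat) \<Rightarrow> 'k) \<sigma>0. inertia_cocycle n G r \<phi> p \<sigma>0 I"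
proof -
  obtain f :: "(nat \<Rightarrow> nat) \<Rightarrow> nat" and \<sigma>0 where f: "\<And>\<sigma> \<tau>. \<sigma> \<in> I \<Longrightarrow> \<tau> \<in> I \<Longrightarrow> f (\<sigma> \<circ> \<tau>) mod p =
    (f \<sigma> + f \<tau>) mod p"
    and s0: "\<sigma>0 \<in> I" "f \<sigma>0 mod p \<noteq> 0" and fH: "\<And>\<sigma>. \<sigma> \<in> H \<Longrightarrow> f \<sigma> mod p = 0"
    using hom_exists[OF d] by blast
  have of_mod: "of_nat (a mod p) = (of_nat a :: 'k)" for a
  proof -
    have "(of_nat a :: 'k) = of_nat (p * (a div p) + a mod p)" by simp
    also have "\<dots> = of_nat p * of_nat (a div p) + of_nat (a mod p)"
      by (simp only: of_nat_add of_nat_mult)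
    finally show ?thesis using of_nat_CHAR[where 'a = 'k] char by simp
  qed
  have zero_iff: "(of_nat a :: 'k) = 0 \<longleftrightarrow> a mod p = 0" for a
    using of_nat_eq_0_iff_char_dvd[of a, where 'a = 'k] char by (simp add: dvd_eq_mod_eq_0)
  have "inertia_cocycle n G r (\<lambda>\<sigma>. of_nat (f \<sigma>) :: 'k) p \<sigma>0 I"
  proof (rule inertia_cocycle.intro)
    show "subgroup G (sym_group n)" by (rule G)
    show "r i \<in> {1..n}" if "i \<in> {1..n}" for i using r_in[OF that] .
    show "I = {\<sigma> \<in> G. \<forall>i\<in>{1..n}. r (\<sigma> i) = r i}" by (rule I_def)
    show "of_nat (f (\<sigma> \<circ> \<tau>)) = (of_nat (f \<sigma>) + of_nat (f \<tau>) :: 'k)" if "\<sigma> \<in> I" "\<tau> \<in> I" for \<sigma> \<tau>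
    proof -
      have "(of_nat (f (\<sigma> \<circ> \<tau>)) :: 'k) = of_nat ((f \<sigma> + f \<tau>) mod p)"
        unfolding f[OF that, symmetric] by (rule of_mod[symmetric])
      also have "\<dots> = of_nat (f \<sigma> + f \<tau>)" by (rule of_mod)
      finally show ?thesis by simp
    qed
    show "\<sigma>0 \<in> I" by (rule s0(1))
    show "(of_nat (f \<sigma>0) :: 'k) \<noteq> 0" unfolding zero_iff by (rule s0(2))
    show "\<exists>j. (of_nat (f \<sigma>) :: 'k) = of_nat j * of_nat (f \<sigma>0)" if "\<sigma> \<in> I" for \<sigma>
    proof -
      have "coprime p (f \<sigma>0)" using d(2) s0(2) by (metis dvd_eq_mod_eq_0 prime_imp_coprime)
      then have "coprime (f \<sigma>0) p" by (simp add: coprime_commute)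
      moreover have "f \<sigma>0 \<noteq> 0" using s0(2) by (cases "f \<sigma>0 = 0") simp_all
      \<comment> \<open>\<open>u\<close> inverts \<open>f \<sigma>0\<close> modulo \<open>p\<close>,
        so \<open>f \<sigma> * u\<close> is the required multiple.\<close>
      ultimately obtain u v where uv: "f \<sigma>0 * u = p * v + 1"
        using bezout_nat[of "f \<sigma>0" p] by (metis coprime_imp_gcd_eq_1)
      have "of_nat (f \<sigma>0) * of_nat u = (of_nat (p * v + 1) :: 'k)" unfolding uv[symmetric] by simp
      also have "\<dots> = 1" using of_nat_CHAR[where 'a = 'k] char by simp
      finally have "(of_nat (f \<sigma>) :: 'k) = of_nat (f \<sigma> * u) * of_nat (f \<sigma>0)" by (simp add: mult_ac)
      then show ?thesis by blast
    qed
    show "\<exists>j. (\<sigma> ^^ j) i = r i" if s: "\<sigma> \<in> I" "(of_nat (f \<sigma>) :: 'k) \<noteq> 0" and i: "i \<in> {1..n}" for \<sigma> i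
    proof -
      have "\<sigma> \<notin> H" using s(2) fH[of \<sigma>] unfolding zero_iff by (rule contrapos_nn)
      then have "full \<sigma>" by (rule full_outside_H[OF s(1)])
      then have "r i \<in> cyc \<sigma> i" using r_cyc[OF i] i by (simp add: full_def)
      then show ?thesis by (auto simp: cyc_def)
    qed
  qed (use char d in auto)
  then show ?thesis by blast
qed

end

text \<open>As \<open>l > 0\<close>, the prime \<open>p\<close> is determined by the order of
  \<open>g\<close>; hence it is the same for every instance of the field type
  \<open>'k\<close>.\<close>

theorem proposition4:
  fixes n :: nat and G N :: "(nat \<Rightarrow> nat) set" and g :: "nat \<Rightarrow> nat"
  assumes G: "subgroup G (sym_group n)"
    and N: "N = small_subgroup n G"
    and proper: "N \<subset> G"
    and g: "g \<in> G - N"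
    and finest: "\<forall>h \<in> G - N. h \<noteq> g \<longrightarrow>
       \<not> properly_refines {1..n} (orbit_partition n h) (orbit_partition n g)"
  shows "\<exists>p l. prime p \<and> l > 0 \<and> group.ord (sym_group n) g = p ^ l \<and>
    (CHAR('k::field) = p \<longrightarrow> \<not> cohen_macaulay (invariant_ring n G :: 'k mpoly ring))"
proof -
  interpret finest_element n G N g by (rule finest_element.intro[OF G N g finest])
  obtain p l where p: "prime p" "l > 0" "d = p ^ l" using order_prime_power by blast
  have "\<not> cohen_macaulay (invariant_ring n G :: 'k mpoly ring)" if char: "CHAR('k) = p"
  proof -
    obtain \<phi> :: "(nat \<Rightarrow> nat) \<Rightarrow> 'k" and \<sigma>0 where "inertia_cocycle n G r \<phi> p \<sigma>0 I"
      using exists_inertia_cocycle[OF p(3,1) char] by blast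
    then show ?thesis by (rule inertia_cocycle.not_cohen_macaulay) (use r_idem codim in auto)
  qed
  then show ?thesis using p by blast
qed

end
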